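(* Let $(\mathcal C,\mathcal D)$ be a regular MASA inclusion, let $(I(\mathcal D),\iota)$ be an injective envelope of $\mathcal D$, and let $E:\mathcal C\to I(\mathcal D)$ be the pseudo-expectation for $\iota$. Then the left kernel of $E$, $$\mathcal L(\mathcal C,\mathcal D):=\{x\in\mathcal C: E(x^*x)=0\},$$ is an ideal of $\mathcal C$ such that $\mathcal L(\mathcal C,\mathcal D)\cap\mathcal D=(0)$. Moreover, if $\mathcal K\subseteq\mathcal C$ is an ideal such that $\mathcal K\cap\mathcal D=(0)$, then $\mathcal K\subseteq\mathcal L(\mathcal C,\mathcal D)$.
   Context: All $C^*$-algebras are unital. An inclusion is a pair $(\mathcal C,\mathcal D)$ where $\mathcal C$ is a unital $C^*$-algebra and $\mathcal D\subseteq\mathcal C$ is an abelian $C^*$-subalgebra containing the unit of $\mathcal C$. Its set of normalizers is $\mathcal N(\mathcal C,\mathcal D)=\{v\in\mathcal C: v^*\mathcal Dv\cup v\mathcal Dv^*\subseteq\mathcal D\}$. The inclusion is regular if $\operatorname{span}\mathcal N(\mathcal C,\mathcal D)$ is norm dense in $\mathcal C$, and a MASA inclusion if $\mathcal D$ is a maximal abelian $C^*$-subalgebra of $\mathcal C$; a regular MASA inclusion is both. An injective envelope of a unital abelian $C^*$-algebra $\mathcal D$ is a pair $(I(\mathcal D),\iota)$ with $I(\mathcal D)$ an injective unital abelian $C^*$-algebra and $\iota:\mathcal D\to I(\mathcal D)$ a unital injective $*$-homomorphism which is a rigid and essential extension. A pseudo-expectation for $\iota$ is a unital completely positive map $E:\mathcal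 C\to I(\mathcal D)$ with $E|_{\mathcal D}=\iota$; for a regular MASA inclusion there is exactly one. "Ideal" means norm-closed two-sided ideal. *)

theory Defs
  imports "HOL-Analysis.Analysis" "HOL-Algebra.Module"
begin

section \<open>Unital C*-algebras as a type class\<close>

class cstar_algebra = real_normed_algebra_1 + banach +
  fixes scaleC :: "complex \<Rightarrow> 'a \<Rightarrow> 'a"  (infixr \<open>*\<^sub>C\<close> 75)
    and star :: "'a \<Rightarrow> 'a"
  assumes scaleC_add_right: "a *\<^sub>C (x + y) = a *\<^sub>C x + a *\<^sub>C y"
    and scaleC_add_left: "(a + b) *\<^sub>C x = a *\<^sub>C x + b *\<^sub>C x"
    and scaleC_scaleC: "a *\<^sub>C b *\<^sub>C x = (a * b) *\<^sub>C x"
    and scaleR_scaleC: "r *\<^sub>R x = complex_of_real r *\<^sub>C x"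
    and mult_scaleC_left: "(a *\<^sub>C x) * y = a *\<^sub>C (x * y)"
    and mult_scaleC_right: "x * (a *\<^sub>C y) = a *\<^sub>C (x * y)"
    and norm_scaleC: "norm (a *\<^sub>C x) = cmod a * norm x"
    and star_add: "star (x + y) = star x + star y"
    and star_scaleC: "star (a *\<^sub>C x) = cnj a *\<^sub>C star x"
    and star_mult: "star (x * y) = star y * star x"
    and star_star: "star (star x) = x"
    and cstar_identity: "norm (star x * x) = (norm x)\<^sup>2"

lemma scaleC_one: "1 *\<^sub>C x = (x :: 'a :: cstar_algebra)"
  using scaleR_scaleC[of 1 x] by simp

global_interpretation complex_vector: vector_space
  "scaleC :: complex \<Rightarrow> 'a \<Rightarrow> 'a :: cstar_algebra"
  defines csubspace = complex_vector.subspace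
    and cspan = complex_vector.span
  by unfold_locales (simp_all add: scaleC_add_right scaleC_add_left scaleC_scaleC scaleC_one)


section \<open>Inclusions, normalizers, ideals\<close>

definition cstar_subalgebra :: "'a :: cstar_algebra set \<Rightarrow> bool" where
  "cstar_subalgebra B \<longleftrightarrow> csubspace B \<and> closed B \<and>
     (\<forall>x\<in>B. \<forall>y\<in>B. x * y \<in> B) \<and> (\<forall>x\<in>B. star x \<in> B)"

definition abelian_cstar_subalgebra :: "'a :: cstar_algebra set \<Rightarrow> bool" where
  "abelian_cstar_subalgebra B \<longleftrightarrow> cstar_subalgebra B \<and> (\<forall>x\<in>B. \<forall>y\<in>B. x * y = y * x)"

text \<open>In the following notions the algebra \<open>\<C>\<close> of a pair \<open>(\<C>, \<D>)\<close> is the whole type.\<close>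

definition inclusion :: "'a :: cstar_algebra set \<Rightarrow> bool" where
  "inclusion D \<longleftrightarrow> abelian_cstar_subalgebra D \<and> 1 \<in> D"

definition normalizers :: "'a :: cstar_algebra set \<Rightarrow> 'a set" where
  "normalizers D = {v. (\<lambda>d. star v * d * v) ` D \<union> (\<lambda>d. v * d * star v) ` D \<subseteq> D}"

definition regular_inclusion :: "'a :: cstar_algebra set \<Rightarrow> bool" where
  "regular_inclusion D \<longleftrightarrow> inclusion D \<and> closure (cspan (normalizers D)) = UNIV"

definition masa_inclusion :: "'a :: cstar_algebra set \<Rightarrow> bool" where
  "masa_inclusion D \<longleftrightarrow> inclusion D \<and>
     (\<forall>B. abelian_cstar_subalgebra B \<and> D \<subseteq> B \<longrightarrow> B = D)"

definition regular_masa_inclusion :: "'a :: cstar_algebra set \<Rightarrow> bool" where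
  "regular_masa_inclusion D \<longleftrightarrow> regular_inclusion D \<and> masa_inclusion D"

definition cstar_ideal :: "'a :: cstar_algebra set \<Rightarrow> bool" where
  "cstar_ideal K \<longleftrightarrow> csubspace K \<and> closed K \<and> (\<forall>a. \<forall>x\<in>K. a * x \<in> K \<and> x * a \<in> K)"


section \<open>C*-algebras on carrier sets\<close>

text \<open>
  Injectivity and essentiality quantify over arbitrary operator systems. As HOL cannot quantify
  over types inside a formula, the test objects are operator systems in C*-algebras whose carrier
  is a subset of a type \<open>'u\<close>.
\<close>

definition complex_ring :: "complex ring" where
  "complex_ring = \<lparr>carrier = UNIV, mult = (*), one = 1, zero = 0, add = (+)\<rparr>"

record 'u cstar_struct = "(complex, 'u) module" +
  adj :: "'u \<Rightarrow> 'u"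
  nrm :: "'u \<Rightarrow> real"

locale cstar_structure = ring A for A :: "'u cstar_struct" (structure) +
  assumes module: "module complex_ring A"
    and smult_mult_left: "\<lbrakk>x \<in> carrier A; y \<in> carrier A\<rbrakk> \<Longrightarrow> (a \<odot> x) \<otimes> y = a \<odot> (x \<otimes> y)"
    and smult_mult_right: "\<lbrakk>x \<in> carrier A; y \<in> carrier A\<rbrakk> \<Longrightarrow> x \<otimes> (a \<odot> y) = a \<odot> (x \<otimes> y)"
    and adj_closed: "x \<in> carrier A \<Longrightarrow> adj A x \<in> carrier A"
    and adj_add: "\<lbrakk>x \<in> carrier A; y \<in> carrier A\<rbrakk> \<Longrightarrow> adj A (x \<oplus> y) = adj A x \<oplus> adj A y"
    and adj_smult: "x \<in> carrier A \<Longrightarrow> adj A (a \<odot> x) = cnj a \<odot> adj A x"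
    and adj_mult: "\<lbrakk>x \<in> carrier A; y \<in> carrier A\<rbrakk> \<Longrightarrow> adj A (x \<otimes> y) = adj A y \<otimes> adj A x"
    and adj_adj: "x \<in> carrier A \<Longrightarrow> adj A (adj A x) = x"
    and nrm_nonneg: "x \<in> carrier A \<Longrightarrow> 0 \<le> nrm A x"
    and nrm_eq_0: "x \<in> carrier A \<Longrightarrow> nrm A x = 0 \<longleftrightarrow> x = \<zero>"
    and nrm_triangle: "\<lbrakk>x \<in> carrier A; y \<in> carrier A\<rbrakk> \<Longrightarrow> nrm A (x \<oplus> y) \<le> nrm A x + nrm A y"
    and nrm_smult: "x \<in> carrier A \<Longrightarrow> nrm A (a \<odot> x) = cmod a * nrm A x"
    and nrm_mult: "\<lbrakk>x \<in> carrier A; y \<in> carrier A\<rbrakk> \<Longrightarrow> nrm A (x \<otimes> y) \<le> nrm A x * nrm A y"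
    and nrm_cstar: "x \<in> carrier A \<Longrightarrow> nrm A (adj A x \<otimes> x) = (nrm A x)\<^sup>2"
    and nrm_complete:
      "\<lbrakk>range \<sigma> \<subseteq> carrier A; \<And>e. 0 < e \<Longrightarrow> \<exists>N. \<forall>m\<ge>N. \<forall>n\<ge>N. nrm A (\<sigma> m \<ominus> \<sigma> n) < e\<rbrakk>
        \<Longrightarrow> \<exists>x\<in>carrier A. (\<lambda>n. nrm A (\<sigma> n \<ominus> x)) \<longlonglongrightarrow> 0"

definition univ_cstar :: "'a :: cstar_algebra cstar_struct" where
  "univ_cstar = \<lparr>carrier = UNIV, mult = (*), one = 1, zero = 0, add = (+), smult = scaleC,
     adj = star, nrm = norm\<rparr>"

lemma univ_cstar_simps [simp]:
  "carrier univ_cstar = UNIV" "mult univ_cstar = (*)" "one univ_cstar = 1"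
  "zero univ_cstar = 0" "add univ_cstar = (+)" "smult univ_cstar = scaleC"
  "adj univ_cstar = star" "nrm univ_cstar = norm"
  by (simp_all add: univ_cstar_def)

lemma cstar_structure_univ_cstar: "cstar_structure (univ_cstar :: 'a :: cstar_algebra cstar_struct)"
proof -
  let ?A = "univ_cstar :: 'a cstar_struct"
  have grp: "abelian_group ?A"
    by (rule abelian_groupI) (auto simp: add.assoc add.commute intro: exI[of _ "- _"] left_minus)
  interpret A: ring ?A
    by (rule ringI[OF grp]) (auto intro: Group.monoidI simp: mult.assoc algebra_simps)
  have minus: "a_minus ?A x y = x - y" for x y
  proof -
    have "a_inv ?A y = - y"
      by (rule A.minus_equality) simp_all
    then show ?thesis by (simp add: a_minus_def)
  qed
  have C: "cring complex_ring"
  proof (rule cringI)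
    show "abelian_group complex_ring"
      by (rule abelian_groupI) (auto simp: complex_ring_def intro: exI[of _ "- _"] left_minus)
    show "comm_monoid complex_ring"
      by (rule comm_monoidI) (auto simp: complex_ring_def)
  qed (auto simp: complex_ring_def algebra_simps)
  have M: "module complex_ring ?A"
    by (rule moduleI[OF C grp])
      (auto simp: complex_ring_def scaleC_add_left scaleC_add_right scaleC_scaleC scaleC_one)
  have complete: "\<exists>x\<in>carrier ?A. (\<lambda>n. nrm ?A (a_minus ?A (\<sigma> n) x)) \<longlonglongrightarrow> 0"
    if "\<And>e. 0 < e \<Longrightarrow> \<exists>N. \<forall>m\<ge>N. \<forall>n\<ge>N. nrm ?A (a_minus ?A (\<sigma> m) (\<sigma> n)) < e"
    for \<sigma> :: "nat \<Rightarrow> 'a"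
  proof -
    have "Cauchy \<sigma>"
      unfolding Cauchy_def dist_norm using that by (simp add: minus)
    then obtain x where "\<sigma> \<longlonglongrightarrow> x"
      using Cauchy_convergent convergent_def by blast
    then have "(\<lambda>n. norm (\<sigma> n - x)) \<longlonglongrightarrow> 0"
      by (simp add: LIM_zero tendsto_norm_zero)
    then show ?thesis by (auto simp: minus)
  qed
  show ?thesis
  proof (intro cstar_structure.intro cstar_structure_axioms.intro)
    show "ring ?A" by (rule A.ring_axioms)
    show "module complex_ring ?A" by (rule M)
  qed (simp_all add: complete[simplified] mult_scaleC_left mult_scaleC_right star_add star_scaleC
      star_mult star_star norm_triangle_ineq norm_scaleC norm_mult_ineq cstar_identity)
qed


section \<open>Operator systems and unital completely positive maps\<close>

text \<open>An element of \<open>M\<^sub>n(A)\<close> is a function of two indices below \<open>n\<close>. It is positive if it has the form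
  \<open>B\<^sup>* B\<close> with \<open>B \<in> M\<^sub>n(A)\<close>; the \<open>(i, j)\<close> entry of \<open>B\<^sup>* B\<close> is the sum of the \<open>(B k i)\<^sup>* (B k j)\<close> over \<open>k\<close>.\<close>

definition mat_pos :: "'u cstar_struct \<Rightarrow> nat \<Rightarrow> (nat \<Rightarrow> nat \<Rightarrow> 'u) \<Rightarrow> bool" where
  "mat_pos A n M \<longleftrightarrow> (\<exists>B. (\<forall>i<n. \<forall>j<n. B i j \<in> carrier A) \<and>
     (\<forall>i<n. \<forall>j<n. M i j = (\<Oplus>\<^bsub>A\<^esub>k\<in>{..<n}. adj A (B k i) \<otimes>\<^bsub>A\<^esub> B k j)))"

definition operator_system :: "'u cstar_struct \<Rightarrow> 'u set \<Rightarrow> bool" where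
  "operator_system A S \<longleftrightarrow> cstar_structure A \<and> submodule S complex_ring A \<and>
     \<one>\<^bsub>A\<^esub> \<in> S \<and> (\<forall>x\<in>S. adj A x \<in> S)"

text \<open>In the next two definitions \<open>S\<close> and \<open>T\<close> are operator systems in \<open>A\<close> and \<open>B\<close>, with the matrix
  orders inherited from \<open>A\<close> and \<open>B\<close>.\<close>

definition ucp ::
  "'u cstar_struct \<Rightarrow> 'u set \<Rightarrow> 'v cstar_struct \<Rightarrow> 'v set \<Rightarrow> ('u \<Rightarrow> 'v) \<Rightarrow> bool" where
  "ucp A S B T f \<longleftrightarrow> f \<in> S \<rightarrow> T \<and>
     (\<forall>x\<in>S. \<forall>y\<in>S. f (x \<oplus>\<^bsub>A\<^esub> y) = f x \<oplus>\<^bsub>B\<^esub> f y) \<and>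
     (\<forall>a. \<forall>x\<in>S. f (a \<odot>\<^bsub>A\<^esub> x) = a \<odot>\<^bsub>B\<^esub> f x) \<and>
     f \<one>\<^bsub>A\<^esub> = \<one>\<^bsub>B\<^esub> \<and>
     (\<forall>n M. (\<forall>i<n. \<forall>j<n. M i j \<in> S) \<and> mat_pos A n M \<longrightarrow> mat_pos B n (\<lambda>i j. f (M i j)))"

definition complete_order_embedding ::
  "'u cstar_struct \<Rightarrow> 'u set \<Rightarrow> 'v cstar_struct \<Rightarrow> 'v set \<Rightarrow> ('u \<Rightarrow> 'v) \<Rightarrow> bool" where
  "complete_order_embedding A S B T f \<longleftrightarrow> ucp A S B T f \<and> inj_on f S \<and>
     (\<forall>n M. (\<forall>i<n. \<forall>j<n. M i j \<in> S) \<and> mat_pos B n (\<lambda>i j. f (M i j)) \<longrightarrow> mat_pos A n M)"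


section \<open>Injective envelopes and pseudo-expectations\<close>

text \<open>Injectivity, rigidity and essentiality are meant in Hamana's category of operator systems and
  unital completely positive maps.\<close>

definition injective_cstar :: "'u itself \<Rightarrow> 'i :: cstar_algebra itself \<Rightarrow> bool" where
  "injective_cstar _ _ \<longleftrightarrow>
     (\<forall>(A :: 'u cstar_struct) S T (\<phi> :: 'u \<Rightarrow> 'i).
        operator_system A S \<and> operator_system A T \<and> S \<subseteq> T \<and> ucp A S univ_cstar UNIV \<phi> \<longrightarrow>
        (\<exists>\<psi>. ucp A T univ_cstar UNIV \<psi> \<and> (\<forall>x\<in>S. \<psi> x = \<phi> x)))"

definition unital_star_hom_on ::
  "'a :: cstar_algebra set \<Rightarrow> ('a \<Rightarrow> 'b :: cstar_algebra) \<Rightarrow> bool" where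
  "unital_star_hom_on D f \<longleftrightarrow>
     (\<forall>x\<in>D. \<forall>y\<in>D. f (x + y) = f x + f y \<and> f (x * y) = f x * f y) \<and>
     (\<forall>a. \<forall>x\<in>D. f (a *\<^sub>C x) = a *\<^sub>C f x) \<and>
     (\<forall>x\<in>D. f (star x) = star (f x)) \<and> f 1 = 1"

definition rigid_extension ::
  "'a :: cstar_algebra set \<Rightarrow> ('a \<Rightarrow> 'i :: cstar_algebra) \<Rightarrow> bool" where
  "rigid_extension D \<iota> \<longleftrightarrow>
     (\<forall>\<phi> :: 'i \<Rightarrow> 'i. ucp univ_cstar UNIV univ_cstar UNIV \<phi> \<and> (\<forall>d\<in>D. \<phi> (\<iota> d) = \<iota> d) \<longrightarrow> \<phi> = id)"

definition essential_extension ::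
  "'u itself \<Rightarrow> 'a :: cstar_algebra set \<Rightarrow> ('a \<Rightarrow> 'i :: cstar_algebra) \<Rightarrow> bool" where
  "essential_extension _ D \<iota> \<longleftrightarrow>
     (\<forall>(A :: 'u cstar_struct) T (\<phi> :: 'i \<Rightarrow> 'u).
        operator_system A T \<and> ucp univ_cstar UNIV A T \<phi> \<and>
        complete_order_embedding univ_cstar D A T (\<phi> \<circ> \<iota>) \<longrightarrow>
        complete_order_embedding univ_cstar UNIV A T \<phi>)"

definition injective_envelope ::
  "'u itself \<Rightarrow> 'a :: cstar_algebra set \<Rightarrow> ('a \<Rightarrow> 'i :: cstar_algebra) \<Rightarrow> bool" where
  "injective_envelope U D \<iota> \<longleftrightarrow>
     (\<forall>a b :: 'i. a * b = b * a) \<and> injective_cstar U TYPE('i) \<and>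
     unital_star_hom_on D \<iota> \<and> inj_on \<iota> D \<and>
     rigid_extension D \<iota> \<and> essential_extension U D \<iota>"

text \<open>
  A type \<open>'u\<close> that is large enough for \<open>\<C>\<close> of type \<open>'c\<close> and \<open>I(\<D>)\<close> of type \<open>'i\<close>: up to
  isomorphism it contains \<open>\<C>\<close>, its quotients, and the algebra of bounded functions on the character
  space of \<open>I(\<D>)\<close>. An abelian C*-algebra is injective as soon as the identity map extends from it
  to the bounded functions on its character space (these are injective, by extension of states), so
  injectivity against this type is injectivity against all operator systems. An injective rigid
  extension is essential against all operator systems.
\<close>

type_synonym ('c, 'i) test_universe = "('c + 'i \<Rightarrow> complex) \<Rightarrow> complex"

definition pseudo_expectation ::
  "'a :: cstar_algebra set \<Rightarrow> ('a \<Rightarrow> 'i :: cstar_algebra) \<Rightarrow> ('a \<Rightarrow> 'i) \<Rightarrow> bool" where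
  "pseudo_expectation D \<iota> E \<longleftrightarrow>
     ucp univ_cstar UNIV univ_cstar UNIV E \<and> (\<forall>d\<in>D. E d = \<iota> d)"

definition left_kernel :: "('a :: cstar_algebra \<Rightarrow> 'i :: cstar_algebra) \<Rightarrow> 'a set" where
  "left_kernel E = {x. E (star x * x) = 0}"

end

theory Submission
  imports Defs
begin

text \<open>
  Let \<open>w\<close> be a normalizer. The elements \<open>w\<^sup>* f w - f w\<^sup>* w\<close> of \<open>D\<close> and the \<open>d \<in> D\<close> with \<open>w d \<in> D\<close> have no
  common annihilator in \<open>D\<close>: where all the former vanish, \<open>w\<close> commutes with \<open>D\<close> and hence lies in
  \<open>D\<close> locally, by maximality. On the former elements \<open>E(w)\<close> vanishes and on the latter it is
  determined by \<open>\<iota>\<close>. A subset of \<open>D\<close> without annihilator in \<open>D\<close> has none in \<open>I(D)\<close>, so \<open>E\<close> is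
  unique. The same localisation shows \<open>norm (E (v\<^sup>* x v)) \<le> (norm v)\<^sup>2 norm (E x)\<close> for normalizers \<open>v\<close>,
  which makes the left kernel a right ideal. If an ideal \<open>K\<close> meets \<open>D\<close> trivially, then
  \<open>d + k \<mapsto> \<iota> d\<close> is completely positive on \<open>D + K\<close> and extends to \<open>C\<close> by injectivity; by uniqueness the
  extension is \<open>E\<close>, so \<open>E\<close> vanishes on \<open>K\<close>.
\<close>

section \<open>Elementary C*-algebra\<close>

text \<open>The analytic input is one power series, that of \<open>sqrt (1 - y)\<close>. Its
  coefficients are absolutely summable, so it converges on the closed unit ball, boundary included,
  and for self-adjoint \<open>a\<close> with \<open>norm a \<le> t\<close> and \<open>t > 0\<close>
  positivity becomes the ball condition \<open>norm (t *\<^sub>R 1 - a) \<le> t\<close>. The same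
  series does two further jobs: applied to elements that agree modulo an ideal it stands in for the
  quotient algebra, and applied entrywise to a matrix whose powers have bounded entries it gives
  square roots in \<open>M_n(D)\<close> without a norm there. The obstacle in the norm estimate is
  that conjugation by \<open>v\<close> acts on \<open>D\<close> but is not given on
  \<open>I(D)\<close>, so \<open>v^* E(x) v\<close> has no meaning as it stands. It acquires one
  after \<open>x\<close> is multiplied by some \<open>d \<in> D\<close> for which
  \<open>E (x * d)\<close> lies in the image of \<iota>. For finite sums of normalizers there are
  enough such \<open>d\<close>. What passes to limits in \<open>x\<close> is only the resulting
  inequality of norms, which is why the right ideal property is drawn from an inequality.\<close>

lemma star_zero [simp]: "star (0 :: 'a :: cstar_algebra) = 0"
  using star_add[of "0 :: 'a" 0] by simp

lemma star_minus [simp]: "star (- x :: 'a :: cstar_algebra) = - star x"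
  using star_add[of x "- x"] by (simp add: eq_neg_iff_add_eq_0 add.commute)

lemma star_diff: "star (x - y :: 'a :: cstar_algebra) = star x - star y"
  using star_add[of x "- y"] by simp

lemma star_one [simp]: "star (1 :: 'a :: cstar_algebra) = 1"
  by (metis mult.right_neutral star_mult star_star mult_1)

lemma star_scaleR: "star (r *\<^sub>R x :: 'a :: cstar_algebra) = r *\<^sub>R star x"
  by (simp add: scaleR_scaleC star_scaleC)

lemma star_sum: "star (sum f S :: 'a :: cstar_algebra) = (\<Sum>i\<in>S. star (f i))"
  by (induction S rule: infinite_finite_induct) (simp_all add: star_add)

lemma star_power: "star (x ^ n :: 'a :: cstar_algebra) = star x ^ n"
  by (induction n) (simp_all add: star_mult power_commutes)

lemma norm_star [simp]: "norm (star x :: 'a :: cstar_algebra) = norm x"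
proof -
  have le: "norm y \<le> norm (star y)" for y :: 'a
  proof (cases "y = 0")
    case False
    have "norm y * norm y \<le> norm (star y) * norm y"
      using norm_mult_ineq[of "star y" y] by (simp add: cstar_identity power2_eq_square)
    then show ?thesis using False by simp
  qed simp
  show ?thesis using le[of x] le[of "star x"] by (simp add: star_star)
qed

lemma star_mult_self_eq_0_iff [simp]: "star x * x = 0 \<longleftrightarrow> (x :: 'a :: cstar_algebra) = 0"
  by (metis cstar_identity mult_zero_right norm_eq_zero power_eq_0_iff)

lemma bounded_linear_star: "bounded_linear (star :: 'a :: cstar_algebra \<Rightarrow> 'a)"
  by (rule bounded_linear_intro[of _ 1]) (simp_all add: star_add star_scaleR)

lemma norm_square_hermitian:
  "star h = h \<Longrightarrow> norm (h * h :: 'a :: cstar_algebra) = (norm h)\<^sup>2"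
  using cstar_identity[of h] by simp

lemma scaleC_minus_one: "(- 1) *\<^sub>C x = - (x :: 'a :: cstar_algebra)"
  using scaleR_scaleC[of "- 1" x] by simp

lemma cstar_subalgebraD:
  assumes "cstar_subalgebra D"
  shows "0 \<in> D" and "x \<in> D \<Longrightarrow> y \<in> D \<Longrightarrow> x + y \<in> D" and "x \<in> D \<Longrightarrow> y \<in> D \<Longrightarrow> x * y \<in> D"
    and "x \<in> D \<Longrightarrow> a *\<^sub>C x \<in> D" and "x \<in> D \<Longrightarrow> r *\<^sub>R x \<in> D" and "x \<in> D \<Longrightarrow> - x \<in> D"
    and "x \<in> D \<Longrightarrow> y \<in> D \<Longrightarrow> x - y \<in> D" and "x \<in> D \<Longrightarrow> star x \<in> D" and "closed D"
    and "(\<And>i. i \<in> S \<Longrightarrow> f i \<in> D) \<Longrightarrow> sum f S \<in> D"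
proof -
  have sub: "csubspace D" using assms by (simp add: cstar_subalgebra_def)
  show "0 \<in> D" using sub by (rule complex_vector.subspace_0)
  show "x \<in> D \<Longrightarrow> y \<in> D \<Longrightarrow> x + y \<in> D" using sub by (rule complex_vector.subspace_add)
  show "x \<in> D \<Longrightarrow> a *\<^sub>C x \<in> D" for a using sub by (rule complex_vector.subspace_scale)
  then show "x \<in> D \<Longrightarrow> r *\<^sub>R x \<in> D" by (simp add: scaleR_scaleC)
  show "x \<in> D \<Longrightarrow> - x \<in> D" using sub by (rule complex_vector.subspace_neg)
  show "x \<in> D \<Longrightarrow> y \<in> D \<Longrightarrow> x - y \<in> D" using sub by (rule complex_vector.subspace_diff)
  show "(\<And>i. i \<in> S \<Longrightarrow> f i \<in> D) \<Longrightarrow> sum f S \<in> D" using sub by (rule complex_vector.subspace_sum)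
qed (use assms in \<open>auto simp: cstar_subalgebra_def\<close>)

lemma cstar_subalgebra_power:
  "cstar_subalgebra D \<Longrightarrow> 1 \<in> D \<Longrightarrow> x \<in> D \<Longrightarrow> x ^ n \<in> D"
  by (induction n) (simp_all add: cstar_subalgebraD)

section \<open>The binomial series of the square root\<close>

text \<open>The Taylor coefficients of \<open>sqrt (1 - y)\<close> at 0.\<close>

definition sqrt_coeff :: "nat \<Rightarrow> real" where
  "sqrt_coeff m = (- 1) ^ m * ((1 / 2) gchoose m)"

lemma sqrt_coeff_0 [simp]: "sqrt_coeff 0 = 1"
  by (simp add: sqrt_coeff_def)

text \<open>Vandermonde's identity for 1/2 + 1/2 = 1. It says that the formal series squares to
  \<open>1 - y\<close>.\<close>

lemma sqrt_coeff_convolution: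
  "(\<Sum>i\<le>m. sqrt_coeff i * sqrt_coeff (m - i)) = (if m = 0 then 1 else if m = 1 then - 1 else 0)"
proof -
  have "(\<Sum>i\<le>m. sqrt_coeff i * sqrt_coeff (m - i)) =
      (- 1) ^ m * (\<Sum>i\<le>m. ((1 / 2) gchoose i) * ((1 / 2) gchoose (m - i)))"
    unfolding sum_distrib_left
    by (rule sum.cong) (auto simp: sqrt_coeff_def power_add[symmetric])
  also have "\<dots> = (- 1) ^ m * ((1 :: real) gchoose m)"
    using gbinomial_Vandermonde[of "1 / 2 :: real" "1 / 2" m] by (simp add: atMost_atLeast0)
  also have "(1 :: real) gchoose m = of_nat (1 choose m)"
    using binomial_gbinomial[of 1 m, where ?'a = real] by simp
  also have "(- 1) ^ m * real (1 choose m) = (if m = 0 then 1 else if m = 1 then - 1 else 0)"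
    by (auto simp: binomial_eq_0)
  finally show ?thesis .
qed

lemma sqrt_coeff_nonpos: "m > 0 \<Longrightarrow> sqrt_coeff m \<le> 0"
proof (induction m)
  case (Suc m)
  show ?case
  proof (cases "m = 0")
    case True
    then show ?thesis by (simp add: sqrt_coeff_def)
  next
    case False
    have "((1 / 2 :: real) gchoose Suc m) = ((1 / 2) gchoose m) * (1 / 2 - real m) / real (Suc m)"
      using gbinomial_mult_1[of "1 / 2 :: real" m] by (simp add: eq_divide_eq algebra_simps)
    then have "sqrt_coeff (Suc m) = sqrt_coeff m * ((real m - 1 / 2) / real (Suc m))"
      by (simp add: sqrt_coeff_def diff_divide_distrib right_diff_distrib)
    then show ?thesis using Suc False by (simp add: mult_nonpos_nonneg divide_nonpos_pos)
  qed
qed simp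

text \<open>All coefficients after the first are nonpositive, so the sum of absolute values is 1
  minus the full partial sum. That partial sum has the closed form \<open>(-1)^n\<close> times the
  binomial coefficient of -1/2 over \<open>n\<close>, which is nonnegative.\<close>

lemma sum_abs_sqrt_coeff_le: "(\<Sum>m=1..n. \<bar>sqrt_coeff m\<bar>) \<le> 1"
proof -
  have pos: "(- 1) ^ m * ((- 1 / 2 :: real) gchoose m) \<ge> 0" for m
  proof -
    have "(- 1) ^ m * ((- 1 / 2 :: real) gchoose m) = pochhammer (1 / 2) m / fact m"
      by (simp add: gbinomial_pochhammer)
    then show ?thesis by (simp add: pochhammer_nonneg)
  qed
  have "(\<Sum>m\<le>n. sqrt_coeff m) = (- 1) ^ n * ((1 / 2 - 1 :: real) gchoose n)"
    using gbinomial_sum_lower_neg[of "1 / 2 :: real" n]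
    by (simp add: sqrt_coeff_def mult.commute)
  also have "\<dots> \<ge> 0" using pos[of n] by simp
  finally have "0 \<le> (\<Sum>m\<le>n. sqrt_coeff m)" .
  also have "(\<Sum>m\<le>n. sqrt_coeff m) = 1 + (\<Sum>m=1..n. sqrt_coeff m)"
    by (simp add: atMost_atLeast0 sum.atLeast_Suc_atMost)
  also have "(\<Sum>m=1..n. sqrt_coeff m) = - (\<Sum>m=1..n. \<bar>sqrt_coeff m\<bar>)"
    unfolding sum_negf[symmetric] by (rule sum.cong) (auto simp: sqrt_coeff_nonpos)
  finally show ?thesis by simp
qed

lemma summable_abs_sqrt_coeff: "summable (\<lambda>m. \<bar>sqrt_coeff m\<bar>)"
  and suminf_abs_sqrt_coeff_Suc: "(\<Sum>m. \<bar>sqrt_coeff (Suc m)\<bar>) \<le> 1"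
proof -
  have le: "(\<Sum>m<n. \<bar>sqrt_coeff (Suc m)\<bar>) \<le> 1" for n
    using sum_abs_sqrt_coeff_le[of n]
    by (simp add: sum.atLeast1_atMost_eq)
  then have "summable (\<lambda>m. \<bar>sqrt_coeff (Suc m)\<bar>)"
    by (intro bounded_imp_summable[where B = 1])
      (auto simp: lessThan_Suc_atMost[symmetric] simp del: sum.lessThan_Suc)
  then show "summable (\<lambda>m. \<bar>sqrt_coeff m\<bar>)" using summable_Suc_iff by blast
  from \<open>summable (\<lambda>m. \<bar>sqrt_coeff (Suc m)\<bar>)\<close> le
  show "(\<Sum>m. \<bar>sqrt_coeff (Suc m)\<bar>) \<le> 1" by (intro suminf_le_const) auto
qed

definition sqrt1m :: "'a :: cstar_algebra \<Rightarrow> 'a" where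
  "sqrt1m y = (\<Sum>m. sqrt_coeff m *\<^sub>R y ^ m)"

lemma norm_power_le_1: "norm y \<le> 1 \<Longrightarrow> norm (y ^ m :: 'a :: real_normed_algebra_1) \<le> 1"
  by (rule order_trans[OF norm_power_ineq power_le_one]) simp_all

lemma summable_norm_sqrt1m:
  assumes "norm (y :: 'a :: cstar_algebra) \<le> 1"
  shows "summable (\<lambda>m. norm (sqrt_coeff m *\<^sub>R y ^ m))"
proof (rule summable_comparison_test'[OF summable_abs_sqrt_coeff])
  show "norm (norm (sqrt_coeff m *\<^sub>R y ^ m)) \<le> \<bar>sqrt_coeff m\<bar>" for m
    using mult_left_mono[OF norm_power_le_1[OF assms, of m], of "\<bar>sqrt_coeff m\<bar>"] by simp
qed

lemma sqrt1m_LIMSEQ: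
  assumes "norm (y :: 'a :: cstar_algebra) \<le> 1"
  shows "(\<lambda>n. \<Sum>m<n. sqrt_coeff m *\<^sub>R y ^ m) \<longlonglongrightarrow> sqrt1m y"
  unfolding sqrt1m_def
  by (rule summable_LIMSEQ[OF summable_norm_cancel[OF summable_norm_sqrt1m[OF assms]]])

lemma sqrt1m_square:
  assumes "norm (y :: 'a :: cstar_algebra) \<le> 1"
  shows "sqrt1m y * sqrt1m y = 1 - y"
proof -
  have "(\<lambda>k. \<Sum>i\<le>k. (sqrt_coeff i *\<^sub>R y ^ i) * (sqrt_coeff (k - i) *\<^sub>R y ^ (k - i))) sums
      (sqrt1m y * sqrt1m y)"
    unfolding sqrt1m_def by (intro Cauchy_product_sums summable_norm_sqrt1m assms)
  moreover have "(\<Sum>i\<le>k. (sqrt_coeff i *\<^sub>R y ^ i) * (sqrt_coeff (k - i) *\<^sub>R y ^ (k - i))) =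
      (if k = 0 then 1 else if k = 1 then - 1 else 0) *\<^sub>R y ^ k" for k
    unfolding sqrt_coeff_convolution[symmetric] scaleR_sum_left
    by (rule sum.cong) (auto simp: power_add[symmetric])
  moreover have "(\<lambda>k. (if k = 0 then 1 else if k = 1 then - 1 else 0) *\<^sub>R y ^ k) sums
      (\<Sum>k\<in>{0,1}. (if k = 0 then 1 else if k = 1 then - 1 else 0) *\<^sub>R y ^ k)"
    by (rule sums_finite) auto
  ultimately show ?thesis by (auto dest: sums_unique2)
qed

lemma sqrt1m_in:
  assumes "norm (y :: 'a :: cstar_algebra) \<le> 1" and "cstar_subalgebra D" "1 \<in> D" "y \<in> D"
  shows "sqrt1m y \<in> D"
proof (rule closed_sequentially[OF _ _ sqrt1m_LIMSEQ[OF assms(1)]])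
  show "closed D" using assms(2) by (rule cstar_subalgebraD)
  show "(\<Sum>m<n. sqrt_coeff m *\<^sub>R y ^ m) \<in> D" for n
    by (simp add: cstar_subalgebraD(5,10) cstar_subalgebra_power assms)
qed

text \<open>Stated for two elements because the proof that \<open>star b * b\<close> is positive
  intertwines the roots of two different squares; commutation is the case
  \<open>y = z\<close>.\<close>

lemma sqrt1m_intertwine:
  assumes "norm (y :: 'a :: cstar_algebra) \<le> 1" "norm z \<le> 1" and "y * x = x * z"
  shows "sqrt1m y * x = x * sqrt1m z"
proof -
  have pow: "y ^ m * x = x * z ^ m" for m
  proof (induction m)
    case (Suc m)
    have "y ^ Suc m * x = y ^ m * x * z" by (simp only: power_Suc2 mult.assoc assms(3))
    then show ?case by (simp only: Suc power_Suc2 mult.assoc)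
  qed simp
  have "(\<lambda>n. (\<Sum>m<n. sqrt_coeff m *\<^sub>R y ^ m) * x) \<longlonglongrightarrow> sqrt1m y * x"
    by (intro tendsto_intros sqrt1m_LIMSEQ assms)
  moreover have "(\<lambda>n. x * (\<Sum>m<n. sqrt_coeff m *\<^sub>R z ^ m)) \<longlonglongrightarrow> x * sqrt1m z"
    by (intro tendsto_intros sqrt1m_LIMSEQ assms)
  moreover have "(\<Sum>m<n. sqrt_coeff m *\<^sub>R y ^ m) * x = x * (\<Sum>m<n. sqrt_coeff m *\<^sub>R z ^ m)" for n
    by (simp add: sum_distrib_left sum_distrib_right pow)
  ultimately show ?thesis by (simp add: LIMSEQ_unique)
qed

lemma star_sqrt1m:
  assumes "norm (y :: 'a :: cstar_algebra) \<le> 1" and "star y = y"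
  shows "star (sqrt1m y) = sqrt1m y"
proof -
  have "(\<lambda>n. star (\<Sum>m<n. sqrt_coeff m *\<^sub>R y ^ m)) \<longlonglongrightarrow> star (sqrt1m y)"
    by (intro bounded_linear.tendsto[OF bounded_linear_star] sqrt1m_LIMSEQ assms)
  moreover have "star (\<Sum>m<n. sqrt_coeff m *\<^sub>R y ^ m) = (\<Sum>m<n. sqrt_coeff m *\<^sub>R y ^ m)" for n
    by (simp add: star_sum star_scaleR star_power assms)
  ultimately show ?thesis using sqrt1m_LIMSEQ[OF assms(1)] by (simp add: LIMSEQ_unique)
qed

text \<open>The coefficients after the constant one have absolute sum at most 1. The bound puts the
  root itself into the unit ball around 1, so that it has a root in turn.\<close>

lemma norm_one_minus_sqrt1m_le:
  assumes "norm (y :: 'a :: cstar_algebra) \<le> 1"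
  shows "norm (1 - sqrt1m y) \<le> 1"
proof -
  note s = summable_norm_sqrt1m[OF assms]
  have "(\<Sum>m. sqrt_coeff m *\<^sub>R y ^ m) = (\<Sum>m. sqrt_coeff (Suc m) *\<^sub>R y ^ Suc m) + 1"
    using suminf_split_head[OF summable_norm_cancel[OF s]] by simp
  then have "norm (1 - sqrt1m y) = norm (\<Sum>m. sqrt_coeff (Suc m) *\<^sub>R y ^ Suc m)"
    by (simp add: sqrt1m_def)
  also have "\<dots> \<le> (\<Sum>m. \<bar>sqrt_coeff (Suc m)\<bar>)"
  proof (rule norm_suminf_le)
    show "norm (sqrt_coeff (Suc m) *\<^sub>R y ^ Suc m) \<le> \<bar>sqrt_coeff (Suc m)\<bar>" for m
      using mult_left_mono[OF norm_power_le_1[OF assms, of "Suc m"], of "\<bar>sqrt_coeff (Suc m)\<bar>"]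
      by simp
    show "summable (\<lambda>m. \<bar>sqrt_coeff (Suc m)\<bar>)"
      by (rule summable_abs_sqrt_coeff[THEN summable_Suc_iff[THEN iffD2]])
  qed
  also have "\<dots> \<le> 1" by (rule suminf_abs_sqrt_coeff_Suc)
  finally show ?thesis .
qed

section \<open>Positive elements\<close>

text \<open>A self-adjoint root commutes with its square, and the norm estimates below rely on this.
  That elements \<open>star b * b\<close> are positive in this sense is the harder fact
  \<open>positive_star_mult_self\<close>.\<close>

definition positive :: "'a :: cstar_algebra \<Rightarrow> bool" where
  "positive a \<longleftrightarrow> (\<exists>h. star h = h \<and> a = h * h)"

lemma positive_hermitian: "positive a \<Longrightarrow> star a = a"
  by (auto simp: positive_def star_mult)

lemma positive_0 [simp]: "positive 0"
  unfolding positive_def by (rule exI[of _ 0]) simp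

lemma positive_scaleR: "0 \<le> r \<Longrightarrow> positive a \<Longrightarrow> positive (r *\<^sub>R a)"
  unfolding positive_def
  by (elim exE, rule_tac x = "sqrt r *\<^sub>R h" in exI) (auto simp: star_scaleR)

text \<open>A square root of \<open>a\<close>, provided that \<open>t > 0\<close> and \<open>norm (t - a) \<le> t\<close>. The same \<open>t\<close> serves
  for several elements at once, which makes it possible to compare their square roots.\<close>

definition psqrt :: "real \<Rightarrow> 'a :: cstar_algebra \<Rightarrow> 'a" where
  "psqrt t a = sqrt t *\<^sub>R sqrt1m (1 - (1 / t) *\<^sub>R a)"

lemma norm_rescale_le:
  assumes "0 < t" "norm (t *\<^sub>R 1 - a :: 'a :: cstar_algebra) \<le> t"
  shows "norm (1 - (1 / t) *\<^sub>R a) \<le> 1"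
proof -
  have "1 - (1 / t) *\<^sub>R a = (1 / t) *\<^sub>R (t *\<^sub>R 1 - a)"
    using assms by (simp add: scaleR_diff_right)
  then show ?thesis using assms by (simp add: divide_le_eq)
qed

context
  fixes t :: real and a :: "'a :: cstar_algebra"
  assumes t: "0 < t" and a: "norm (t *\<^sub>R 1 - a) \<le> t"
begin

lemma psqrt_square: "psqrt t a * psqrt t a = a"
  using t by (simp add: psqrt_def sqrt1m_square[OF norm_rescale_le[OF t a]])

lemma psqrt_in: "cstar_subalgebra D \<Longrightarrow> 1 \<in> D \<Longrightarrow> a \<in> D \<Longrightarrow> psqrt t a \<in> D"
  unfolding psqrt_def
  by (intro cstar_subalgebraD sqrt1m_in norm_rescale_le[OF t a])

lemma psqrt_intertwine:
  assumes "norm (t *\<^sub>R 1 - b) \<le> t" and "a * x = x * b"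
  shows "psqrt t a * x = x * psqrt t b"
proof -
  have "sqrt1m (1 - (1 / t) *\<^sub>R a) * x = x * sqrt1m (1 - (1 / t) *\<^sub>R b)"
    using assms by (intro sqrt1m_intertwine norm_rescale_le t a) (simp_all add: algebra_simps)
  then show ?thesis by (simp add: psqrt_def)
qed

lemma star_psqrt: "star a = a \<Longrightarrow> star (psqrt t a) = psqrt t a"
  by (simp add: psqrt_def star_scaleR star_sqrt1m[OF norm_rescale_le[OF t a]] star_diff)

lemma positive_if_norm_diff_le: "star a = a \<Longrightarrow> positive a"
  unfolding positive_def
  by (rule exI[of _ "psqrt t a"]) (simp add: psqrt_square star_psqrt)

end

text \<open>By \<open>norm_one_minus_sqrt1m_le\<close> the ball criterion with radius 1 applies to
  the root.\<close>

lemma positive_psqrt: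
  assumes "0 < t" "norm (t *\<^sub>R 1 - a) \<le> t" and "star a = (a :: 'a :: cstar_algebra)"
  shows "positive (psqrt t a)"
proof -
  let ?s = "sqrt1m (1 - (1 / t) *\<^sub>R a)"
  note y = norm_rescale_le[OF assms(1,2)]
  have "star ?s = ?s" using assms by (intro star_sqrt1m y) (simp add: star_diff star_scaleR)
  then have "positive ?s"
    using norm_one_minus_sqrt1m_le[OF y] by (intro positive_if_norm_diff_le[of 1]) simp_all
  then show ?thesis using assms(1) by (simp add: psqrt_def positive_scaleR)
qed

text \<open>Both bounds hold because \<open>u = h + i w\<close> satisfies \<open>u\<^sup>* u = h\<^sup>2 + w\<^sup>2\<close>; for \<open>w\<^sup>2 = t - h\<^sup>2\<close> it is
  a multiple of a unitary.\<close>

lemma norm_commuting_hermitian: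
  assumes "star h = h" "star w = w" "h * w = w * (h :: 'a :: cstar_algebra)"
  shows "(norm h)\<^sup>2 \<le> norm (h * h + w * w)" and "(norm w)\<^sup>2 \<le> norm (h * h + w * w)"
proof -
  let ?u = "h + \<i> *\<^sub>C w"
  have su: "star ?u = h - \<i> *\<^sub>C w"
    using assms by (simp add: star_add star_scaleC complex_vector.scale_minus_left)
  have "star ?u * ?u = h * h + w * w"
    unfolding su
    using assms
    by (simp add: algebra_simps mult_scaleC_left mult_scaleC_right scaleC_scaleC scaleC_minus_one)
  then have u: "norm (h * h + w * w) = (norm ?u)\<^sup>2" using cstar_identity[of ?u] by simp
  have nu: "norm (star ?u) = norm ?u" by simp
  have "2 *\<^sub>R h = ?u + star ?u" unfolding su by (simp add: scaleR_2)
  then have "2 * norm h \<le> norm ?u + norm (star ?u)"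
    by (metis norm_triangle_ineq norm_scaleR abs_numeral)
  then have "norm h \<le> norm ?u" unfolding nu by simp
  then show "(norm h)\<^sup>2 \<le> norm (h * h + w * w)" unfolding u by (simp add: power_mono)
  have "(2 * \<i>) *\<^sub>C w = ?u - star ?u"
    unfolding su by (simp add: scaleC_add_left[symmetric])
  then have "norm ((2 * \<i>) *\<^sub>C w) \<le> norm ?u + norm (star ?u)"
    by (metis norm_triangle_ineq4)
  then have "norm w \<le> norm ?u" unfolding nu by (simp add: norm_scaleC norm_mult)
  then show "(norm w)\<^sup>2 \<le> norm (h * h + w * w)" unfolding u by (simp add: power_mono)
qed

text \<open>Converse of \<open>positive_if_norm_diff_le\<close>. Since
  \<open>norm a \<le> t\<close>, the element \<open>t - a\<close> satisfies the ball condition and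
  has a root that commutes with the root \<open>h\<close> of \<open>a\<close>; the squares of both
  add up to \<open>t\<close>, which bounds each of them.\<close>

lemma norm_diff_le_if_positive:
  assumes "positive a" "norm a \<le> t"
  shows "norm (t *\<^sub>R 1 - a :: 'a :: cstar_algebra) \<le> t"
proof (cases "t = 0")
  case True
  then show ?thesis using assms by simp
next
  case False
  then have t: "0 < t" using assms(2) norm_ge_zero[of a] by linarith
  obtain h where h: "star h = h" "a = h * h" using assms(1) by (auto simp: positive_def)
  let ?b = "t *\<^sub>R 1 - a"
  have b: "norm (t *\<^sub>R 1 - ?b) \<le> t" using assms(2) by simp
  have "star ?b = ?b" using h by (simp add: star_diff star_scaleR star_mult)
  then have sw: "star (psqrt t ?b) = psqrt t ?b" by (rule star_psqrt[OF t b])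
  have comm: "psqrt t ?b * h = h * psqrt t ?b"
    by (rule psqrt_intertwine[OF t b b]) (simp add: h algebra_simps)
  have "h * h + psqrt t ?b * psqrt t ?b = t *\<^sub>R 1"
    unfolding psqrt_square[OF t b] using h by simp
  with norm_commuting_hermitian(2)[OF h(1) sw comm[symmetric]] t
  have "(norm (psqrt t ?b))\<^sup>2 \<le> t" by simp
  then show ?thesis
    using norm_square_hermitian[OF sw] by (simp add: psqrt_square[OF t b])
qed

text \<open>Roots of summands do not add, but the ball conditions do, with the radii adding as
  well.\<close>

lemma positive_add:
  assumes "positive a" "positive b"
  shows "positive (a + b :: 'a :: cstar_algebra)"
proof -
  let ?s = "norm a + 1" and ?t = "norm b + 1"
  have "norm ((?s *\<^sub>R 1 - a) + (?t *\<^sub>R 1 - b)) \<le> ?s + ?t"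
    by (intro norm_triangle_mono norm_diff_le_if_positive assms) simp_all
  moreover have "(?s *\<^sub>R 1 - a) + (?t *\<^sub>R 1 - b) = (?s + ?t) *\<^sub>R 1 - (a + b)"
    by (simp only: scaleR_add_left add_diff_add)
  ultimately have "norm ((?s + ?t) *\<^sub>R 1 - (a + b)) \<le> ?s + ?t" by simp
  moreover have "0 < ?s + ?t" by (smt (verit) norm_ge_zero)
  moreover have "star (a + b) = a + b" using assms by (simp add: star_add positive_hermitian)
  ultimately show ?thesis by (metis positive_if_norm_diff_le)
qed

lemma positive_sum: "(\<And>i. i \<in> S \<Longrightarrow> positive (f i)) \<Longrightarrow> positive (sum f S)"
  by (induction S rule: infinite_finite_induct) (simp_all add: positive_add)

lemma positive_norm_minus:
  assumes "star a = a" "norm (a :: 'a :: cstar_algebra) \<le> t"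
  shows "positive (t *\<^sub>R 1 - a)"
proof (cases "t = 0")
  case False
  then have "0 < t" using assms(2) norm_ge_zero[of a] by linarith
  then show ?thesis
    using assms by (intro positive_if_norm_diff_le[of t]) (simp_all add: star_diff star_scaleR)
qed (use assms in simp)

lemma positive_sqrt_exists:
  assumes "positive (a :: 'a :: cstar_algebra)"
  obtains h where "positive h" "h * h = a" "\<And>x. a * x = x * a \<Longrightarrow> h * x = x * h"
    "\<And>D. cstar_subalgebra D \<Longrightarrow> 1 \<in> D \<Longrightarrow> a \<in> D \<Longrightarrow> h \<in> D"
proof
  \<comment> \<open>The summand 1 keeps \<open>?t\<close> positive when
    \<open>a = 0\<close>.\<close>
  let ?t = "norm a + 1"
  have t: "0 < ?t" by (simp add: add_nonneg_pos)
  have a: "norm (?t *\<^sub>R 1 - a) \<le> ?t" using assms by (rule norm_diff_le_if_positive) simp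
  show "positive (psqrt ?t a)" using t a assms by (intro positive_psqrt positive_hermitian)
  show "psqrt ?t a * psqrt ?t a = a" by (rule psqrt_square[OF t a])
  show "a * x = x * a \<Longrightarrow> psqrt ?t a * x = x * psqrt ?t a" for x
    by (rule psqrt_intertwine[OF t a a])
  show "cstar_subalgebra D \<Longrightarrow> 1 \<in> D \<Longrightarrow> a \<in> D \<Longrightarrow> psqrt ?t a \<in> D" for D
    by (rule psqrt_in[OF t a])
qed

text \<open>Commuting roots of \<open>a\<close> and of \<open>s - a\<close> have squares that add up
  to \<open>s\<close>. The case \<open>s = 0\<close> gives \<open>positive_antisym\<close>.\<close>

lemma norm_le_if_positive_minus:
  assumes "positive a" "positive (s *\<^sub>R 1 - a :: 'a :: cstar_algebra)"
  shows "norm a \<le> \<bar>s\<bar>"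
proof -
  obtain h where h: "star h = h" "a = h * h" using assms(1) by (auto simp: positive_def)
  obtain w where w: "positive w" "w * w = s *\<^sub>R 1 - a"
    "\<And>x. (s *\<^sub>R 1 - a) * x = x * (s *\<^sub>R 1 - a) \<Longrightarrow> w * x = x * w"
    by (rule positive_sqrt_exists[OF assms(2)]) blast
  have "w * h = h * w" by (rule w(3)) (simp add: h algebra_simps)
  then have "(norm h)\<^sup>2 \<le> norm (h * h + w * w)"
    by (intro norm_commuting_hermitian h positive_hermitian w) simp
  also have "h * h + w * w = s *\<^sub>R 1" using h(2) w(2) by simp
  finally show ?thesis using norm_square_hermitian[OF h(1)] by (simp add: h)
qed

lemma positive_antisym: "positive a \<Longrightarrow> positive (- a) \<Longrightarrow> a = (0 :: 'a :: cstar_algebra)"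
  using norm_le_if_positive_minus[of a 0] by simp

lemma positive_mult:
  assumes "positive a" "positive b" "a * b = b * (a :: 'a :: cstar_algebra)"
  shows "positive (a * b)"
proof -
  obtain h where h: "positive h" "h * h = a" "\<And>x. a * x = x * a \<Longrightarrow> h * x = x * h"
    by (rule positive_sqrt_exists[OF assms(1)]) blast
  have hb: "b * h = h * b" using h(3) assms(3) by simp
  obtain k where k: "positive k" "k * k = b" "\<And>x. b * x = x * b \<Longrightarrow> k * x = x * k"
    by (rule positive_sqrt_exists[OF assms(2)]) blast
  have kh: "k * h = h * k" by (rule k(3)) (rule hb)
  have "(h * k) * (h * k) = h * (k * h) * k" by (simp add: mult.assoc)
  also have "\<dots> = (h * h) * (k * k)" by (simp only: kh mult.assoc)
  also have "\<dots> = a * b" by (simp only: h k)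
  finally show ?thesis unfolding positive_def using kh h(1) k(1)
    by (intro exI[of _ "h * k"]) (simp add: star_mult positive_hermitian)
qed

lemma positive_add_eq_0:
  assumes "positive a" "positive b" "a + b = (0 :: 'a :: cstar_algebra)"
  shows "a = 0"
proof -
  have "b = - a" using assms(3) by (simp add: eq_neg_iff_add_eq_0 add.commute)
  then show ?thesis using assms(1,2) by (simp add: positive_antisym)
qed

lemma hermitian_cube_eq_0:
  assumes "star q = q" "q * q * q = 0"
  shows "q = (0 :: 'a :: cstar_algebra)"
proof -
  have "star (q * q) * (q * q) = q * q * q * q"
    by (simp only: star_mult assms(1) mult.assoc)
  then have "q * q = 0" using assms(2) by simp
  then show ?thesis using assms(1) star_mult_self_eq_0_iff[of q] by simp
qed

lemma commute_square_left: "x * y = y * x \<Longrightarrow> x * x * y = y * (x * x)" for x y :: "'a :: semigroup_mult"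
  by (metis mult.assoc)

section \<open>Uniqueness of the positive square root, and positivity of
  \<open>star b * b\<close>\<close>

lemma positive_sqrt_unique:
  assumes "positive e" "positive f" "e * e = f * f" "e * f = f * (e :: 'a :: cstar_algebra)"
  shows "e = f"
proof -
  let ?g = "e - f"
  have sg: "star ?g = ?g" using assms by (simp add: star_diff positive_hermitian)
  have comm: "?g * e = e * ?g" "?g * f = f * ?g" using assms(4) by (simp_all add: algebra_simps)
  have pos: "positive (?g * ?g)" unfolding positive_def using sg by auto
  have c2: "?g * ?g * e = e * (?g * ?g)" "?g * ?g * f = f * (?g * ?g)"
    by (rule commute_square_left[OF comm(1)], rule commute_square_left[OF comm(2)])
  have z: "?g * e + ?g * f = 0" using assms(3,4) by (simp add: algebra_simps)
  have sum: "?g * ?g * e + ?g * ?g * f = 0"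
    using z by (simp only: mult.assoc distrib_left[symmetric] mult_zero_right)
  have "?g * ?g * e = 0"
    by (rule positive_add_eq_0[OF positive_mult[OF pos assms(1) c2(1)]
        positive_mult[OF pos assms(2) c2(2)] sum])
  moreover from this sum have "?g * ?g * f = 0" by simp
  ultimately have "?g * ?g * ?g = 0" by (simp add: right_diff_distrib)
  then show ?thesis using hermitian_cube_eq_0[OF sg] by simp
qed

text \<open>Recovers a positive element from its square, so that what the series shows about squares
  carries over to the elements themselves.\<close>

lemma psqrt_eqI:
  assumes "0 < t" "norm (a :: 'a :: cstar_algebra) \<le> t" "positive e" "e * e = a"
  shows "psqrt t a = e"
proof (rule positive_sqrt_unique)
  have "positive a" using assms(3,4) positive_hermitian positive_def by blast
  then have a: "norm (t *\<^sub>R 1 - a) \<le> t" using assms(2) by (rule norm_diff_le_if_positive)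
  show "positive (psqrt t a)" using assms(1) a \<open>positive a\<close> by (intro positive_psqrt positive_hermitian)
  show "psqrt t a * psqrt t a = e * e" using assms(4) psqrt_square[OF assms(1) a] by simp
  show "psqrt t a * e = e * psqrt t a"
    by (rule psqrt_intertwine[OF assms(1) a a]) (simp add: assms(4)[symmetric] mult.assoc)
qed fact

lemma positive_square: "star h = h \<Longrightarrow> positive (h * h)"
  by (auto simp: positive_def)

lemma hermitian_abs_exists:
  assumes "star x = (x :: 'a :: cstar_algebra)"
  obtains m where "positive m" "m * m = x * x" "\<And>y. x * y = y * x \<Longrightarrow> m * y = y * m"
    "\<And>D. cstar_subalgebra D \<Longrightarrow> 1 \<in> D \<Longrightarrow> x \<in> D \<Longrightarrow> m \<in> D"
proof -
  obtain m where m: "positive m" "m * m = x * x" "\<And>y. (x * x) * y = y * (x * x) \<Longrightarrow> m * y = y * m"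
    "\<And>D. cstar_subalgebra D \<Longrightarrow> 1 \<in> D \<Longrightarrow> x * x \<in> D \<Longrightarrow> m \<in> D"
    by (rule positive_sqrt_exists[OF positive_square[OF assms]]) blast
  show thesis
  proof (rule that[OF m(1,2)])
    show "m * y = y * m" if "x * y = y * x" for y
      by (rule m(3)[OF commute_square_left[OF that]])
    show "m \<in> D" if "cstar_subalgebra D" "1 \<in> D" "x \<in> D" for D
      using that by (intro m(4) cstar_subalgebraD(3))
  qed
qed

text \<open>The negative part of a self-adjoint \<open>x\<close> with absolute value \<open>m\<close> is \<open>(m - x) / 2\<close>.\<close>

lemma negative_part_cube:
  assumes "star x = (x :: 'a :: cstar_algebra)" "positive m" "m * m = x * x" "x * m = m * x"
  shows "positive ((m - x) * (m - x) * (m - x))"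
    and "x * (m - x) = - (1 / 2) *\<^sub>R ((m - x) * (m - x))"
    and "m - x = 0 \<Longrightarrow> positive x"
proof -
  let ?q = "m - x"
  have sq: "star ?q = ?q" using assms by (simp add: star_diff positive_hermitian)
  \<comment> \<open>Since \<open>m * m = x * x\<close>, the square of \<open>m - x\<close> is both
    \<open>2 (m^2 - x m)\<close> and \<open>2 (x^2 - x m)\<close>.\<close>
  have qq: "?q * ?q = 2 *\<^sub>R (?q * m)" "?q * ?q = - 2 *\<^sub>R (x * ?q)"
    by (simp_all add: left_diff_distrib right_diff_distrib scaleR_2 assms(3,4) scaleR_diff_right)
  have qm: "?q * m = m * ?q" using assms(4) by (simp add: algebra_simps)
  have "positive ((?q * ?q) * m)"
    by (rule positive_mult[OF positive_square[OF sq] assms(2)]) (rule commute_square_left[OF qm])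
  then have "positive (2 *\<^sub>R ((?q * ?q) * m))" by (intro positive_scaleR) simp
  moreover have "?q * ?q * ?q = 2 *\<^sub>R ((?q * ?q) * m)"
    using arg_cong[OF qq(1), of "\<lambda>w. ?q * w"] by (simp only: mult.assoc mult_scaleR_right)
  ultimately show "positive (?q * ?q * ?q)" by simp
  show "x * ?q = - (1 / 2) *\<^sub>R (?q * ?q)" unfolding qq(2) by simp
  show "?q = 0 \<Longrightarrow> positive x" using assms(2) by simp
qed

text \<open>With \<open>q\<close> the negative part of \<open>b\<^sup>* b\<close> and \<open>y = b q\<close>, both \<open>- y\<^sup>* y\<close> and \<open>y y\<^sup>*\<close> are positive.
  As \<open>y\<close> intertwines their squares, it intertwines their square roots.\<close>

theorem positive_star_mult_self: "positive (star b * b :: 'a :: cstar_algebra)"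
proof -
  define x where "x = star b * b"
  have sx: "star x = x" by (simp add: x_def star_mult star_star)
  obtain m where m: "positive m" "m * m = x * x" and cm: "\<And>y. x * y = y * x \<Longrightarrow> m * y = y * m"
    by (rule hermitian_abs_exists[OF sx]) blast
  have xm: "x * m = m * x" using cm[of x] by simp
  note neg = negative_part_cube[OF sx m xm]
  define q where "q = m - x"
  have sq: "star q = q" using m sx by (simp add: q_def star_diff positive_hermitian)
  define y where "y = b * q"
  define c where "c = - (star y * y)"
  have "star y * y = q * (x * q)" by (simp add: y_def star_mult sq x_def mult.assoc)
  also have "\<dots> = - (1 / 2) *\<^sub>R (q * q * q)"
    using neg(2) by (simp add: q_def[symmetric] mult.assoc)
  finally have ceq: "c = (1 / 2) *\<^sub>R (q * q * q)" by (simp add: c_def)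
  then have c: "positive c" using neg(1) by (simp add: q_def positive_scaleR)
  define e where "e = y * star y"
  \<comment> \<open>\<open>h\<close> and \<open>k\<close> are the real and imaginary parts of
    \<open>y\<close>. Their squares add up to half of \<open>y * star y + star y * y\<close>, which
    expresses \<open>e\<close> as a sum of positive elements.\<close>
  define h where "h = (1 / 2) *\<^sub>R (y + star y)"
  define k where "k = (\<i> / 2) *\<^sub>C (star y - y)"
  have sh: "star h = h" by (simp add: h_def star_scaleR star_add star_star add.commute)
  have "star k = (- (\<i> / 2)) *\<^sub>C (y - star y)"
    by (simp add: k_def star_scaleC star_diff star_star)
  then have sk: "star k = k"
    by (simp add: k_def complex_vector.scale_minus_left complex_vector.scale_right_diff_distrib)
  have hh: "h * h = (1 / 4) *\<^sub>R (y * y + y * star y + star y * y + star y * star y)"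
    by (simp add: h_def algebra_simps)
  have "k * k = (- (1 / 4)) *\<^sub>C ((star y - y) * (star y - y))"
    by (simp add: k_def mult_scaleC_left mult_scaleC_right scaleC_scaleC)
  also have "\<dots> = (- (1 / 4)) *\<^sub>R ((star y - y) * (star y - y))"
    by (simp add: scaleR_scaleC)
  also have "\<dots> = (1 / 4) *\<^sub>R (y * star y + star y * y - y * y - star y * star y)"
    by (simp add: algebra_simps)
  finally have kk: "k * k = (1 / 4) *\<^sub>R (y * star y + star y * y - y * y - star y * star y)" .
  have "h * h + k * k = (1 / 4) *\<^sub>R (2 *\<^sub>R (y * star y + star y * y))"
    unfolding hh kk scaleR_add_right[symmetric] by (simp add: scaleR_2)
  then have "e = 2 *\<^sub>R (h * h + k * k) + c"
    by (simp add: e_def c_def)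
  then have e: "positive e"
    using c sh sk by (simp add: positive_add positive_scaleR positive_square)
  have ey: "e * y = - (y * c)" by (simp add: e_def c_def mult.assoc)
  have eyz: "e * (y * z) = - (y * (c * z))" for z
    using arg_cong[OF ey, of "\<lambda>w. w * z"] by (simp add: mult.assoc)
  have eey: "(e * e) * y = y * (c * c)" by (simp add: mult.assoc ey eyz)
  define t where "t = norm (e * e) + norm (c * c) + 1"
  have t: "0 < t" "norm (e * e) \<le> t" "norm (c * c) \<le> t"
    using norm_ge_zero[of "e * e"] norm_ge_zero[of "c * c"] unfolding t_def by linarith+
  have "psqrt t (e * e) * y = y * psqrt t (c * c)"
    using positive_hermitian[OF e] positive_hermitian[OF c]
    by (intro psqrt_intertwine norm_diff_le_if_positive positive_square t eey)
  moreover have "psqrt t (e * e) = e" "psqrt t (c * c) = c"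
    by (rule psqrt_eqI[OF t(1,2) e refl], rule psqrt_eqI[OF t(1,3) c refl])
  \<comment> \<open>Intertwining gives \<open>e * y = y * c\<close>, while \<open>ey\<close> has the
    opposite sign.\<close>
  ultimately have "y * c + y * c = 0" using ey by (simp add: add_eq_0_iff)
  then have "y * c = 0" by (simp add: scaleR_2[symmetric])
  then have "star y * (y * c) = 0" by simp
  then have "star c * c = 0"
    using positive_hermitian[OF c] by (simp add: c_def mult.assoc)
  then have "c = 0" by (simp only: star_mult_self_eq_0_iff)
  then have "q * q * q = 0" using ceq by simp
  then have "q = 0" by (rule hermitian_cube_eq_0[OF sq])
  then show ?thesis using neg(3) by (simp add: q_def x_def)
qed

lemma positive_conj:
  assumes "positive a"
  shows "positive (star x * a * (x :: 'a :: cstar_algebra))"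
proof -
  obtain h where h: "star h = h" "a = h * h" using assms by (auto simp: positive_def)
  then have "star x * a * x = star (h * x) * (h * x)" by (simp add: star_mult mult.assoc)
  then show ?thesis by (simp only: positive_star_mult_self)
qed

lemma sum_star_mult_self_eq_0:
  assumes "finite S" "(\<Sum>i\<in>S. star (f i) * f i) = 0" "j \<in> S"
  shows "f j = (0 :: 'a :: cstar_algebra)"
proof -
  have "star (f j) * f j + (\<Sum>i\<in>S - {j}. star (f i) * f i) = 0"
    using assms(2) unfolding sum.remove[OF assms(1,3)] .
  then have "star (f j) * f j = 0"
    by (rule positive_add_eq_0[OF positive_star_mult_self positive_sum[OF positive_star_mult_self]])
  then show ?thesis by simp
qed

lemma norm_le_if_positive:
  assumes "positive a" "positive (b - a :: 'a :: cstar_algebra)"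
  shows "norm a \<le> norm b"
proof -
  have "star b = b"
    using positive_hermitian[OF assms(1)] positive_hermitian[OF assms(2)] by (simp add: star_diff)
  then have "positive ((norm b *\<^sub>R 1 - b) + (b - a))"
    by (intro positive_add positive_norm_minus assms) simp_all
  then show ?thesis using norm_le_if_positive_minus[OF assms(1), of "norm b"] by simp
qed

section \<open>Homomorphisms and positivity modulo an ideal\<close>

locale star_hom =
  fixes D :: "'b :: cstar_algebra set" and \<rho> :: "'b \<Rightarrow> 'a :: cstar_algebra"
  assumes subalgebra: "cstar_subalgebra D" and one_in: "1 \<in> D" and hom: "unital_star_hom_on D \<rho>"
begin

lemmas closure_rules = cstar_subalgebraD[OF subalgebra] one_in
  cstar_subalgebra_power[OF subalgebra one_in]

lemma hom_add: "x \<in> D \<Longrightarrow> y \<in> D \<Longrightarrow> \<rho> (x + y) = \<rho> x + \<rho> y"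
  and hom_mult: "x \<in> D \<Longrightarrow> y \<in> D \<Longrightarrow> \<rho> (x * y) = \<rho> x * \<rho> y"
  and hom_scaleC: "x \<in> D \<Longrightarrow> \<rho> (a *\<^sub>C x) = a *\<^sub>C \<rho> x"
  and hom_star: "x \<in> D \<Longrightarrow> \<rho> (star x) = star (\<rho> x)"
  and hom_one: "\<rho> 1 = 1"
  using hom by (simp_all add: unital_star_hom_on_def)

lemma hom_zero: "\<rho> 0 = 0"
  using hom_add[of 0 0] closure_rules(1) by simp

lemma hom_scaleR: "x \<in> D \<Longrightarrow> \<rho> (r *\<^sub>R x) = r *\<^sub>R \<rho> x"
  by (simp add: scaleR_scaleC hom_scaleC)

lemma hom_minus: "x \<in> D \<Longrightarrow> \<rho> (- x) = - \<rho> x"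
  using hom_scaleR[of x "- 1"] by simp

lemma hom_diff: "x \<in> D \<Longrightarrow> y \<in> D \<Longrightarrow> \<rho> (x - y) = \<rho> x - \<rho> y"
  using hom_add[of x "- y"] by (simp add: hom_minus closure_rules)

lemma hom_sum: "(\<And>i. i \<in> S \<Longrightarrow> f i \<in> D) \<Longrightarrow> \<rho> (sum f S) = (\<Sum>i\<in>S. \<rho> (f i))"
  by (induction S rule: infinite_finite_induct)
    (simp_all add: hom_zero hom_add closure_rules(10))

lemma hom_positive:
  assumes "a \<in> D" "positive a"
  shows "positive (\<rho> a)"
proof -
  obtain h where "positive h" "h * h = a" "h \<in> D"
    by (rule positive_sqrt_exists[OF assms(2)]) (use assms(1) subalgebra one_in in blast)
  then have "\<rho> a = star (\<rho> h) * \<rho> h"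
    using hom_mult[of h h] hom_star[of h] by (simp add: positive_hermitian)
  then show ?thesis by (simp only: positive_star_mult_self)
qed

text \<open>The homomorphism keeps the positive element \<open>(norm d)^2 - star d * d\<close>
  positive, and this is the norm bound for the image.\<close>

lemma norm_hom_le:
  assumes "d \<in> D"
  shows "norm (\<rho> d) \<le> norm d"
proof -
  let ?t = "(norm d)\<^sup>2"
  have dd: "star d * d \<in> D" using assms by (simp add: closure_rules)
  have "positive (?t *\<^sub>R 1 - star d * d)"
    by (rule positive_norm_minus) (simp_all add: star_mult star_star cstar_identity)
  then have "positive (\<rho> (?t *\<^sub>R 1 - star d * d))"
    using dd by (intro hom_positive) (simp_all add: closure_rules)
  moreover have "\<rho> (?t *\<^sub>R 1 - star d * d) = ?t *\<^sub>R 1 - star (\<rho> d) * \<rho> d"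
    using assms dd by (simp add: hom_diff hom_scaleR hom_one hom_mult hom_star closure_rules)
  ultimately have "norm (star (\<rho> d) * \<rho> d) \<le> \<bar>?t\<bar>"
    using norm_le_if_positive_minus[OF positive_star_mult_self] by metis
  then show ?thesis by (simp add: cstar_identity abs_le_square_iff[symmetric])
qed

end

text \<open>Encodes an injective homomorphism from \<open>D\<close> into the quotient by
  \<open>K\<close> without forming the quotient. It is used for the inclusion of \<open>D\<close>
  into the algebra, for \<iota> with an annihilator in \<open>I(D)\<close> as \<open>K\<close>, and
  for \<iota> with the zero ideal.\<close>

locale star_hom_mod_ideal = star_hom D \<rho>
  for D :: "'b :: cstar_algebra set" and \<rho> :: "'b \<Rightarrow> 'a :: cstar_algebra" +
  fixes K :: "'a set"
  assumes ideal: "cstar_ideal K" and star_ideal: "x \<in> K \<Longrightarrow> star x \<in> K"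
    and faithful: "d \<in> D \<Longrightarrow> \<rho> d \<in> K \<Longrightarrow> d = 0"
begin

lemma ideal_subspace: "csubspace K" and closed_ideal: "closed K"
  and ideal_mult_left: "x \<in> K \<Longrightarrow> a * x \<in> K" and ideal_mult_right: "x \<in> K \<Longrightarrow> x * a \<in> K"
  using ideal by (auto simp: cstar_ideal_def)

lemmas ideal_add = complex_vector.subspace_add[OF ideal_subspace]
  and ideal_diff = complex_vector.subspace_diff[OF ideal_subspace]
  and ideal_scaleC = complex_vector.subspace_scale[OF ideal_subspace]
  and ideal_sum = complex_vector.subspace_sum[OF ideal_subspace]
  and ideal_0 = complex_vector.subspace_0[OF ideal_subspace]

lemma ideal_scaleR: "x \<in> K \<Longrightarrow> r *\<^sub>R x \<in> K"
  by (simp add: scaleR_scaleC ideal_scaleC)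

lemma power_mod_ideal:
  assumes "y \<in> D" "z - \<rho> y \<in> K"
  shows "z ^ n - \<rho> (y ^ n) \<in> K"
proof (induction n)
  case (Suc n)
  have "z ^ Suc n - \<rho> (y ^ Suc n) = z * (z ^ n - \<rho> (y ^ n)) + (z - \<rho> y) * \<rho> (y ^ n)"
    using assms(1) by (simp add: hom_mult closure_rules algebra_simps)
  then show ?case using Suc assms(2) by (simp only: ideal_add ideal_mult_left ideal_mult_right)
qed (simp add: hom_one ideal_0)

text \<open>Partial sums agree modulo \<open>K\<close>, and \<open>K\<close> is closed; \<rho>
  passes to the limit because it is contractive.\<close>

lemma sqrt1m_mod_ideal:
  assumes "y \<in> D" "norm y \<le> 1" "norm z \<le> 1" "z - \<rho> y \<in> K"
  shows "sqrt1m z - \<rho> (sqrt1m y) \<in> K"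
proof (rule closed_sequentially[OF closed_ideal])
  let ?p = "\<lambda>x :: 'b. \<lambda>n. \<Sum>m<n. sqrt_coeff m *\<^sub>R x ^ m"
  let ?q = "\<lambda>x :: 'a. \<lambda>n. \<Sum>m<n. sqrt_coeff m *\<^sub>R x ^ m"
  have pD: "?p y n \<in> D" for n using assms(1) by (simp add: closure_rules(5,10,12))
  have sD: "sqrt1m y \<in> D" by (rule sqrt1m_in[OF assms(2) subalgebra one_in assms(1)])
  show "?q z n - \<rho> (?p y n) \<in> K" for n
  proof -
    have "?q z n - \<rho> (?p y n) = (\<Sum>m<n. sqrt_coeff m *\<^sub>R (z ^ m - \<rho> (y ^ m)))"
      using assms(1)
      by (simp add: hom_sum hom_scaleR closure_rules(5,12) sum_subtractf scaleR_diff_right)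
    then show ?thesis using power_mod_ideal[OF assms(1,4)] by (simp add: ideal_sum ideal_scaleR)
  qed
  have "(\<lambda>n. \<rho> (?p y n) - \<rho> (sqrt1m y)) \<longlonglongrightarrow> 0"
  proof (rule Lim_null_comparison)
    show "\<forall>\<^sub>F n in sequentially. norm (\<rho> (?p y n) - \<rho> (sqrt1m y)) \<le> norm (?p y n - sqrt1m y)"
    proof (rule always_eventually, rule allI)
      show "norm (\<rho> (?p y n) - \<rho> (sqrt1m y)) \<le> norm (?p y n - sqrt1m y)" for n
        using norm_hom_le[of "?p y n - sqrt1m y"] hom_diff[OF pD sD] closure_rules(7)[OF pD sD]
        by simp
    qed
    show "(\<lambda>n. norm (?p y n - sqrt1m y)) \<longlonglongrightarrow> 0"
      using sqrt1m_LIMSEQ[OF assms(2)] by (intro tendsto_norm_zero) (simp add: LIM_zero_iff)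
  qed
  then have "(\<lambda>n. \<rho> (?p y n)) \<longlonglongrightarrow> \<rho> (sqrt1m y)" by (simp add: LIM_zero_iff)
  then show "(\<lambda>n. ?q z n - \<rho> (?p y n)) \<longlonglongrightarrow> sqrt1m z - \<rho> (sqrt1m y)"
    by (intro tendsto_diff sqrt1m_LIMSEQ assms(3))
qed

text \<open>A positive \<open>c = \<rho> d + k\<close> is the square root of \<open>c\<^sup>2\<close>, which modulo \<open>K\<close> is \<open>\<rho> (sqrt (d\<^sup>2))\<close>.\<close>

lemma positive_mod_ideal:
  assumes "d \<in> D" "k \<in> K" "positive (\<rho> d + k)"
  shows "positive d"
proof -
  define c where "c = \<rho> d + k"
  have c: "positive c" using assms(3) by (simp add: c_def)
  have "\<rho> (star d - d) = k - star k"
    using positive_hermitian[OF assms(3)] assms(1)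
    by (simp add: hom_diff hom_star closure_rules star_add algebra_simps)
  then have "star d - d = 0"
    using assms(1,2) by (intro faithful) (simp_all add: closure_rules ideal_diff star_ideal)
  then have sd: "star d = d" by simp
  define t where "t = norm (d * d) + norm (c * c) + 1"
  have t: "0 < t" "norm (d * d) \<le> t" "norm (c * c) \<le> t"
    using norm_ge_zero[of "d * d"] norm_ge_zero[of "c * c"] unfolding t_def by linarith+
  let ?y = "1 - (1 / t) *\<^sub>R (d * d)" and ?z = "1 - (1 / t) *\<^sub>R (c * c)"
  have dd: "norm (t *\<^sub>R 1 - d * d) \<le> t"
    by (rule norm_diff_le_if_positive[OF positive_square[OF sd] t(2)])
  have cc: "norm (t *\<^sub>R 1 - c * c) \<le> t"
    by (rule norm_diff_le_if_positive[OF positive_square[OF positive_hermitian[OF c]] t(3)])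
  have "?z - \<rho> ?y = (- (1 / t)) *\<^sub>R (k * c + \<rho> d * k)"
    using assms(1)
    by (simp add: hom_diff hom_scaleR hom_one hom_mult closure_rules c_def algebra_simps)
  also have "\<dots> \<in> K"
    using assms(2) by (intro ideal_scaleR ideal_add ideal_mult_left ideal_mult_right)
  finally have "sqrt1m ?z - \<rho> (sqrt1m ?y) \<in> K"
    using assms(1) norm_rescale_le[OF t(1) dd] norm_rescale_le[OF t(1) cc]
    by (intro sqrt1m_mod_ideal) (simp_all add: closure_rules)
  then have "sqrt t *\<^sub>R (sqrt1m ?z - \<rho> (sqrt1m ?y)) \<in> K" by (rule ideal_scaleR)
  moreover have sy: "sqrt1m ?y \<in> D"
    using assms(1) norm_rescale_le[OF t(1) dd] subalgebra one_in
    by (intro sqrt1m_in) (simp_all add: closure_rules)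
  ultimately have "psqrt t (c * c) - \<rho> (psqrt t (d * d)) \<in> K"
    by (simp add: psqrt_def hom_scaleR scaleR_diff_right)
  then have "c - \<rho> (psqrt t (d * d)) - k \<in> K"
    using psqrt_eqI[OF t(1,3) c refl] assms(2) by (simp add: ideal_diff)
  moreover have pD: "psqrt t (d * d) \<in> D"
    using sy by (simp add: psqrt_def closure_rules)
  ultimately have "\<rho> (d - psqrt t (d * d)) \<in> K"
    using assms(1) by (simp add: hom_diff c_def algebra_simps)
  then have "d - psqrt t (d * d) = 0"
    using assms(1) pD by (intro faithful) (simp_all add: closure_rules)
  then show ?thesis using positive_psqrt[OF t(1) dd] sd by (simp add: star_mult)
qed

end

section \<open>Square roots of matrices\<close>

text \<open>Vectors and matrices over a C*-algebra are functions of indices below \<open>n\<close>; their other values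
  are irrelevant.\<close>

definition vinner :: "nat \<Rightarrow> (nat \<Rightarrow> 'a :: cstar_algebra) \<Rightarrow> (nat \<Rightarrow> 'a) \<Rightarrow> 'a" where
  "vinner n x y = (\<Sum>i<n. star (x i) * y i)"

definition mat_vec :: "nat \<Rightarrow> (nat \<Rightarrow> nat \<Rightarrow> 'a :: cstar_algebra) \<Rightarrow> (nat \<Rightarrow> 'a) \<Rightarrow> nat \<Rightarrow> 'a" where
  "mat_vec n M x i = (\<Sum>j<n. M i j * x j)"

lemma funpow_mat_vec_Suc: "(mat_vec n M ^^ Suc m) x i = (\<Sum>j<n. M i j * (mat_vec n M ^^ m) x j)"
  unfolding funpow.simps o_apply by (rule mat_vec_def)

definition unit_vec :: "nat \<Rightarrow> nat \<Rightarrow> 'a :: cstar_algebra" where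
  "unit_vec j i = (if i = j then 1 else 0)"

lemma vinner_cong:
  "(\<And>i. i < n \<Longrightarrow> x i = x' i) \<Longrightarrow> (\<And>i. i < n \<Longrightarrow> y i = y' i) \<Longrightarrow> vinner n x y = vinner n x' y'"
  by (simp add: vinner_def)

lemma vinner_add_right: "vinner n x (\<lambda>i. y i + z i) = vinner n x y + vinner n x z"
  by (simp add: vinner_def distrib_left sum.distrib)

lemma vinner_add_left: "vinner n (\<lambda>i. y i + z i) x = vinner n y x + vinner n z x"
  by (simp add: vinner_def distrib_right star_add sum.distrib)

lemma vinner_diff_right: "vinner n x (\<lambda>i. y i - z i) = vinner n x y - vinner n x z"
  by (simp add: vinner_def right_diff_distrib sum_subtractf)

lemma vinner_scaleR_right: "vinner n x (\<lambda>i. r *\<^sub>R y i) = r *\<^sub>R vinner n x y"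
  by (simp add: vinner_def scaleR_sum_right)

lemma star_vinner: "star (vinner n x y) = vinner n y x"
  by (simp add: vinner_def star_sum star_mult star_star)

lemma positive_vinner_self: "positive (vinner n x x)"
  unfolding vinner_def by (rule positive_sum) (rule positive_star_mult_self)

lemma vinner_unit_vec_right: "j < n \<Longrightarrow> vinner n x (unit_vec j) = star (x j)"
  by (simp add: vinner_def unit_vec_def if_distrib[of "\<lambda>u. _ * u"] cong: if_cong)

lemma vinner_unit_vec_left: "j < n \<Longrightarrow> vinner n (unit_vec j) x = x j"
  by (metis star_star star_vinner vinner_unit_vec_right)

lemma vinner_mat_vec:
  assumes "\<And>i j. i < n \<Longrightarrow> j < n \<Longrightarrow> star (M i j) = M j i"
  shows "vinner n (mat_vec n M x) y = vinner n x (mat_vec n M y)"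
proof -
  have "vinner n (mat_vec n M x) y = (\<Sum>i<n. \<Sum>j<n. star (x j) * M j i * y i)"
    by (simp add: vinner_def mat_vec_def star_sum star_mult assms sum_distrib_right)
  also have "\<dots> = (\<Sum>j<n. \<Sum>i<n. star (x j) * M j i * y i)" by (rule sum.swap)
  also have "\<dots> = vinner n x (mat_vec n M y)"
    by (simp add: vinner_def mat_vec_def sum_distrib_left mult.assoc)
  finally show ?thesis .
qed

lemma vinner_funpow_mat_vec:
  assumes "\<And>i j. i < n \<Longrightarrow> j < n \<Longrightarrow> star (M i j) = M j i"
  shows "vinner n ((mat_vec n M ^^ m) x) y = vinner n x ((mat_vec n M ^^ m) y)"
proof (induction m arbitrary: y)
  case (Suc m)
  have "vinner n ((mat_vec n M ^^ Suc m) x) y = vinner n ((mat_vec n M ^^ m) x) (mat_vec n M y)"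
    by (simp add: vinner_mat_vec[OF assms])
  also have "\<dots> = vinner n x ((mat_vec n M ^^ m) (mat_vec n M y))" by (rule Suc.IH)
  finally show ?case by (simp add: funpow_swap1)
qed simp

lemma funpow_mat_vec_expand:
  assumes "i < n"
  shows "(mat_vec n M ^^ m) x i = (\<Sum>k<n. (mat_vec n M ^^ m) (unit_vec k) i * x k)"
  using assms
proof (induction m arbitrary: i)
  case 0
  then show ?case by (simp add: unit_vec_def if_distrib[of "\<lambda>u. u * _"] cong: if_cong)
next
  case (Suc m)
  have "(mat_vec n M ^^ Suc m) x i = (\<Sum>j<n. \<Sum>k<n. M i j * ((mat_vec n M ^^ m) (unit_vec k) j * x k))"
    unfolding funpow_mat_vec_Suc by (simp add: Suc.IH sum_distrib_left)
  also have "\<dots> = (\<Sum>k<n. \<Sum>j<n. M i j * ((mat_vec n M ^^ m) (unit_vec k) j * x k))"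
    by (rule sum.swap)
  also have "\<dots> = (\<Sum>k<n. (mat_vec n M ^^ Suc m) (unit_vec k) i * x k)"
    unfolding funpow_mat_vec_Suc by (simp add: sum_distrib_right mult.assoc)
  finally show ?case .
qed

text \<open>If \<open>0 \<le> T \<le> 1\<close> as a form, then \<open>T\<^sup>2 \<le> T \<le> 1\<close> because
  \<open>T - T\<^sup>2 = T (1 - T) T + (1 - T) T (1 - T)\<close>. Hence the columns of all powers of \<open>T\<close> are bounded.\<close>

lemma norm_funpow_mat_vec_le:
  assumes D: "cstar_subalgebra D" "1 \<in> D"
    and T: "\<And>i j. i < n \<Longrightarrow> j < n \<Longrightarrow> T i j \<in> D" "\<And>i j. i < n \<Longrightarrow> j < n \<Longrightarrow> star (T i j) = T j i"
    and pos: "\<And>x. (\<And>i. i < n \<Longrightarrow> x i \<in> D) \<Longrightarrow> positive (vinner n x (mat_vec n T x))"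
    and le: "\<And>x. (\<And>i. i < n \<Longrightarrow> x i \<in> D) \<Longrightarrow>
      positive (vinner n x (\<lambda>i. x i - mat_vec n T x i))"
    and ij: "i < n" "j < n"
  shows "norm ((mat_vec n T ^^ m) (unit_vec j) i) \<le> 1"
proof -
  let ?T = "mat_vec n T"
  have TD: "?T x i \<in> D" if "\<And>i. i < n \<Longrightarrow> x i \<in> D" "i < n" for x i
    unfolding mat_vec_def using that T(1) by (intro cstar_subalgebraD[OF D(1)]) auto
  have contr: "positive (vinner n x x - vinner n (?T x) (?T x))"
    if x: "\<And>i. i < n \<Longrightarrow> x i \<in> D" for x
  proof -
    define y where "y = ?T x"
    define z where "z = (\<lambda>i. x i - y i)"
    have y: "y i \<in> D" if "i < n" for i using TD x that by (simp add: y_def)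
    have z: "z i \<in> D" if "i < n" for i using x y that by (simp add: z_def cstar_subalgebraD[OF D(1)])
    have xyz: "x = (\<lambda>i. y i + z i)" by (simp add: z_def)
    have Tz: "?T z = (\<lambda>i. y i - ?T y i)"
      by (rule ext) (simp add: z_def mat_vec_def y_def right_diff_distrib sum_subtractf)
    have Ty: "y = (\<lambda>i. ?T y i + ?T z i)" unfolding Tz by simp
    \<comment> \<open>\<open>vinner n z y\<close> is the form of \<open>T - T^2\<close> at
      \<open>x\<close>. The two summands are the forms of \<open>1 - T\<close> at \<open>y\<close>
      and of \<open>T\<close> at \<open>z\<close>, as in the identity above.\<close>
    have "vinner n z y = vinner n z (?T y) + vinner n z (?T z)"
      by (subst Ty) (rule vinner_add_right)
    also have "vinner n z (?T y) = vinner n (?T z) y"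
      by (rule vinner_mat_vec[OF T(2), symmetric])
    also have "\<dots> = star (vinner n y (\<lambda>i. y i - ?T y i))"
      unfolding Tz star_vinner ..
    also have "\<dots> = vinner n y (\<lambda>i. y i - ?T y i)"
      by (rule positive_hermitian[OF le[OF y]])
    finally have zy: "positive (vinner n z y)"
      using positive_add[OF le[OF y] pos[OF z]] by simp
    have "vinner n x x = vinner n y y + vinner n y z + (vinner n z y + vinner n z z)"
      unfolding xyz vinner_add_left vinner_add_right ..
    also have "vinner n y z = vinner n z y"
      using positive_hermitian[OF zy] by (simp add: star_vinner)
    finally have "vinner n x x - vinner n y y = vinner n z y + (vinner n z y + vinner n z z)" by simp
    then show ?thesis unfolding y_def[symmetric]
      by (simp only:) (intro positive_add zy positive_vinner_self)
  qed
  let ?c = "\<lambda>m. (?T ^^ m) (unit_vec j)"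
  have cD: "?c m i \<in> D" if "i < n" for m i
    using that
  proof (induction m arbitrary: i)
    case 0
    then show ?case using D by (simp add: unit_vec_def cstar_subalgebraD)
  next
    case (Suc m)
    show ?case using TD[of "?c m" i] Suc by simp
  qed
  have A: "positive (1 - vinner n (?c m) (?c m))"
  proof (induction m)
    case 0
    show ?case using ij(2) by (simp add: vinner_unit_vec_left) (simp add: unit_vec_def)
  next
    case (Suc m)
    have "1 - vinner n (?c (Suc m)) (?c (Suc m)) = (1 - vinner n (?c m) (?c m)) +
        (vinner n (?c m) (?c m) - vinner n (?T (?c m)) (?T (?c m)))" by simp
    then show ?case using positive_add[OF Suc contr[of "?c m"]] cD by simp
  qed
  \<comment> \<open>Dropping the other entries of the column bounds the single entry.\<close>
  let ?r = "\<Sum>k\<in>{..<n} - {i}. star (?c m k) * ?c m k"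
  have "vinner n (?c m) (?c m) = star (?c m i) * ?c m i + ?r"
    unfolding vinner_def using ij(1) by (simp add: sum.remove)
  then have "(1 - vinner n (?c m) (?c m)) + ?r = 1 *\<^sub>R 1 - star (?c m i) * ?c m i" by simp
  moreover have "positive ((1 - vinner n (?c m) (?c m)) + ?r)"
    by (intro positive_add A positive_sum positive_star_mult_self)
  ultimately have "positive (1 *\<^sub>R 1 - star (?c m i) * ?c m i)" by (simp only:)
  then have "norm (star (?c m i) * ?c m i) \<le> \<bar>1\<bar>"
    by (rule norm_le_if_positive_minus[OF positive_star_mult_self])
  then show ?thesis by (simp add: cstar_identity abs_square_le_1)
qed

text \<open>Completing the square: with \<open>u = r x - a y\<close>, the sum of
  \<open>star u * u\<close> and the conjugate of \<open>r^2 - star a * a\<close> by \<open>y\<close>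
  is \<open>r\<close> times the element in question.\<close>

lemma positive_off_diagonal:
  assumes "norm (a :: 'a :: cstar_algebra) \<le> r" "0 < r"
  shows "positive (r *\<^sub>R (star x * x) + r *\<^sub>R (star y * y) - star x * a * y - star y * star a * x)"
proof -
  let ?u = "r *\<^sub>R x - a * y"
  have "norm (star a * a) \<le> r\<^sup>2"
    using assms by (simp add: cstar_identity power_mono)
  then have "positive (r\<^sup>2 *\<^sub>R 1 - star a * a)"
    by (intro positive_norm_minus) (simp_all add: star_mult star_star)
  then have "positive (star ?u * ?u + star y * (r\<^sup>2 *\<^sub>R 1 - star a * a) * y)"
    by (intro positive_add positive_star_mult_self positive_conj)
  moreover have "star ?u * ?u + star y * (r\<^sup>2 *\<^sub>R 1 - star a * a) * y =
      r *\<^sub>R (r *\<^sub>R (star x * x) + r *\<^sub>R (star y * y) - star x * a * y - star y * star a * x)"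
    by (simp add: star_diff star_mult star_scaleR algebra_simps power2_eq_square)
  ultimately have "positive ((1 / r) *\<^sub>R r *\<^sub>R
      (r *\<^sub>R (star x * x) + r *\<^sub>R (star y * y) - star x * a * y - star y * star a * x))"
    using assms(2) by (intro positive_scaleR[of "1 / r"]) simp_all
  then show ?thesis using assms(2) by simp
qed

text \<open>A substitute for the operator norm of the matrix \<open>M\<close>. Summing the estimate
  for two indices over all pairs counts the form of \<open>M\<close> twice.\<close>

lemma form_bounded:
  fixes M :: "nat \<Rightarrow> nat \<Rightarrow> 'a :: cstar_algebra"
  assumes M: "\<And>i j. i < n \<Longrightarrow> j < n \<Longrightarrow> star (M i j) = M j i"
  shows "\<exists>t>0. \<forall>x. positive (t *\<^sub>R vinner n x x - vinner n x (mat_vec n M x))"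
proof -
  define r where "r = (\<Sum>i<n. \<Sum>j<n. norm (M i j)) + 1"
  have r: "0 < r" unfolding r_def by (intro add_nonneg_pos sum_nonneg) simp_all
  have le: "norm (M i j) \<le> r" if "i < n" "j < n" for i j
  proof -
    have "norm (M i j) \<le> (\<Sum>j<n. norm (M i j))"
      using that by (intro member_le_sum) simp_all
    also have "\<dots> \<le> (\<Sum>i<n. \<Sum>j<n. norm (M i j))"
      using that by (intro member_le_sum[where f = "\<lambda>i. \<Sum>j<n. norm (M i j)"]) (simp_all add: sum_nonneg)
    finally show ?thesis by (simp add: r_def)
  qed
  let ?t = "r * real n + 1"
  have "0 < ?t" using r by (simp add: add_nonneg_pos)
  moreover have "positive (?t *\<^sub>R vinner n x x - vinner n x (mat_vec n M x))" for x
  proof -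
    let ?g = "\<lambda>i j. r *\<^sub>R (star (x i) * x i) + r *\<^sub>R (star (x j) * x j) - star (x i) * M i j * x j -
      star (x j) * M j i * x i"
    let ?f = "vinner n x (mat_vec n M x)"
    have f: "(\<Sum>i<n. \<Sum>j<n. star (x i) * M i j * x j) = ?f"
      by (simp add: vinner_def mat_vec_def sum_distrib_left mult.assoc)
    then have f': "(\<Sum>i<n. \<Sum>j<n. star (x j) * M j i * x i) = ?f" by (subst sum.swap)
    have g: "(\<Sum>i<n. \<Sum>j<n. r *\<^sub>R (star (x i) * x i)) = (r * real n) *\<^sub>R vinner n x x"
      "(\<Sum>i<n. \<Sum>j<n. r *\<^sub>R (star (x j) * x j)) = (r * real n) *\<^sub>R vinner n x x"
      by (simp_all add: vinner_def sum_constant_scaleR scaleR_sum_right mult.commute del: sum_constant)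
    have "positive (\<Sum>i<n. \<Sum>j<n. ?g i j)"
    proof (intro positive_sum)
      show "positive (?g i j)" if "i \<in> {..<n}" "j \<in> {..<n}" for i j
        using positive_off_diagonal[OF le[of i j] r, of "x i" "x j"] that by (simp add: M)
    qed
    also have "(\<Sum>i<n. \<Sum>j<n. ?g i j) = 2 *\<^sub>R ((r * real n) *\<^sub>R vinner n x x - ?f)"
      unfolding sum_subtractf sum.distrib f f' g by (simp add: scaleR_2)
    finally have "positive ((1 / 2) *\<^sub>R 2 *\<^sub>R ((r * real n) *\<^sub>R vinner n x x - ?f))"
      by (intro positive_scaleR[of "1 / 2"]) simp_all
    then have "positive (vinner n x x + ((r * real n) *\<^sub>R vinner n x x - ?f))"
      by (intro positive_add positive_vinner_self) simp
    then show ?thesis by (simp add: algebra_simps)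
  qed
  ultimately show ?thesis by blast
qed

text \<open>For \<open>T = 1 - M / t\<close> the forms satisfy \<open>0 \<le> T \<le> 1\<close>, so
  all powers of \<open>T\<close> have entries of norm at most 1 and the series of
  \<open>sqrt (1 - T)\<close> converges entry by entry. Positivity is tested on vectors over
  \<open>D\<close> only, since that is what \<open>positive_mod_ideal\<close> can deliver.\<close>

theorem matrix_sqrt_exists:
  fixes M :: "nat \<Rightarrow> nat \<Rightarrow> 'a :: cstar_algebra"
  assumes D: "cstar_subalgebra D" "1 \<in> D"
    and M: "\<And>i j. i < n \<Longrightarrow> j < n \<Longrightarrow> M i j \<in> D" "\<And>i j. i < n \<Longrightarrow> j < n \<Longrightarrow> star (M i j) = M j i"
    and pos: "\<And>x. (\<And>i. i < n \<Longrightarrow> x i \<in> D) \<Longrightarrow> positive (vinner n x (mat_vec n M x))"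
  shows "\<exists>S. \<forall>i<n. \<forall>j<n. S i j \<in> D \<and> star (S i j) = S j i \<and> (\<Sum>k<n. S i k * S k j) = M i j"
proof -
  obtain t where t: "0 < t" "\<And>x. positive (t *\<^sub>R vinner n x x - vinner n x (mat_vec n M x))"
    using form_bounded[of n M, OF M(2)] by blast
  define T where "T i j = unit_vec j i - (1 / t) *\<^sub>R M i j" for i j
  have Tx: "mat_vec n T x i = x i - (1 / t) *\<^sub>R mat_vec n M x i" if "i < n" for x i
    using that
    by (simp add: mat_vec_def T_def unit_vec_def left_diff_distrib sum_subtractf scaleR_sum_right
        if_distrib[of "\<lambda>u. u * _"] cong: if_cong)
  have TD: "T i j \<in> D" if "i < n" "j < n" for i j
    using that M(1) D by (simp add: T_def unit_vec_def cstar_subalgebraD)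
  have sT: "star (T i j) = T j i" if "i < n" "j < n" for i j
    using that M(2) by (simp add: T_def unit_vec_def star_diff star_scaleR)
  \<comment> \<open>The matrix \<open>P m\<close> is the \<open>m\<close>-th power of
    \<open>T\<close>, built from its columns.\<close>
  define P where "P m i j = (mat_vec n T ^^ m) (unit_vec j) i" for m i j
  have P: "norm (P m i j) \<le> 1" if "i < n" "j < n" for m i j
    unfolding P_def
  proof (rule norm_funpow_mat_vec_le[OF D TD sT])
    fix x :: "nat \<Rightarrow> 'a" assume x: "\<And>i. i < n \<Longrightarrow> x i \<in> D"
    have "vinner n x (mat_vec n T x) = vinner n x (\<lambda>i. x i - (1 / t) *\<^sub>R mat_vec n M x i)"
      by (rule vinner_cong) (simp_all add: Tx)
    also have "\<dots> = (1 / t) *\<^sub>R (t *\<^sub>R vinner n x x - vinner n x (mat_vec n M x))"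
      using t(1) by (simp add: vinner_diff_right vinner_scaleR_right scaleR_diff_right)
    finally show "positive (vinner n x (mat_vec n T x))"
      using t by (simp add: positive_scaleR del: scaleR_scaleR)
    have "vinner n x (\<lambda>i. x i - mat_vec n T x i) = vinner n x (\<lambda>i. (1 / t) *\<^sub>R mat_vec n M x i)"
      by (rule vinner_cong) (simp_all add: Tx)
    then show "positive (vinner n x (\<lambda>i. x i - mat_vec n T x i))"
      using pos[OF x] t(1) by (simp add: vinner_scaleR_right positive_scaleR)
  qed (use that in simp_all)
  have PD: "P m i j \<in> D" if "i < n" "j < n" for m i j
    using that(1)
  proof (induction m arbitrary: i)
    case 0
    then show ?case using D by (simp add: P_def unit_vec_def cstar_subalgebraD)
  next
    case (Suc m)
    have "P (Suc m) i j = (\<Sum>k<n. T i k * P m k j)" unfolding P_def by (rule funpow_mat_vec_Suc)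
    also have "\<dots> \<in> D"
      using Suc TD by (intro cstar_subalgebraD(10)[OF D(1)] cstar_subalgebraD(3)[OF D(1)]) simp_all
    finally show ?case .
  qed
  have P_add: "(\<Sum>k<n. P a i k * P b k j) = P (a + b) i j" if "i < n" for a b i j
    using funpow_mat_vec_expand[OF that, where M = T and m = a and x = "(mat_vec n T ^^ b) (unit_vec j)"]
    by (simp add: P_def funpow_add)
  have sP: "star (P m i j) = P m j i" if "i < n" "j < n" for m i j
    using vinner_funpow_mat_vec[where n = n and M = T and m = m and x = "unit_vec j" and y = "unit_vec i", OF sT] that
    by (simp add: P_def vinner_unit_vec_left vinner_unit_vec_right)
  have bound: "norm (sqrt_coeff m *\<^sub>R P m i j) \<le> \<bar>sqrt_coeff m\<bar>" if "i < n" "j < n" for m i j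
    using mult_left_mono[OF P[OF that, of m], of "\<bar>sqrt_coeff m\<bar>"] by simp
  have sm: "summable (\<lambda>m. norm (sqrt_coeff m *\<^sub>R P m i j))" if "i < n" "j < n" for i j
    by (rule summable_comparison_test'[OF summable_abs_sqrt_coeff]) (use bound[OF that] in simp)
  define R where "R i j = (\<Sum>m. sqrt_coeff m *\<^sub>R P m i j)" for i j
  have lim: "(\<lambda>N. \<Sum>m<N. sqrt_coeff m *\<^sub>R P m i j) \<longlonglongrightarrow> R i j" if "i < n" "j < n" for i j
    unfolding R_def by (rule summable_LIMSEQ[OF summable_norm_cancel[OF sm[OF that]]])
  have RD: "R i j \<in> D" if "i < n" "j < n" for i j
    by (rule closed_sequentially[OF cstar_subalgebraD(9)[OF D(1)] _ lim[OF that]])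
      (simp add: cstar_subalgebraD(5,10)[OF D(1)] PD that)
  have sR: "star (R i j) = R j i" if "i < n" "j < n" for i j
  proof -
    have "(\<lambda>N. star (\<Sum>m<N. sqrt_coeff m *\<^sub>R P m i j)) \<longlonglongrightarrow> star (R i j)"
      by (rule bounded_linear.tendsto[OF bounded_linear_star lim[OF that]])
    moreover have "star (\<Sum>m<N. sqrt_coeff m *\<^sub>R P m i j) = (\<Sum>m<N. sqrt_coeff m *\<^sub>R P m j i)" for N
      using that by (simp add: star_sum star_scaleR sP)
    ultimately show ?thesis using lim[of j i] that by (simp add: LIMSEQ_unique)
  qed
  have RR: "(\<Sum>k<n. R i k * R k j) = (1 / t) *\<^sub>R M i j" if "i < n" "j < n" for i j
  proof -
    \<comment> \<open>The Cauchy product is taken for each \<open>k\<close>. Summing over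
      \<open>k\<close> turns \<open>P a\<close> times \<open>P (m - a)\<close> into
      \<open>P m\<close>, which leaves the scalar convolution.\<close>
    let ?h = "\<lambda>m k. \<Sum>a\<le>m. (sqrt_coeff a *\<^sub>R P a i k) * (sqrt_coeff (m - a) *\<^sub>R P (m - a) k j)"
    have "(\<lambda>m. \<Sum>k<n. ?h m k) sums (\<Sum>k<n. R i k * R k j)"
      unfolding R_def using that by (intro sums_sum Cauchy_product_sums sm) simp_all
    moreover have "(\<Sum>k<n. ?h m k) =
        (if m = 0 then 1 else if m = 1 then - 1 else 0) *\<^sub>R P m i j" for m
    proof -
      have "(\<Sum>k<n. ?h m k) =
          (\<Sum>a\<le>m. \<Sum>k<n. (sqrt_coeff a * sqrt_coeff (m - a)) *\<^sub>R (P a i k * P (m - a) k j))"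
        by (subst sum.swap) (simp add: mult.commute)
      also have "\<dots> = (\<Sum>a\<le>m. (sqrt_coeff a * sqrt_coeff (m - a)) *\<^sub>R P m i j)"
        unfolding scaleR_sum_right[symmetric] P_add[OF that(1)] by simp
      finally show ?thesis
        unfolding scaleR_sum_left[symmetric] sqrt_coeff_convolution .
    qed
    moreover have "(\<lambda>m. (if m = 0 then 1 else if m = 1 then - 1 else 0) *\<^sub>R P m i j) sums
        (\<Sum>m\<in>{0,1}. (if m = 0 then 1 else if m = 1 then - 1 else 0) *\<^sub>R P m i j)"
      by (rule sums_finite) auto
    ultimately have "(\<Sum>k<n. R i k * R k j) = P 0 i j - P 1 i j" by (auto dest: sums_unique2)
    also have "P 1 i j = T i j"
      using that
      by (simp add: P_def mat_vec_def unit_vec_def if_distrib[of "\<lambda>u. _ * u"] cong: if_cong)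
    finally show ?thesis by (simp add: P_def T_def)
  qed
  show ?thesis
  proof (intro exI[of _ "\<lambda>i j. sqrt t *\<^sub>R R i j"] allI impI conjI)
    show "(\<Sum>k<n. (sqrt t *\<^sub>R R i k) * (sqrt t *\<^sub>R R k j)) = M i j" if "i < n" "j < n" for i j
      using t(1) RR[OF that] by (simp add: scaleR_sum_right[symmetric])
  qed (simp_all add: RD sR star_scaleR cstar_subalgebraD(5)[OF D(1)])
qed

section \<open>Transport of structure and extension of completely positive maps\<close>

text \<open>Injectivity is tested on carrier sets inside a universe type, so the algebra is copied
  there along an injection.\<close>

definition transport_cstar :: "('a :: cstar_algebra \<Rightarrow> 'u) \<Rightarrow> 'u cstar_struct" where
  "transport_cstar f = \<lparr>carrier = range f, mult = \<lambda>x y. f (inv_into UNIV f x * inv_into UNIV f y), one = f 1, zero = f 0,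
     add = \<lambda>x y. f (inv_into UNIV f x + inv_into UNIV f y), smult = \<lambda>a x. f (a *\<^sub>C inv_into UNIV f x),
     adj = \<lambda>x. f (star (inv_into UNIV f x)), nrm = \<lambda>x. norm (inv_into UNIV f x)\<rparr>"

lemma transport_cstar_simps [simp]:
  "carrier (transport_cstar f) = range f"
  "mult (transport_cstar f) = (\<lambda>x y. f (inv_into UNIV f x * inv_into UNIV f y))"
  "one (transport_cstar f) = f 1"
  "zero (transport_cstar f) = f 0"
  "add (transport_cstar f) = (\<lambda>x y. f (inv_into UNIV f x + inv_into UNIV f y))"
  "smult (transport_cstar f) = (\<lambda>a x. f (a *\<^sub>C inv_into UNIV f x))"
  "adj (transport_cstar f) = (\<lambda>x. f (star (inv_into UNIV f x)))"
  "nrm (transport_cstar f) = (\<lambda>x. norm (inv_into UNIV f x))"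
  by (simp_all add: transport_cstar_def)

lemma cring_complex_ring: "cring complex_ring"
proof (rule cringI)
  show "abelian_group complex_ring"
    by (rule abelian_groupI) (auto simp: complex_ring_def intro: exI[of _ "- _"] left_minus)
  show "comm_monoid complex_ring"
    by (rule comm_monoidI) (auto simp: complex_ring_def)
qed (auto simp: complex_ring_def algebra_simps)

context
  fixes f :: "'a :: cstar_algebra \<Rightarrow> 'u"
  assumes inj: "inj f"
begin

lemma inv_f [simp]: "inv_into UNIV f (f x) = x"
  using inj by (rule inv_f_f)

lemma abelian_group_transport: "abelian_group (transport_cstar f)"
proof (rule abelian_groupI)
  fix x assume "x \<in> carrier (transport_cstar f)"
  then obtain y where "x = f y" by auto
  then show "\<exists>y\<in>carrier (transport_cstar f). add (transport_cstar f) y x = zero (transport_cstar f)"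
    by (intro bexI[of _ "f (- y)"]) simp_all
qed (auto simp: ac_simps)

lemma ring_transport: "ring (transport_cstar f)"
proof (rule ringI[OF abelian_group_transport])
  show "Group.monoid (transport_cstar f)"
    by (rule Group.monoidI) (auto simp: mult.assoc)
qed (auto simp: algebra_simps)

lemma minus_transport: "a_minus (transport_cstar f) (f x) (f y) = f (x - y)"
proof -
  interpret A: ring "transport_cstar f" by (rule ring_transport)
  have "a_inv (transport_cstar f) (f y) = f (- y)"
    by (rule A.minus_equality) simp_all
  then show ?thesis by (simp add: a_minus_def)
qed

lemma module_transport: "module complex_ring (transport_cstar f)"
  by (rule moduleI[OF cring_complex_ring abelian_group_transport])
    (auto simp: complex_ring_def scaleC_add_left scaleC_add_right scaleC_scaleC scaleC_one)

lemma cstar_structure_transport: "cstar_structure (transport_cstar f)"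
proof -
  let ?A = "transport_cstar f"
  have complete: "\<exists>x\<in>carrier ?A. (\<lambda>n. nrm ?A (a_minus ?A (\<sigma> n) x)) \<longlonglongrightarrow> 0"
    if ran: "range \<sigma> \<subseteq> carrier ?A"
      and cauchy: "\<And>e. 0 < e \<Longrightarrow> \<exists>N. \<forall>m\<ge>N. \<forall>n\<ge>N. nrm ?A (a_minus ?A (\<sigma> m) (\<sigma> n)) < e"
    for \<sigma> :: "nat \<Rightarrow> 'u"
  proof -
    define s where "s n = inv_into UNIV f (\<sigma> n)" for n
    have \<sigma>: "\<sigma> n = f (s n)" for n
      using ran unfolding s_def by (metis f_inv_into_f rangeI subsetD transport_cstar_simps(1))
    have "Cauchy s"
      unfolding Cauchy_def dist_norm using cauchy by (simp add: \<sigma> minus_transport)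
    then obtain x where "s \<longlonglongrightarrow> x"
      using Cauchy_convergent convergent_def by blast
    then have "(\<lambda>n. norm (s n - x)) \<longlonglongrightarrow> 0"
      by (simp add: LIM_zero tendsto_norm_zero)
    then show ?thesis by (intro bexI[of _ "f x"]) (simp_all add: \<sigma> minus_transport)
  qed
  have f0: "f y = f 0 \<longleftrightarrow> y = 0" for y using inj by (simp add: inj_eq)
  show ?thesis
  proof (intro cstar_structure.intro cstar_structure_axioms.intro)
    show "ring ?A" by (rule ring_transport)
    show "module complex_ring ?A" by (rule module_transport)
    show "\<exists>x\<in>carrier ?A. (\<lambda>n. nrm ?A (a_minus ?A (\<sigma> n) x)) \<longlonglongrightarrow> 0"
      if "range \<sigma> \<subseteq> carrier ?A"
        "\<And>e. 0 < e \<Longrightarrow> \<exists>N. \<forall>m\<ge>N. \<forall>n\<ge>N. nrm ?A (a_minus ?A (\<sigma> m) (\<sigma> n)) < e" for \<sigma>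
      by (rule complete[OF that])
  qed (auto simp: mult_scaleC_left mult_scaleC_right star_add star_scaleC f0
      star_mult star_star norm_triangle_ineq norm_scaleC norm_mult_ineq cstar_identity)
qed

lemma finsum_transport:
  assumes "finite S"
  shows "finsum (transport_cstar f) (\<lambda>k. f (h k)) S = f (sum h S)"
proof -
  interpret A: ring "transport_cstar f" by (rule ring_transport)
  show ?thesis using assms
  proof (induction S rule: finite_induct)
    case (insert k S)
    then have "finsum (transport_cstar f) (\<lambda>k. f (h k)) (insert k S) =
        add (transport_cstar f) (f (h k)) (finsum (transport_cstar f) (\<lambda>k. f (h k)) S)"
      by (intro A.finsum_insert) auto
    then show ?case using insert by simp
  qed (use A.finsum_empty in simp)
qed

end

lemma finsum_univ_cstar: "finite S \<Longrightarrow> finsum univ_cstar h S = sum h S"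
proof (induction S rule: finite_induct)
  interpret A: cstar_structure univ_cstar by (rule cstar_structure_univ_cstar)
  {
    case empty
    show ?case using A.finsum_empty by simp
  next
    case (insert k S)
    have "finsum univ_cstar h (insert k S) = add univ_cstar (h k) (finsum univ_cstar h S)"
      using insert by (intro A.finsum_insert) auto
    then show ?case using insert by simp
  }
qed

lemma mat_pos_univ_cstar:
  "mat_pos univ_cstar n M \<longleftrightarrow>
    (\<exists>B. \<forall>i<n. \<forall>j<n. M i j = (\<Sum>k<n. star (B k i) * B k j))"
  by (simp add: mat_pos_def finsum_univ_cstar)

lemma mat_pos_transport:
  assumes "inj f"
  shows "mat_pos (transport_cstar f) n (\<lambda>i j. f (M i j)) \<longleftrightarrow> mat_pos univ_cstar n M"
proof
  assume "mat_pos (transport_cstar f) n (\<lambda>i j. f (M i j))"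
  then obtain B where M: "\<forall>i<n. \<forall>j<n. f (M i j) = finsum (transport_cstar f)
      (\<lambda>k. mult (transport_cstar f) (adj (transport_cstar f) (B k i)) (B k j)) {..<n}"
    unfolding mat_pos_def by blast
  have "f (M i j) = f (\<Sum>k<n. star (inv_into UNIV f (B k i)) * inv_into UNIV f (B k j))" if "i < n" "j < n" for i j
    using M that finsum_transport[OF assms finite_lessThan] by (simp add: inv_f[OF assms])
  then show "mat_pos univ_cstar n M"
    unfolding mat_pos_univ_cstar
    by (intro exI[of _ "\<lambda>i j. inv_into UNIV f (B i j)"]) (simp add: inj_eq[OF assms])
next
  assume "mat_pos univ_cstar n M"
  then obtain B where "\<forall>i<n. \<forall>j<n. M i j = (\<Sum>k<n. star (B k i) * B k j)"
    unfolding mat_pos_univ_cstar by blast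
  then show "mat_pos (transport_cstar f) n (\<lambda>i j. f (M i j))"
    unfolding mat_pos_def
    by (intro exI[of _ "\<lambda>i j. f (B i j)"]) (simp add: inv_f[OF assms] finsum_transport[OF assms finite_lessThan])
qed

lemma mat_pos_cong:
  assumes "\<And>i j. i < n \<Longrightarrow> j < n \<Longrightarrow> M i j = N i j"
  shows "mat_pos A n M \<longleftrightarrow> mat_pos A n N"
  using assms by (simp add: mat_pos_def)

section \<open>Extension of unital completely positive maps\<close>

lemma ucp_univ_cstar_iff:
  "ucp univ_cstar S univ_cstar UNIV \<phi> \<longleftrightarrow>
     (\<forall>x\<in>S. \<forall>y\<in>S. \<phi> (x + y) = \<phi> x + \<phi> y) \<and> (\<forall>a. \<forall>x\<in>S. \<phi> (a *\<^sub>C x) = a *\<^sub>C \<phi> x) \<and> \<phi> 1 = 1 \<and>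
     (\<forall>n M. (\<forall>i<n. \<forall>j<n. M i j \<in> S) \<and> mat_pos univ_cstar n M \<longrightarrow>
        mat_pos univ_cstar n (\<lambda>i j. \<phi> (M i j)))"
  by (simp add: ucp_def)

lemma ucp_univ_cstarD:
  assumes "ucp univ_cstar S univ_cstar UNIV \<phi>"
  shows "x \<in> S \<Longrightarrow> y \<in> S \<Longrightarrow> \<phi> (x + y) = \<phi> x + \<phi> y" "x \<in> S \<Longrightarrow> \<phi> (a *\<^sub>C x) = a *\<^sub>C \<phi> x" "\<phi> 1 = 1"
    "(\<And>i j. i < n \<Longrightarrow> j < n \<Longrightarrow> M i j \<in> S) \<Longrightarrow> mat_pos univ_cstar n M \<Longrightarrow>
      mat_pos univ_cstar n (\<lambda>i j. \<phi> (M i j))"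
  using assms unfolding ucp_univ_cstar_iff by simp_all

lemma operator_system_transport:
  assumes "inj f" and "csubspace S" "1 \<in> S" "\<And>x. x \<in> S \<Longrightarrow> star x \<in> S"
  shows "operator_system (transport_cstar f) (f ` S)"
proof -
  interpret A: module complex_ring "transport_cstar f" by (rule module_transport[OF assms(1)])
  have inv: "a_inv (transport_cstar f) (f x) = f (- x)" for x
    by (rule A.minus_equality) (simp_all add: assms(1))
  have "submodule (f ` S) complex_ring (transport_cstar f)"
    using assms complex_vector.subspace_0[OF assms(2)] complex_vector.subspace_neg[OF assms(2)]
      complex_vector.subspace_add[OF assms(2)] complex_vector.subspace_scale[OF assms(2)]
    by (intro A.submoduleI) (auto simp: inv)
  then show ?thesis
    using assms cstar_structure_transport[OF assms(1)] by (auto simp: operator_system_def)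
qed

lemma injective_cstar_extend:
  fixes f :: "'a :: cstar_algebra \<Rightarrow> 'u" and \<phi> :: "'a \<Rightarrow> 'i :: cstar_algebra"
  assumes "injective_cstar TYPE('u) TYPE('i)" "inj f"
    and S: "csubspace S" "1 \<in> S" "\<And>x. x \<in> S \<Longrightarrow> star x \<in> S"
    and \<phi>: "ucp univ_cstar S univ_cstar UNIV \<phi>"
  shows "\<exists>\<psi>. ucp univ_cstar UNIV univ_cstar UNIV \<psi> \<and> (\<forall>x\<in>S. \<psi> x = \<phi> x)"
proof -
  let ?A = "transport_cstar f" and ?g = "inv_into UNIV f"
  note [simp] = inv_f[OF assms(2)]
  have "ucp ?A (f ` S) univ_cstar UNIV (\<phi> \<circ> ?g)"
    unfolding ucp_def
  proof (intro conjI allI impI)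
    fix n and M :: "nat \<Rightarrow> nat \<Rightarrow> 'u"
    assume M: "(\<forall>i<n. \<forall>j<n. M i j \<in> f ` S) \<and> mat_pos ?A n M"
    then have "mat_pos ?A n (\<lambda>i j. f (?g (M i j))) \<longleftrightarrow> mat_pos ?A n M"
      by (intro mat_pos_cong f_inv_into_f) blast
    then have "mat_pos univ_cstar n (\<lambda>i j. ?g (M i j))"
      using M mat_pos_transport[OF assms(2), of n "\<lambda>i j. ?g (M i j)"] by blast
    moreover have "?g y \<in> S" if "y \<in> f ` S" for y using that by auto
    with M have "\<forall>i<n. \<forall>j<n. ?g (M i j) \<in> S" by blast
    ultimately show "mat_pos univ_cstar n (\<lambda>i j. (\<phi> \<circ> ?g) (M i j))"
      unfolding o_def by (intro ucp_univ_cstarD(4)[OF \<phi>]) simp_all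
  qed (use \<phi> in \<open>auto simp: ucp_univ_cstar_iff\<close>)
  moreover have "operator_system ?A (f ` S)"
    by (rule operator_system_transport[OF assms(2) S])
  moreover have "operator_system ?A (f ` UNIV)"
    by (rule operator_system_transport[OF assms(2) complex_vector.subspace_UNIV]) simp_all
  moreover have "f ` S \<subseteq> f ` UNIV" by blast
  ultimately obtain \<psi> where \<psi>: "ucp ?A (f ` UNIV) univ_cstar UNIV \<psi>"
    "\<forall>x\<in>f ` S. \<psi> x = (\<phi> \<circ> ?g) x"
    using assms(1)[unfolded injective_cstar_def, rule_format, of ?A "f ` S" "f ` UNIV" "\<phi> \<circ> ?g"]
    by blast
  show ?thesis
  proof (intro exI[of _ "\<psi> \<circ> f"] conjI ballI)
    show "ucp univ_cstar UNIV univ_cstar UNIV (\<psi> \<circ> f)"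
      unfolding ucp_univ_cstar_iff
    proof (intro conjI allI impI ballI)
      show "(\<psi> \<circ> f) (x + y) = (\<psi> \<circ> f) x + (\<psi> \<circ> f) y" for x y
        using \<psi>(1) by (simp add: ucp_def)
      show "(\<psi> \<circ> f) (a *\<^sub>C x) = a *\<^sub>C (\<psi> \<circ> f) x" for a x
        using \<psi>(1) by (simp add: ucp_def)
      show "(\<psi> \<circ> f) 1 = 1" using \<psi>(1) by (simp add: ucp_def)
      fix n and M :: "nat \<Rightarrow> nat \<Rightarrow> 'a"
      assume "(\<forall>i<n. \<forall>j<n. M i j \<in> UNIV) \<and> mat_pos univ_cstar n M"
      then have "mat_pos ?A n (\<lambda>i j. f (M i j))" by (simp add: mat_pos_transport assms(2))
      then show "mat_pos univ_cstar n (\<lambda>i j. (\<psi> \<circ> f) (M i j))"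
        using \<psi>(1) by (simp add: ucp_def)
    qed
    show "(\<psi> \<circ> f) x = \<phi> x" if "x \<in> S" for x using \<psi>(2) that by simp
  qed
qed

context star_hom_mod_ideal
begin

text \<open>On the operator system \<rho>(D) + K the \<open>D\<close>-component is unique by
  faithfulness. If a matrix over this system is positive, the form of its \<open>D\<close>-part is
  positive modulo \<open>K\<close>, hence positive in \<open>D\<close>; so the \<open>D\<close>-part
  has a root over \<open>D\<close>, and \<iota> maps this root to a witness of positivity.\<close>

theorem ucp_extension_mod_ideal:
  fixes \<iota> :: "'b \<Rightarrow> 'i :: cstar_algebra" and f :: "'a \<Rightarrow> 'u"
  assumes \<iota>: "unital_star_hom_on D \<iota>"
    and inj: "injective_cstar TYPE('u) TYPE('i)" "inj f"
  shows "\<exists>\<psi>. ucp univ_cstar UNIV univ_cstar UNIV \<psi> \<and> (\<forall>d\<in>D. \<psi> (\<rho> d) = \<iota> d) \<and> (\<forall>k\<in>K. \<psi> k = 0)"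
proof -
  interpret \<iota>: star_hom D \<iota> by (rule star_hom.intro[OF subalgebra one_in \<iota>])
  define S where "S = {x. \<exists>d\<in>D. x - \<rho> d \<in> K}"
  \<comment> \<open>The choice is unique by \<open>p_eq\<close>, which makes \<open>p\<close> linear
    and compatible with \<open>star\<close>.\<close>
  define p where "p x = (SOME d. d \<in> D \<and> x - \<rho> d \<in> K)" for x
  have p: "p x \<in> D \<and> x - \<rho> (p x) \<in> K" if "x \<in> S" for x
    using that someI_ex[of "\<lambda>d. d \<in> D \<and> x - \<rho> d \<in> K"] unfolding S_def p_def by blast
  have SI: "x \<in> S" if "d \<in> D" "x - \<rho> d \<in> K" for x d
    using that by (auto simp: S_def)
  have p_eq: "p x = d" if "d \<in> D" "x - \<rho> d \<in> K" for x d
  proof -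
    have "p x \<in> D \<and> x - \<rho> (p x) \<in> K" by (rule p[OF SI[OF that]])
    moreover from this have "\<rho> (d - p x) \<in> K"
      using ideal_diff[of "x - \<rho> (p x)" "x - \<rho> d"] that by (simp add: hom_diff)
    ultimately show ?thesis using faithful[of "d - p x"] that by (simp add: closure_rules)
  qed
  have add: "p x + p y \<in> D \<and> (x + y) - \<rho> (p x + p y) \<in> K" if "x \<in> S" "y \<in> S" for x y
    using p[OF that(1)] p[OF that(2)] ideal_add[of "x - \<rho> (p x)" "y - \<rho> (p y)"]
    by (simp add: closure_rules hom_add algebra_simps)
  have scale: "a *\<^sub>C p x \<in> D \<and> a *\<^sub>C x - \<rho> (a *\<^sub>C p x) \<in> K" if "x \<in> S" for a x
    using p[OF that] ideal_scaleC[of "x - \<rho> (p x)" a]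
    by (simp add: closure_rules hom_scaleC complex_vector.scale_right_diff_distrib)
  have adj: "star (p x) \<in> D \<and> star x - \<rho> (star (p x)) \<in> K" if "x \<in> S" for x
    using p[OF that] star_ideal[of "x - \<rho> (p x)"] by (simp add: closure_rules hom_star star_diff)
  have one: "1 - \<rho> 1 \<in> K" by (simp add: hom_one ideal_0)
  have sub: "csubspace S"
  proof (rule complex_vector.subspaceI)
    show "0 \<in> S" by (rule SI[of 0]) (simp_all add: hom_zero ideal_0 closure_rules)
    show "x + y \<in> S" if "x \<in> S" "y \<in> S" for x y using add[OF that] SI by blast
    show "a *\<^sub>C x \<in> S" if "x \<in> S" for a x using scale[OF that] SI by blast
  qed
  have "ucp univ_cstar S univ_cstar UNIV (\<lambda>x. \<iota> (p x))"
    unfolding ucp_univ_cstar_iff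
  proof (intro conjI allI impI ballI)
    show "\<iota> (p (x + y)) = \<iota> (p x) + \<iota> (p y)" if "x \<in> S" "y \<in> S" for x y
      using p_eq[OF conjunct1 conjunct2, OF add[OF that] add[OF that]] p[OF that(1)] p[OF that(2)]
      by (simp add: \<iota>.hom_add)
    show "\<iota> (p (a *\<^sub>C x)) = a *\<^sub>C \<iota> (p x)" if "x \<in> S" for a x
      using p_eq[OF conjunct1 conjunct2, OF scale[OF that] scale[OF that]] p[OF that] by (simp add: \<iota>.hom_scaleC)
    show "\<iota> (p 1) = 1" using p_eq[OF one_in one] by (simp add: \<iota>.hom_one)
    fix n and M :: "nat \<Rightarrow> nat \<Rightarrow> 'a"
    assume M: "(\<forall>i<n. \<forall>j<n. M i j \<in> S) \<and> mat_pos univ_cstar n M"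
    then obtain B where B: "\<And>i j. i < n \<Longrightarrow> j < n \<Longrightarrow> M i j = (\<Sum>k<n. star (B k i) * B k j)"
      unfolding mat_pos_univ_cstar by blast
    define N where "N i j = p (M i j)" for i j
    have N: "N i j \<in> D" "M i j - \<rho> (N i j) \<in> K" if "i < n" "j < n" for i j
      using p[of "M i j"] M that by (auto simp: N_def)
    have sN: "star (N i j) = N j i" if "i < n" "j < n" for i j
    proof -
      have "star (M i j) = M j i" using that by (simp add: B star_sum star_mult star_star)
      moreover have "M i j \<in> S" using M that by blast
      ultimately show ?thesis
        using p_eq[OF conjunct1 conjunct2, OF adj adj, of "M i j"] by (simp add: N_def)
    qed
    have pos: "positive (vinner n x (mat_vec n N x))" if x: "\<And>i. i < n \<Longrightarrow> x i \<in> D" for x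
    proof (rule positive_mod_ideal)
      let ?x = "\<lambda>i. \<rho> (x i)"
      have Nx: "mat_vec n N x i \<in> D" if "i < n" for i
        unfolding mat_vec_def using that x N by (intro closure_rules(10) closure_rules(3)) simp_all
      show "vinner n x (mat_vec n N x) \<in> D"
        unfolding vinner_def using x Nx by (intro closure_rules(10) closure_rules(3) closure_rules(8)) simp_all
      have "\<rho> (mat_vec n N x i) = (\<Sum>j<n. \<rho> (N i j) * ?x j)" if "i < n" for i
      proof -
        have NxD: "N i j \<in> D" "x j \<in> D" if "j < n" for j
          using \<open>i < n\<close> that x N by simp_all
        have "\<rho> (mat_vec n N x i) = (\<Sum>j<n. \<rho> (N i j * x j))"
          unfolding mat_vec_def using NxD by (intro hom_sum closure_rules(3)) simp_all
        also have "\<dots> = (\<Sum>j<n. \<rho> (N i j) * ?x j)"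
          using NxD by (intro sum.cong refl hom_mult) simp_all
        finally show ?thesis .
      qed
      then have "\<rho> (vinner n x (mat_vec n N x)) =
          (\<Sum>i<n. star (?x i) * (\<Sum>j<n. \<rho> (N i j) * ?x j))"
        unfolding vinner_def using x Nx
        by (subst hom_sum) (simp_all add: hom_mult hom_star closure_rules(3,8))
      then have eq: "vinner n ?x (mat_vec n M ?x) - \<rho> (vinner n x (mat_vec n N x)) =
          (\<Sum>i<n. star (?x i) * (\<Sum>j<n. (M i j - \<rho> (N i j)) * ?x j))"
        by (simp add: vinner_def mat_vec_def sum_subtractf left_diff_distrib right_diff_distrib)
      show "vinner n ?x (mat_vec n M ?x) - \<rho> (vinner n x (mat_vec n N x)) \<in> K"
        unfolding eq using N
        by (intro ideal_sum ideal_mult_left ideal_mult_right) simp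
      have "vinner n ?x (mat_vec n M ?x) =
          (\<Sum>i<n. \<Sum>j<n. \<Sum>k<n. star (?x i) * star (B k i) * (B k j * ?x j))"
        by (simp add: vinner_def mat_vec_def B sum_distrib_left sum_distrib_right mult.assoc)
      also have "\<dots> = (\<Sum>i<n. \<Sum>k<n. \<Sum>j<n. star (?x i) * star (B k i) * (B k j * ?x j))"
        by (intro sum.cong refl sum.swap)
      also have "\<dots> = (\<Sum>k<n. \<Sum>i<n. \<Sum>j<n. star (?x i) * star (B k i) * (B k j * ?x j))"
        by (rule sum.swap)
      also have "\<dots> = vinner n (mat_vec n B ?x) (mat_vec n B ?x)"
        by (simp add: vinner_def mat_vec_def star_sum star_mult sum_product)
      finally have "vinner n ?x (mat_vec n M ?x) = vinner n (mat_vec n B ?x) (mat_vec n B ?x)" .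
      then show "positive (\<rho> (vinner n x (mat_vec n N x)) +
          (vinner n ?x (mat_vec n M ?x) - \<rho> (vinner n x (mat_vec n N x))))"
        by (simp add: positive_vinner_self)
    qed
    \<comment> \<open>The entries of the root lie in \<open>D\<close>, where \<iota> is
      multiplicative.\<close>
    obtain R where R: "\<And>i j. i < n \<Longrightarrow> j < n \<Longrightarrow> R i j \<in> D"
      "\<And>i j. i < n \<Longrightarrow> j < n \<Longrightarrow> star (R i j) = R j i"
      "\<And>i j. i < n \<Longrightarrow> j < n \<Longrightarrow> (\<Sum>k<n. R i k * R k j) = N i j"
      using matrix_sqrt_exists[of D n N, OF subalgebra one_in N(1) sN pos] by blast
    have "\<iota> (N i j) = (\<Sum>k<n. star (\<iota> (R k i)) * \<iota> (R k j))" if "i < n" "j < n" for i j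
    proof -
      have "\<iota> (N i j) = (\<Sum>k<n. \<iota> (R i k) * \<iota> (R k j))"
        unfolding R(3)[OF that, symmetric]
        using that R(1) by (subst \<iota>.hom_sum) (simp_all add: \<iota>.hom_mult closure_rules(3))
      also have "\<dots> = (\<Sum>k<n. star (\<iota> (R k i)) * \<iota> (R k j))"
        using that R(1,2) by (intro sum.cong refl) (simp add: \<iota>.hom_star[symmetric])
      finally show ?thesis .
    qed
    then show "mat_pos univ_cstar n (\<lambda>i j. \<iota> (p (M i j)))"
      unfolding mat_pos_univ_cstar by (intro exI[of _ "\<lambda>i j. \<iota> (R i j)"]) (simp add: N_def)
  qed
  moreover have "star x \<in> S" if "x \<in> S" for x using adj[OF that] SI by blast
  ultimately obtain \<psi> where \<psi>: "ucp univ_cstar UNIV univ_cstar UNIV \<psi>" "\<forall>x\<in>S. \<psi> x = \<iota> (p x)"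
    using injective_cstar_extend[OF inj sub SI[OF one_in one]] by blast
  show ?thesis
  proof (intro exI[of _ \<psi>] conjI ballI)
    show "ucp univ_cstar UNIV univ_cstar UNIV \<psi>" by (rule \<psi>(1))
    have r: "d \<in> D \<Longrightarrow> \<rho> d - \<rho> d \<in> K" for d by (simp add: ideal_0)
    show "\<psi> (\<rho> d) = \<iota> d" if "d \<in> D" for d
      using \<psi>(2) SI[OF that r[OF that]] p_eq[OF that r[OF that]] by simp
    have k: "k - \<rho> 0 \<in> K" if "k \<in> K" for k using that by (simp add: hom_zero)
    show "\<psi> k = 0" if "k \<in> K" for k
      using \<psi>(2) SI[OF closure_rules(1) k[OF that]] p_eq[OF closure_rules(1) k[OF that]]
      by (simp add: \<iota>.hom_zero)
  qed
qed

end

section \<open>Completely positive maps\<close>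

text \<open>Plays the role of a Stinespring dilation: \<open>E\<close> of a Gram matrix is again a
  Gram matrix, of vectors over the target algebra.\<close>

lemma ucp_gram:
  assumes "ucp univ_cstar UNIV univ_cstar UNIV E"
  shows "\<exists>B. \<forall>i<n. \<forall>j<n. E (star (x i) * x j) = vinner n (B i) (B j)"
proof -
  have "mat_pos univ_cstar n (\<lambda>i j. star (x i) * x j)"
    unfolding mat_pos_univ_cstar
  \<comment> \<open>A square matrix with \<open>x\<close> as its row 0 and zeros elsewhere.\<close>
  proof (intro exI[of _ "\<lambda>k j. if k = 0 then x j else 0"] allI impI)
    fix i j assume "i < n" "j < n"
    then have "(\<Sum>k<n. star (if k = 0 then x i else 0) * (if k = 0 then x j else 0)) =
        (\<Sum>k<n. if k = 0 then star (x i) * x j else 0)"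
      by (intro sum.cong) auto
    then show "star (x i) * x j =
        (\<Sum>k<n. star (if k = 0 then x i else 0) * (if k = 0 then x j else 0))"
      using \<open>i < n\<close> by simp
  qed
  then have "mat_pos univ_cstar n (\<lambda>i j. E (star (x i) * x j))"
    by (intro ucp_univ_cstarD(4)[OF assms]) simp_all
  then obtain B where "\<forall>i<n. \<forall>j<n. E (star (x i) * x j) = (\<Sum>k<n. star (B k i) * B k j)"
    unfolding mat_pos_univ_cstar by blast
  then show ?thesis by (intro exI[of _ "\<lambda>i k. B k i"]) (simp add: vinner_def)
qed

lemma vinner_diff_left: "vinner n (\<lambda>i. y i - z i) x = vinner n y x - vinner n z x"
  by (simp add: vinner_def left_diff_distrib star_diff sum_subtractf)

lemma vinner_mult_right: "vinner n x (\<lambda>i. y i * a) = vinner n x y * a"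
  by (simp add: vinner_def sum_distrib_right mult.assoc)

lemma vinner_mult_left: "vinner n (\<lambda>i. x i * a) y = star a * vinner n x y"
  by (simp add: vinner_def sum_distrib_left star_mult mult.assoc)

locale ucp_map =
  fixes E :: "'a :: cstar_algebra \<Rightarrow> 'i :: cstar_algebra"
  assumes ucp: "ucp univ_cstar UNIV univ_cstar UNIV E"
begin

lemma map_add: "E (x + y) = E x + E y" and map_scaleC: "E (a *\<^sub>C x) = a *\<^sub>C E x"
  and map_one: "E 1 = 1"
  using ucp_univ_cstarD(1-3)[OF ucp] by simp_all

lemma map_scaleR: "E (r *\<^sub>R x) = r *\<^sub>R E x"
  by (simp add: scaleR_scaleC map_scaleC)

lemma map_minus: "E (- x) = - E x"
  using map_scaleR[of "- 1" x] by simp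

lemma map_diff: "E (x - y) = E x - E y"
  using map_add[of x "- y"] by (simp add: map_minus)

lemma map_zero: "E 0 = 0"
  using map_diff[of 0 0] by simp

lemma gram2:
  obtains n b\<^sub>0 b\<^sub>1 where "vinner n b\<^sub>0 b\<^sub>0 = 1" "vinner n b\<^sub>0 b\<^sub>1 = E x" "vinner n b\<^sub>1 b\<^sub>0 = E (star x)"
    "vinner n b\<^sub>1 b\<^sub>1 = E (star x * x)"
proof -
  obtain B where B: "\<forall>i<2. \<forall>j<2. E (star ([1, x] ! i) * [1, x] ! j) = vinner 2 (B i) (B j)"
    using ucp_gram[OF ucp, of 2 "\<lambda>i. [1, x] ! i"] by blast
  show thesis
    using B[rule_format, of 0 0] B[rule_format, of 0 1] B[rule_format, of 1 0] B[rule_format, of 1 1]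
    by (intro that[of 2 "B 0" "B 1"]) (simp_all add: map_one)
qed

lemma map_star: "E (star x) = star (E x)"
  by (rule gram2[of x]) (metis star_vinner)

text \<open>The difference is the inner square of \<open>b\<^sub>1\<close> minus its component
  \<open>b\<^sub>0 * E x\<close> along the unit vector \<open>b\<^sub>0\<close>.\<close>

lemma schwarz: "positive (E (star x * x) - star (E x) * E x)"
proof -
  obtain n b\<^sub>0 b\<^sub>1 where b: "vinner n b\<^sub>0 b\<^sub>0 = 1" "vinner n b\<^sub>0 b\<^sub>1 = E x" "vinner n b\<^sub>1 b\<^sub>0 = E (star x)"
    "vinner n b\<^sub>1 b\<^sub>1 = E (star x * x)"
    by (rule gram2)
  have "positive (vinner n (\<lambda>i. b\<^sub>1 i - b\<^sub>0 i * E x) (\<lambda>i. b\<^sub>1 i - b\<^sub>0 i * E x))"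
    by (rule positive_vinner_self)
  then show ?thesis
    by (simp add: vinner_diff_left vinner_diff_right vinner_mult_left vinner_mult_right b map_star)
qed

lemma map_positive: "positive a \<Longrightarrow> positive (E a)"
proof -
  assume "positive a"
  then obtain h where h: "a = star h * h" unfolding positive_def by metis
  have "positive ((E (star h * h) - star (E h) * E h) + star (E h) * E h)"
    by (intro positive_add schwarz positive_star_mult_self)
  then show ?thesis by (simp add: h)
qed

lemma norm_map_le: "norm (E x) \<le> norm x"
proof -
  let ?t = "(norm x)\<^sup>2"
  have "positive (?t *\<^sub>R 1 - star x * x)"
    by (rule positive_norm_minus) (simp_all add: star_mult star_star cstar_identity)
  then have "positive (E (?t *\<^sub>R 1 - star x * x) + (E (star x * x) - star (E x) * E x))"
    by (intro positive_add schwarz map_positive)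
  then have "positive (?t *\<^sub>R 1 - star (E x) * E x)"
    by (simp add: map_diff map_scaleR map_one)
  then have "norm (star (E x) * E x) \<le> \<bar>?t\<bar>"
    by (rule norm_le_if_positive_minus[OF positive_star_mult_self])
  then show ?thesis by (simp add: cstar_identity abs_le_square_iff[symmetric])
qed

lemma bounded_linear_map: "bounded_linear E"
  using norm_map_le by (intro bounded_linear_intro[of _ 1]) (simp_all add: map_add map_scaleR)

text \<open>The multiplicative domain argument. For Gram vectors of \<open>1\<close>,
  \<open>star d\<close> and \<open>x\<close>, the hypothesis says that the second vector minus the
  first times \<open>star (E d)\<close> has length 0; pairing the resulting equality with the third
  vector gives the claim.\<close>

lemma map_mult_left:
  assumes "E (d * star d) = E d * star (E d)"
  shows "E (d * x) = E d * E x"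
proof -
  obtain B where B: "\<forall>i<3. \<forall>j<3. E (star ([1, star d, x] ! i) * [1, star d, x] ! j) = vinner 3 (B i) (B j)"
    using ucp_gram[OF ucp, of 3 "\<lambda>i. [1, star d, x] ! i"] by blast
  have v00: "vinner 3 (B 0) (B 0) = 1"
    using B[rule_format, of 0 0] by (simp add: map_one)
  have v01: "vinner 3 (B 0) (B 1) = star (E d)"
    using B[rule_format, of 0 1] by (simp add: map_star)
  have v10: "vinner 3 (B 1) (B 0) = E d"
    using B[rule_format, of 1 0] by (simp add: star_star)
  have v11: "vinner 3 (B 1) (B 1) = E d * star (E d)"
    using B[rule_format, of 1 1] assms by (simp add: star_star)
  have v02: "vinner 3 (B 0) (B 2) = E x"
    using B[rule_format, of 0 2] by (simp add: numeral_2_eq_2)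
  have v12: "vinner 3 (B 1) (B 2) = E (d * x)"
    using B[rule_format, of 1 2] by (simp add: numeral_2_eq_2 star_star)
  let ?c = "\<lambda>i. B 1 i - B 0 i * star (E d)"
  have "vinner 3 ?c ?c = 0"
    by (simp add: vinner_diff_left vinner_diff_right vinner_mult_left vinner_mult_right v00 v01 v10 v11
        star_star del: One_nat_def)
  then have "?c i = 0" if "i < 3" for i
    unfolding vinner_def
    by (rule sum_star_mult_self_eq_0[of "{..<3}" ?c i, rotated]) (use that in simp_all)
  then have "vinner 3 (B 1) (B 2) = vinner 3 (\<lambda>i. B 0 i * star (E d)) (B 2)"
    by (intro vinner_cong) simp_all
  then show ?thesis by (simp add: vinner_mult_left v02 v12 star_star del: One_nat_def)
qed

end

section \<open>Regular MASA inclusions\<close>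

lemma normal_square_eq_0:
  assumes "x * star x = star x * x" "x * x = (0 :: 'a :: cstar_algebra)"
  shows "x = 0"
proof -
  have "star (star x * x) * (star x * x) = star x * (x * star x) * x"
    by (simp add: star_mult star_star mult.assoc)
  also have "\<dots> = star x * star x * (x * x)" unfolding assms(1) by (simp add: mult.assoc)
  finally have "star (star x * x) * (star x * x) = 0" using assms(2) by (simp only: mult_zero_right)
  then have "star x * x = 0" by (simp only: star_mult_self_eq_0_iff)
  then show ?thesis by simp
qed

text \<open>\<open>P\<close> is the commutant of \<open>D\<close> together with \<open>h\<close>,
  and \<open>B\<close> is the commutant of \<open>P\<close>. As \<open>D\<close> and
  \<open>h\<close> commute with one another they lie in \<open>P\<close>, so \<open>B\<close> is
  contained in \<open>P\<close> and therefore abelian; maximality gives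
  \<open>B = D\<close>.\<close>

lemma masa_hermitian_commutant:
  assumes D: "masa_inclusion (D :: 'a :: cstar_algebra set)" and h: "star h = h" "\<And>d. d \<in> D \<Longrightarrow> h * d = d * h"
  shows "h \<in> D"
proof -
  have ab: "abelian_cstar_subalgebra D" using D unfolding masa_inclusion_def inclusion_def by blast
  then have sD: "star d \<in> D" if "d \<in> D" for d
    using that by (simp add: abelian_cstar_subalgebra_def cstar_subalgebra_def)
  have cD: "d * e = e * d" if "d \<in> D" "e \<in> D" for d e
    using ab that by (simp add: abelian_cstar_subalgebra_def)
  define P where "P = {y. y * h = h * y \<and> (\<forall>d\<in>D. y * d = d * y)}"
  define B where "B = {z. \<forall>y\<in>P. z * y = y * z}"
  have star_eq: "star x * y = y * star x" if "x * star y = star y * x" for x y :: 'a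
    using arg_cong[OF that, of star] by (simp add: star_mult star_star)
  have sP: "star y \<in> P" if "y \<in> P" for y
  proof -
    have "star y * h = h * star y" using star_eq[of y h] that h(1) by (simp add: P_def)
    moreover have "star y * d = d * star y" if "d \<in> D" for d
      using star_eq[of y d] \<open>y \<in> P\<close> sD[OF that] by (simp add: P_def)
    ultimately show ?thesis by (simp add: P_def)
  qed
  have DB: "D \<subseteq> B" and hB: "h \<in> B" by (auto simp: P_def B_def)
  have "D \<subseteq> P" "h \<in> P" by (auto simp: P_def h(2) intro: cD)
  then have BP: "B \<subseteq> P" by (auto simp: P_def B_def)
  have "abelian_cstar_subalgebra B"
    unfolding abelian_cstar_subalgebra_def cstar_subalgebra_def
  proof (intro conjI ballI)
    show "csubspace B"
      by (rule complex_vector.subspaceI)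
        (auto simp: B_def distrib_left distrib_right mult_scaleC_left mult_scaleC_right)
    have "B = (\<Inter>y\<in>P. {z. z * y = y * z})" by (auto simp: B_def)
    then show "closed B" by (simp add: closed_INT closed_Collect_eq continuous_intros)
    show "x * y \<in> B" if "x \<in> B" "y \<in> B" for x y
    proof -
      have "x * y * z = z * (x * y)" if "z \<in> P" for z
      proof -
        have "x * y * z = x * z * y" using \<open>y \<in> B\<close> that by (simp add: B_def mult.assoc)
        also have "x * z = z * x" using \<open>x \<in> B\<close> that by (simp add: B_def)
        finally show ?thesis by (simp add: mult.assoc)
      qed
      then show ?thesis by (simp add: B_def)
    qed
    show "star x \<in> B" if "x \<in> B" for x
      using that star_eq[of x] sP by (simp add: B_def)
    show "x * y = y * x" if "x \<in> B" "y \<in> B" for x y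
      using that BP unfolding B_def by blast
  qed
  then have "B = D" using D DB unfolding masa_inclusion_def by blast
  then show ?thesis using hB by simp
qed

lemma masa_commutant:
  assumes D: "masa_inclusion (D :: 'a :: cstar_algebra set)" and x: "\<And>d. d \<in> D \<Longrightarrow> x * d = d * x"
  shows "x \<in> D"
proof -
  have sub: "cstar_subalgebra D"
    using D unfolding masa_inclusion_def inclusion_def abelian_cstar_subalgebra_def by blast
  have sx: "star x * d = d * star x" if "d \<in> D" for d
    using arg_cong[OF x[of "star d"], of star] that cstar_subalgebraD(8)[OF sub]
    by (simp add: star_mult star_star)
  define h where "h = (1 / 2) *\<^sub>R (x + star x)"
  define k where "k = (\<i> / 2) *\<^sub>C (star x - x)"
  have sh: "star h = h" by (simp add: h_def star_scaleR star_add star_star add.commute)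
  have "star k = (- (\<i> / 2)) *\<^sub>C (x - star x)"
    by (simp add: k_def star_scaleC star_diff star_star)
  then have sk: "star k = k"
    by (simp add: k_def complex_vector.scale_minus_left complex_vector.scale_right_diff_distrib)
  have "h \<in> D"
    by (rule masa_hermitian_commutant[OF D sh]) (simp add: h_def x sx algebra_simps)
  moreover have "k \<in> D"
    by (rule masa_hermitian_commutant[OF D sk])
      (simp add: k_def x sx algebra_simps mult_scaleC_left mult_scaleC_right)
  moreover have "x = h + \<i> *\<^sub>C k"
  proof -
    have "\<i> *\<^sub>C k = (- (1 / 2)) *\<^sub>R (star x - x)"
      by (simp add: k_def scaleC_scaleC scaleR_scaleC)
    then have "h + \<i> *\<^sub>C k = (1 / 2) *\<^sub>R (x + x)"
      by (simp add: h_def algebra_simps)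
    then show ?thesis by (simp add: scaleR_2[symmetric])
  qed
  ultimately show ?thesis using cstar_subalgebraD(2)[OF sub] cstar_subalgebraD(4)[OF sub] by simp
qed

text \<open>The ideal of \<open>D\<close> generated by \<open>J\<close> is essential: on the
  character space of \<open>D\<close>, the points where some member of \<open>J\<close> does not
  vanish are dense.\<close>

definition essential_subset :: "'a :: cstar_algebra set \<Rightarrow> 'a set \<Rightarrow> bool" where
  "essential_subset D J \<longleftrightarrow> J \<subseteq> D \<and> (\<forall>g\<in>D. (\<forall>j\<in>J. g * j = 0) \<longrightarrow> g = 0)"

lemma essential_subset_mono:
  "essential_subset D I \<Longrightarrow> I \<subseteq> J \<Longrightarrow> J \<subseteq> D \<Longrightarrow> essential_subset D J"
  unfolding essential_subset_def by blast

text \<open>For a normalizer \<open>w\<close> this is, on the character space of \<open>D\<close>,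
  \<open>star w * w\<close> times the difference between \<open>f\<close> moved by the partial
  homeomorphism of \<open>w\<close> and \<open>f\<close>. It vanishes at fixed points.\<close>

definition nonfixed :: "'a :: cstar_algebra \<Rightarrow> 'a \<Rightarrow> 'a" where
  "nonfixed w f = star w * f * w - f * (star w * w)"

locale regular_masa =
  fixes D :: "'c :: cstar_algebra set"
  assumes reg: "regular_masa_inclusion D"
begin

lemma masa: "masa_inclusion D"
  and dense: "closure (cspan (normalizers D)) = UNIV"
  and sub: "cstar_subalgebra D"
  and one_mem: "1 \<in> D"
  and comm: "x \<in> D \<Longrightarrow> y \<in> D \<Longrightarrow> x * y = y * x"
  using reg
  unfolding regular_masa_inclusion_def regular_inclusion_def inclusion_def abelian_cstar_subalgebra_def
  by blast+

lemmas D_rules = cstar_subalgebraD[OF sub] one_mem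

lemma normal: "x \<in> D \<Longrightarrow> x * star x = star x * x"
  using D_rules(8) by (intro comm)

lemma square_eq_0: "x \<in> D \<Longrightarrow> x * x = 0 \<Longrightarrow> x = 0"
  by (rule normal_square_eq_0[OF normal])

lemma normalizer_conj: "v \<in> normalizers D \<Longrightarrow> d \<in> D \<Longrightarrow> star v * d * v \<in> D"
  and normalizer_conj': "v \<in> normalizers D \<Longrightarrow> d \<in> D \<Longrightarrow> v * d * star v \<in> D"
  by (auto simp: normalizers_def)

lemma normalizer_modulus: "v \<in> normalizers D \<Longrightarrow> star v * v \<in> D"
  and normalizer_modulus': "v \<in> normalizers D \<Longrightarrow> v * star v \<in> D"
  using normalizer_conj[OF _ one_mem] normalizer_conj'[OF _ one_mem] by simp_all

text \<open>\<open>v * star v\<close> lies in \<open>D\<close> and so commutes with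
  \<open>d\<close>. This moves \<open>d\<close> across \<open>v\<close> at the price of a factor
  \<open>star v * v\<close>.\<close>

lemma normalizer_swap:
  assumes "v \<in> normalizers D" "d \<in> D"
  shows "v * (star v * d * v) = d * v * (star v * v)"
    and "(star v * d * v) * star v = (star v * v) * star v * d"
  using comm[OF normalizer_modulus'[OF assms(1)] assms(2)]
  by (simp_all add: mult.assoc[symmetric]) (simp_all add: mult.assoc)

lemma nonfixed_in: "w \<in> normalizers D \<Longrightarrow> f \<in> D \<Longrightarrow> nonfixed w f \<in> D"
  by (simp add: nonfixed_def D_rules normalizer_conj normalizer_modulus)

text \<open>A commutator with \<open>D\<close> appears on the right; a pseudo-expectation kills such
  commutators because \<open>I(D)\<close> is commutative.\<close>

lemma normalizer_mult_nonfixed: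
  assumes "w \<in> normalizers D" "f \<in> D"
  shows "w * nonfixed w f = (f * w - w * f) * (star w * w)"
  using normalizer_swap(1)[OF assms] by (simp add: nonfixed_def right_diff_distrib left_diff_distrib mult.assoc)

text \<open>Where all \<open>nonfixed w f\<close> vanish, the partial homeomorphism induced by \<open>w\<close> is the identity and
  \<open>w\<close> commutes with \<open>D\<close>.\<close>

lemma normalizer_mult_in:
  assumes w: "w \<in> normalizers D" and g: "g \<in> D" and z: "\<And>f. f \<in> D \<Longrightarrow> g * nonfixed w f = 0"
  shows "w * g \<in> D"
proof (rule masa_commutant[OF masa])
  fix f assume f: "f \<in> D"
  let ?p = "star w * w"
  have sf: "star f \<in> D" and p: "?p \<in> D" using f w by (simp_all add: D_rules normalizer_modulus)
  have A: "star w * k * w * g = k * ?p * g" if "k \<in> D" for k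
  proof -
    have "g * (star w * k * w) = g * (k * ?p)"
      using z[OF that] by (simp add: nonfixed_def right_diff_distrib)
    then show ?thesis
      using comm[OF g normalizer_conj[OF w that]] comm[OF g, of "k * ?p"] that p by (simp add: D_rules)
  qed
  \<comment> \<open>The commutator of \<open>f\<close> and \<open>w\<close>, cut down by
    \<open>g\<close>. Up to sign, the four terms in \<open>star y * y\<close> coincide by
    \<open>A\<close>, and the signs cancel.\<close>
  define y where "y = f * w * g - w * f * g"
  have pf: "?p * f = f * ?p" and gf: "g * f = f * g" using comm f p g by blast+
  have 1: "star w * (star f * f) * w * g = star f * f * ?p * g" using A f sf by (simp add: D_rules)
  have 2: "star w * star f * w * f * g = star f * f * ?p * g"
  proof -
    have "star w * star f * w * f * g = (star w * star f * w * g) * f" using gf by (simp add: mult.assoc)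
    also have "\<dots> = star f * (?p * f) * g" unfolding A[OF sf] using gf by (simp add: mult.assoc)
    finally show ?thesis unfolding pf by (simp add: mult.assoc)
  qed
  have 3: "star f * (star w * f * w * g) = star f * f * ?p * g" unfolding A[OF f] by (simp add: mult.assoc)
  have 4: "star f * (?p * f) * g = star f * f * ?p * g" unfolding pf by (simp add: mult.assoc)
  have "star y * y = star g * (star w * (star f * f) * w * g - star w * star f * w * f * g
      - star f * (star w * f * w * g) + star f * (?p * f) * g)"
    by (simp add: y_def star_diff star_mult algebra_simps)
  also have "\<dots> = 0" unfolding 1 2 3 4 by simp
  finally have "y = 0" by simp
  then show "w * g * f = f * (w * g)" using gf by (simp add: y_def mult.assoc)
qed

lemma essential_normalizer:
  assumes w: "w \<in> normalizers D"
  shows "essential_subset D ({d \<in> D. w * d \<in> D} \<union> nonfixed w ` D)"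
  unfolding essential_subset_def
proof (intro conjI ballI impI)
  show "{d \<in> D. w * d \<in> D} \<union> nonfixed w ` D \<subseteq> D" using nonfixed_in[OF w] by blast
  fix g assume g: "g \<in> D" and z: "\<forall>j\<in>{d \<in> D. w * d \<in> D} \<union> nonfixed w ` D. g * j = 0"
  then have "w * g \<in> D" by (intro normalizer_mult_in[OF w]) auto
  \<comment> \<open>\<open>g\<close> itself now belongs to the first set, so it annihilates
    itself.\<close>
  then have "g * g = 0" using g z by blast
  then show "g = 0" by (rule square_eq_0[OF g])
qed

end

section \<open>Annihilators and positivity in the injective envelope\<close>

locale masa_envelope = regular_masa D
  for D :: "'c :: cstar_algebra set" +
  fixes \<iota> :: "'c \<Rightarrow> 'i :: cstar_algebra"
  assumes envelope: "injective_envelope TYPE(('c, 'i) test_universe) D \<iota>"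
begin

lemma i_comm: "a * b = b * (a :: 'i)"
  and injective: "injective_cstar TYPE(('c, 'i) test_universe) TYPE('i)"
  and iota_hom: "unital_star_hom_on D \<iota>" and inj_iota: "inj_on \<iota> D" and rigid: "rigid_extension D \<iota>"
  using envelope unfolding injective_envelope_def by blast+

lemma i_left_comm: "a * (b * c) = b * (a * (c :: 'i))"
  by (metis i_comm mult.assoc)

lemmas i_ac = mult.assoc i_comm i_left_comm

sublocale iota: star_hom D \<iota>
  by (rule star_hom.intro[OF sub one_mem iota_hom])

lemma iota_eq_0: "d \<in> D \<Longrightarrow> \<iota> d = 0 \<Longrightarrow> d = 0"
  using inj_iota iota.hom_zero D_rules(1) by (metis inj_onD)

lemma i_square_cancel:
  assumes "b * star a * a = (0 :: 'i)"
  shows "b * a = 0"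
proof -
  have "star (b * a) * (b * a) = star b * (b * star a * a)" by (simp add: star_mult i_ac)
  then have "star (b * a) * (b * a) = 0" using assms by (simp only: mult_zero_right)
  then show ?thesis by (simp only: star_mult_self_eq_0_iff)
qed

text \<open>The annihilator \<open>K\<close> of \<open>\<iota> J\<close> meets \<open>\<iota> D\<close> trivially, so \<open>\<iota> d + k \<mapsto> \<iota> d\<close> extends to a
  completely positive map on \<open>I(D)\<close>. By rigidity this is the identity, but it vanishes on \<open>K\<close>.\<close>

lemma essential_annihilator:
  assumes J: "essential_subset D J" and a: "\<And>j. j \<in> J \<Longrightarrow> a * \<iota> j = 0"
  shows "a = 0"
proof -
  define K where "K = {a. \<forall>j\<in>J. a * \<iota> j = 0}"
  have K: "star_hom_mod_ideal D \<iota> K"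
  proof
    show "cstar_ideal K"
      unfolding cstar_ideal_def
    proof (intro conjI allI ballI)
      show "csubspace K"
        by (rule complex_vector.subspaceI) (auto simp: K_def distrib_right mult_scaleC_left)
      have "K = (\<Inter>j\<in>J. {a. a * \<iota> j = 0})" by (auto simp: K_def)
      then show "closed K" by (simp add: closed_INT closed_Collect_eq continuous_intros)
      show "x * y \<in> K" if "y \<in> K" for x y using that by (simp add: K_def mult.assoc)
      then show "y * x \<in> K" if "y \<in> K" for x y using that by (simp add: i_comm[of y x])
    qed
    show "star x \<in> K" if "x \<in> K" for x
    proof -
      have "star x * \<iota> j = 0" if "j \<in> J" for j
      proof -
        have "x * \<iota> j = 0" using \<open>x \<in> K\<close> that by (simp add: K_def)
        moreover have "\<iota> j * star (star x) * star x = star x * (x * \<iota> j)" by (simp add: star_star i_ac)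
        ultimately have "\<iota> j * star x = 0" using i_square_cancel[of "\<iota> j" "star x"] by simp
        then show ?thesis by (simp only: i_comm)
      qed
      then show ?thesis by (simp add: K_def)
    qed
    show "d = 0" if "d \<in> D" "\<iota> d \<in> K" for d
    proof -
      have "d * j = 0" if "j \<in> J" for j
      proof -
        have j: "j \<in> D" using that J by (auto simp: essential_subset_def)
        then have "\<iota> (d * j) = 0" using \<open>\<iota> d \<in> K\<close> \<open>d \<in> D\<close> that by (simp add: K_def iota.hom_mult)
        then show ?thesis using j \<open>d \<in> D\<close> by (intro iota_eq_0) (simp_all add: D_rules)
      qed
      then show ?thesis using J \<open>d \<in> D\<close> by (simp add: essential_subset_def)
    qed
  qed
  \<comment> \<open>\<open>I(D)\<close> embeds into the test universe as evaluations at
    \<open>Inr x\<close>; indicator functions separate these.\<close>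
  have "inj (\<lambda>(x :: 'i) (g :: 'c + 'i \<Rightarrow> complex). g (Inr x))"
  proof (rule injI)
    fix x y :: 'i assume "(\<lambda>g :: 'c + 'i \<Rightarrow> complex. g (Inr x)) = (\<lambda>g. g (Inr y))"
    from fun_cong[OF this, of "\<lambda>z. if z = Inr x then 1 else 0"] show "x = y" by (simp split: if_splits)
  qed
  then obtain \<psi> where \<psi>: "ucp univ_cstar UNIV univ_cstar UNIV \<psi>" "\<forall>d\<in>D. \<psi> (\<iota> d) = \<iota> d" "\<forall>k\<in>K. \<psi> k = 0"
    using star_hom_mod_ideal.ucp_extension_mod_ideal[OF K iota_hom injective] by blast
  then have "\<psi> = id" using rigid unfolding rigid_extension_def by blast
  moreover have "a \<in> K" using a by (simp add: K_def)
  ultimately show ?thesis using \<psi>(3) by simp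
qed

text \<open>Let \<open>q\<close> be twice the negative part of \<open>x\<close> and \<open>c\<close>
  its cube, so that \<open>q^2 x = - c / 2\<close>. Multiplied by
  \<open>star (\<iota> j) * \<iota> j\<close>, both \<open>c\<close> and \<open>- c\<close> become
  positive, so \<iota> j annihilates \<open>c\<close> for every \<open>j\<close>.\<close>

lemma essential_positive:
  assumes J: "essential_subset D J" and x: "star x = x"
    and pos: "\<And>j. j \<in> J \<Longrightarrow> positive (x * (star (\<iota> j) * \<iota> j))"
  shows "positive x"
proof -
  obtain m where m: "positive m" "m * m = x * x"
    by (rule hermitian_abs_exists[OF x]) blast
  note neg = negative_part_cube[OF x m i_comm]
  define q where "q = m - x"
  define c where "c = q * q * q"
  have sq: "star q = q" using m x by (simp add: q_def star_diff positive_hermitian)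
  have c: "positive c" using neg(1) by (simp add: c_def q_def)
  have xqq: "(q * q) * x = - (1 / 2) *\<^sub>R c"
  proof -
    have "(q * q) * x = q * (x * q)" by (simp add: i_ac)
    also have "x * q = - (1 / 2) *\<^sub>R (q * q)" using neg(2) by (simp add: q_def)
    finally show ?thesis by (simp add: c_def mult.assoc)
  qed
  have "c * \<iota> j = 0" if "j \<in> J" for j
  proof -
    let ?z = "star (\<iota> j) * \<iota> j"
    have "positive ((q * q) * (x * ?z))"
      by (rule positive_mult[OF positive_square[OF sq] pos[OF that] i_comm])
    moreover have "(q * q) * (x * ?z) = - (1 / 2) *\<^sub>R (c * ?z)"
      using xqq by (simp add: mult.assoc[symmetric])
    ultimately have "positive (2 *\<^sub>R (- (1 / 2) *\<^sub>R (c * ?z)))"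
      by (intro positive_scaleR[of 2]) simp_all
    then have "positive (- (c * ?z))" by simp
    moreover have "positive (c * ?z)"
      by (rule positive_mult[OF c positive_star_mult_self i_comm])
    ultimately have "c * ?z = 0" by (intro positive_antisym)
    then have "c * star (\<iota> j) * \<iota> j = 0" by (simp add: mult.assoc)
    then show ?thesis by (rule i_square_cancel)
  qed
  then have "c = 0" by (rule essential_annihilator[OF J])
  then have "q = 0" using hermitian_cube_eq_0[OF sq] by (simp add: c_def)
  then show ?thesis using neg(3) by (simp add: q_def)
qed

lemma iota_reflects_positive:
  assumes "d \<in> D" "positive (\<iota> d)"
  shows "positive d"
proof -
  have "star_hom_mod_ideal D \<iota> {0}"
  proof
    show "cstar_ideal {0 :: 'i}"
      by (simp add: cstar_ideal_def complex_vector.subspace_0 complex_vector.subspace_single_0)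
    show "d = 0" if "d \<in> D" "\<iota> d \<in> {0}" for d using that iota_eq_0 by simp
  qed simp
  then show ?thesis
    using star_hom_mod_ideal.positive_mod_ideal[of D \<iota> "{0}" d 0] assms by simp
qed

end

section \<open>Pseudo-expectations and their uniqueness\<close>

locale pseudo_exp = masa_envelope D \<iota>
  for D :: "'c :: cstar_algebra set" and \<iota> :: "'c \<Rightarrow> 'i :: cstar_algebra" +
  fixes E :: "'c \<Rightarrow> 'i"
  assumes pseudo: "pseudo_expectation D \<iota> E"
begin

sublocale ucp_map E
  using pseudo by (unfold_locales) (simp add: pseudo_expectation_def)

lemma E_iota: "d \<in> D \<Longrightarrow> E d = \<iota> d"
  using pseudo by (simp add: pseudo_expectation_def)

lemma E_left: "d \<in> D \<Longrightarrow> E (d * x) = \<iota> d * E x"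
  using map_mult_left[of d x]
  by (simp add: E_iota D_rules iota.hom_mult iota.hom_star)

lemma E_right: "d \<in> D \<Longrightarrow> E (x * d) = E x * \<iota> d"
proof -
  assume d: "d \<in> D"
  have "star (E (x * d)) = E (star d * star x)" by (simp add: map_star[symmetric] star_mult)
  also have "\<dots> = star (\<iota> d) * star (E x)" using d by (simp add: E_left D_rules iota.hom_star map_star)
  also have "\<dots> = star (E x * \<iota> d)" by (simp add: star_mult)
  finally show ?thesis by (metis star_star)
qed

lemma E_mult_nonfixed:
  assumes "w \<in> normalizers D" "f \<in> D"
  shows "E (w * nonfixed w f) = 0"
proof -
  have "E (w * nonfixed w f) = E (f * w - w * f) * \<iota> (star w * w)"
    unfolding normalizer_mult_nonfixed[OF assms] by (rule E_right[OF normalizer_modulus[OF assms(1)]])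
  also have "E (f * w - w * f) = 0"
    using assms(2) by (simp add: map_diff E_left E_right i_comm)
  finally show ?thesis by simp
qed

end

lemma pseudo_exp_unique:
  assumes "pseudo_exp D \<iota> E" "pseudo_exp D \<iota> F"
  shows "E = F"
proof -
  interpret E: pseudo_exp D \<iota> E by fact
  interpret F: pseudo_exp D \<iota> F by fact
  have N: "E w = F w" if w: "w \<in> normalizers D" for w
  proof -
    have "E w - F w = 0"
    proof (rule E.essential_annihilator[OF E.essential_normalizer[OF w]])
      fix j assume j: "j \<in> {d \<in> D. w * d \<in> D} \<union> nonfixed w ` D"
      then have jD: "j \<in> D" using E.nonfixed_in[OF w] by blast
      have "E (w * j) = F (w * j)"
        using j w by (auto simp: E.E_iota F.E_iota E.E_mult_nonfixed F.E_mult_nonfixed)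
      then show "(E w - F w) * \<iota> j = 0"
        using E.E_right[OF jD, of w] F.E_right[OF jD, of w] by (simp add: left_diff_distrib)
    qed
    then show ?thesis by simp
  qed
  have "csubspace {x. E x = F x}"
    by (rule complex_vector.subspaceI)
      (simp_all add: E.map_zero F.map_zero E.map_add F.map_add E.map_scaleC F.map_scaleC)
  then have "cspan (normalizers D) \<subseteq> {x. E x = F x}"
    using N by (intro complex_vector.span_minimal) auto
  moreover have "closed {x. E x = F x}"
    by (intro closed_Collect_eq linear_continuous_on E.bounded_linear_map F.bounded_linear_map)
  ultimately have "closure (cspan (normalizers D)) \<subseteq> {x. E x = F x}" by (rule closure_minimal)
  then show ?thesis using E.dense by auto
qed

section \<open>Conjugation by a normalizer\<close>

context pseudo_exp
begin

text \<open>The \<open>d\<close> that bring \<open>E (x * d)\<close> into the image of \<iota>,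
  where conjugation by \<open>v\<close> makes sense, and for which \<open>E\<close> respects this
  conjugation. The factor \<open>star v * v\<close> is the one that arises when elements of
  \<open>D\<close> are moved across \<open>v\<close>.\<close>

definition compressors :: "'c \<Rightarrow> 'c \<Rightarrow> 'c set" where
  "compressors v x = {d \<in> D. \<exists>e\<in>D. E (x * d) = \<iota> e \<and>
     E (star v * (x * d) * v) * \<iota> (star v * v) = \<iota> (star v * e * v) * \<iota> (star v * v)}"

lemma i_mult_cancel_aux: "a * b = c * d \<Longrightarrow> c * b = e * b \<Longrightarrow> a * b * b = e * b * (d :: 'i)"
  by (metis i_comm mult.assoc)

context
  fixes v
  assumes v: "v \<in> normalizers D"
begin

abbreviation (input) "\<alpha> d \<equiv> star v * d * v"
abbreviation (input) "p \<equiv> star v * v"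

lemma p_in: "p \<in> D" and \<alpha>_in: "d \<in> D \<Longrightarrow> \<alpha> d \<in> D"
  using normalizer_modulus normalizer_conj v by blast+

lemma star_iota_p: "star (\<iota> p) = \<iota> p"
  using iota.hom_star[OF p_in] by (simp add: star_mult star_star)

text \<open>Reduces the powers of \<open>p\<close> that accumulate from
  \<open>normalizer_swap\<close> to a single factor.\<close>

lemma cancel_p: "b * \<iota> p * \<iota> p = 0 \<Longrightarrow> b * \<iota> p = 0"
  using i_square_cancel[of b "\<iota> p"] by (simp add: star_iota_p)

lemma E_conj_right:
  assumes "d \<in> D"
  shows "E (star v * (x * d) * v) * \<iota> p = E (star v * x * v) * \<iota> (\<alpha> d)"
proof -
  have "E (star v * (x * d) * v) * \<iota> p = E (star v * (x * d) * v * p)"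
    by (rule E_right[OF p_in, symmetric])
  also have "star v * (x * d) * v * p = star v * x * (d * v * p)" by (simp only: mult.assoc)
  also have "d * v * p = v * \<alpha> d" by (rule normalizer_swap(1)[OF v assms, symmetric])
  also have "star v * x * (v * \<alpha> d) = star v * x * v * \<alpha> d" by (simp only: mult.assoc)
  finally show ?thesis by (simp only: E_right[OF \<alpha>_in[OF assms]])
qed

lemma E_conj_left:
  assumes "d \<in> D"
  shows "\<iota> p * E (star v * (d * x) * v) = \<iota> (\<alpha> d) * E (star v * x * v)"
proof -
  have "\<iota> p * E (star v * (d * x) * v) = E (p * (star v * (d * x) * v))"
    by (rule E_left[OF p_in, symmetric])
  also have "p * (star v * (d * x) * v) = (p * star v * d) * (x * v)" by (simp only: mult.assoc)
  also have "p * star v * d = \<alpha> d * star v" by (rule normalizer_swap(2)[OF v assms, symmetric])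
  also have "\<alpha> d * star v * (x * v) = \<alpha> d * (star v * x * v)" by (simp only: mult.assoc)
  finally show ?thesis by (simp only: E_left[OF \<alpha>_in[OF assms]])
qed

lemma \<alpha>_mult:
  assumes "d \<in> D" "e \<in> D"
  shows "\<alpha> d * \<alpha> e = \<alpha> (d * e) * p"
  using normalizer_swap(1)[OF v assms(2)] by (simp add: mult.assoc)

lemma compressors_subset: "compressors v x \<subseteq> D"
  by (auto simp: compressors_def)

text \<open>This puts products of a compressor for \<open>x\<close> and one for \<open>y\<close>
  into both sets, as sums require.\<close>

lemma compressors_mult:
  assumes "d \<in> compressors v x" "g \<in> D"
  shows "d * g \<in> compressors v x"
proof -
  obtain e where d: "d \<in> D" and e: "e \<in> D" "E (x * d) = \<iota> e"
    and ve: "E (star v * (x * d) * v) * \<iota> p = \<iota> (\<alpha> e) * \<iota> p"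
    using assms(1) by (auto simp: compressors_def)
  have "E (x * (d * g)) = \<iota> (e * g)"
    using E_right[OF assms(2), of "x * d"] e assms(2) by (simp add: mult.assoc iota.hom_mult)
  moreover have "E (star v * (x * (d * g)) * v) * \<iota> p = \<iota> (\<alpha> (e * g)) * \<iota> p"
  proof -
    have "E (star v * (x * (d * g)) * v) * \<iota> p = E (star v * (x * d) * v) * \<iota> (\<alpha> g)"
      using E_conj_right[OF assms(2), of "x * d"] by (simp add: mult.assoc)
    then have "E (star v * (x * (d * g)) * v) * \<iota> p * \<iota> p = \<iota> (\<alpha> e) * \<iota> p * \<iota> (\<alpha> g)"
      by (rule i_mult_cancel_aux[OF _ ve])
    also have "\<dots> = \<iota> (\<alpha> e * \<alpha> g) * \<iota> p"
      unfolding iota.hom_mult[OF \<alpha>_in[OF e(1)] \<alpha>_in[OF assms(2)]] by (simp only: i_ac)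
    also have "\<dots> = \<iota> (\<alpha> (e * g)) * \<iota> p * \<iota> p"
      unfolding \<alpha>_mult[OF e(1) assms(2)] using e assms(2) by (simp add: iota.hom_mult \<alpha>_in p_in D_rules)
    finally have "(E (star v * (x * (d * g)) * v) - \<iota> (\<alpha> (e * g))) * \<iota> p * \<iota> p = 0"
      by (simp add: left_diff_distrib)
    from cancel_p[OF this] show ?thesis by (simp add: left_diff_distrib)
  qed
  ultimately show ?thesis using d e assms(2) by (auto simp: compressors_def D_rules)
qed

text \<open>If \<open>w * d\<close> lies in \<open>D\<close>, it serves as \<open>e\<close>. For
  \<open>d = nonfixed w f\<close> the witness is 0: the conjugated commutator is still killed by
  \<open>E\<close> once factors \<open>p\<close> are attached, because \<open>I(D)\<close> is
  commutative.\<close>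

lemma essential_compressors_normalizer:
  assumes w: "w \<in> normalizers D"
  shows "essential_subset D (compressors v w)"
proof (rule essential_subset_mono[OF essential_normalizer[OF w] _ compressors_subset])
  have "nonfixed w f \<in> compressors v w" if f: "f \<in> D" for f
  proof -
    let ?r = "star w * w"
    have r: "?r \<in> D" by (rule normalizer_modulus[OF w])
    let ?X = "E (star v * (f * w * ?r) * v)" and ?Y = "E (star v * (w * f * ?r) * v)"
    have "\<iota> p * (?X * \<iota> p) = \<iota> p * E (star v * (f * w) * v) * \<iota> (\<alpha> ?r)"
      by (simp only: E_conj_right[OF r] mult.assoc[of "\<iota> p"])
    then have X: "\<iota> p * (?X * \<iota> p) = \<iota> (\<alpha> f) * E (star v * w * v) * \<iota> (\<alpha> ?r)"
      by (simp only: E_conj_left[OF f])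
    have "?Y * \<iota> p = E (star v * w * v) * \<iota> (\<alpha> (f * ?r))"
      using E_conj_right[OF D_rules(3)[OF f r], of w] by (simp only: mult.assoc)
    then have "\<iota> p * (?Y * \<iota> p) = E (star v * w * v) * (\<iota> (\<alpha> (f * ?r)) * \<iota> p)"
      by (simp only: i_comm[of "\<iota> p"] mult.assoc)
    also have "\<iota> (\<alpha> (f * ?r)) * \<iota> p = \<iota> (\<alpha> f * \<alpha> ?r)"
      unfolding \<alpha>_mult[OF f r] by (rule iota.hom_mult[OF \<alpha>_in[OF D_rules(3)[OF f r]] p_in, symmetric])
    also have "\<dots> = \<iota> (\<alpha> f) * \<iota> (\<alpha> ?r)" by (rule iota.hom_mult[OF \<alpha>_in[OF f] \<alpha>_in[OF r]])
    finally have "\<iota> p * (?Y * \<iota> p) = \<iota> p * (?X * \<iota> p)" unfolding X by (simp only: i_ac)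
    then have "(?X - ?Y) * \<iota> p * \<iota> p = 0"
      by (simp only: left_diff_distrib i_comm[of _ "\<iota> p"] right_diff_distrib diff_self)
    moreover have "E (star v * (f * w * ?r - w * f * ?r) * v) = ?X - ?Y"
      by (simp only: right_diff_distrib left_diff_distrib map_diff)
    ultimately have "E (star v * (f * w * ?r - w * f * ?r) * v) * \<iota> p * \<iota> p = 0"
      by (simp only:)
    then have "E (star v * (w * nonfixed w f) * v) * \<iota> p = 0"
      unfolding normalizer_mult_nonfixed[OF w f] left_diff_distrib[of "f * w" "w * f"]
      by (rule cancel_p)
    then show ?thesis
      using E_mult_nonfixed[OF w f] nonfixed_in[OF w f] D_rules(1)
      by (auto simp: compressors_def iota.hom_zero intro!: bexI[of _ 0])
  qed
  moreover have "d \<in> compressors v w" if "d \<in> D" "w * d \<in> D" for d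
    using that by (auto simp: compressors_def E_iota \<alpha>_in intro!: bexI[of _ "w * d"])
  ultimately show "{d \<in> D. w * d \<in> D} \<union> nonfixed w ` D \<subseteq> compressors v w" by blast
qed

text \<open>For sums, an element annihilating all products \<open>c * d\<close> makes every
  \<open>g * c\<close> annihilate the compressors of one summand, and hence \<open>g\<close> those
  of the other. Limits in \<open>x\<close> are left to the norm estimate.\<close>

lemma essential_compressors:
  assumes "x \<in> cspan (normalizers D)"
  shows "essential_subset D (compressors v x)"
proof -
  have "csubspace {x. essential_subset D (compressors v x)}"
  proof (rule complex_vector.subspaceI)
    have "1 \<in> compressors v 0"
      using D_rules(1,11) by (auto simp: compressors_def map_zero iota.hom_zero intro!: bexI[of _ 0])
    then show "0 \<in> {x. essential_subset D (compressors v x)}"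
      using compressors_subset by (force simp: essential_subset_def)
  next
    fix x y
    assume "x \<in> {x. essential_subset D (compressors v x)}" "y \<in> {x. essential_subset D (compressors v x)}"
    then have x: "essential_subset D (compressors v x)" and y: "essential_subset D (compressors v y)"
      by simp_all
    have mem: "c * d \<in> compressors v (x + y)" if c: "c \<in> compressors v x" and d: "d \<in> compressors v y" for c d
    proof -
      have cD: "c \<in> D" and dD: "d \<in> D" using c d compressors_subset by blast+
      have "c * d \<in> compressors v x" by (rule compressors_mult[OF c dD])
      moreover have "c * d \<in> compressors v y"
        unfolding comm[OF cD dD] by (rule compressors_mult[OF d cD])
      ultimately obtain e f where e: "e \<in> D" "E (x * (c * d)) = \<iota> e"
          "E (star v * (x * (c * d)) * v) * \<iota> p = \<iota> (\<alpha> e) * \<iota> p"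
        and f: "f \<in> D" "E (y * (c * d)) = \<iota> f"
          "E (star v * (y * (c * d)) * v) * \<iota> p = \<iota> (\<alpha> f) * \<iota> p"
        unfolding compressors_def by blast
      have "E ((x + y) * (c * d)) = \<iota> (e + f)"
        using e f by (simp add: distrib_right map_add iota.hom_add)
      moreover have "E (star v * ((x + y) * (c * d)) * v) * \<iota> p = \<iota> (\<alpha> (e + f)) * \<iota> p"
        using e f by (simp add: distrib_right distrib_left map_add iota.hom_add \<alpha>_in)
      ultimately show ?thesis
        using e f cD dD by (auto simp: compressors_def D_rules)
    qed
    have "g = 0" if g: "g \<in> D" and z: "\<forall>j\<in>compressors v (x + y). g * j = 0" for g
    proof -
      have "g * c = 0" if c: "c \<in> compressors v x" for c
      proof -
        have "g * c \<in> D" using g c compressors_subset by (blast intro: D_rules(3))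
        moreover have "g * c * d = 0" if "d \<in> compressors v y" for d
          using z mem[OF c that] by (simp add: mult.assoc)
        ultimately show ?thesis using y by (simp add: essential_subset_def)
      qed
      then show ?thesis using x g by (simp add: essential_subset_def)
    qed
    then show "x + y \<in> {x. essential_subset D (compressors v x)}"
      using compressors_subset by (simp add: essential_subset_def)
  next
    fix a x
    assume "x \<in> {x. essential_subset D (compressors v x)}"
    then have x: "essential_subset D (compressors v x)" by simp
    have "compressors v x \<subseteq> compressors v (a *\<^sub>C x)"
    proof
      fix d assume "d \<in> compressors v x"
      then obtain e where "d \<in> D" "e \<in> D" "E (x * d) = \<iota> e"
        "E (star v * (x * d) * v) * \<iota> p = \<iota> (\<alpha> e) * \<iota> p"
        unfolding compressors_def by blast
      then show "d \<in> compressors v (a *\<^sub>C x)"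
        unfolding compressors_def
        by (auto simp: mult_scaleC_left mult_scaleC_right map_scaleC iota.hom_scaleC \<alpha>_in D_rules
            intro!: bexI[of _ "a *\<^sub>C e"])
    qed
    then show "a *\<^sub>C x \<in> {x. essential_subset D (compressors v x)}"
      using essential_subset_mono[OF x _ compressors_subset] by simp
  qed
  then have "cspan (normalizers D) \<subseteq> {x. essential_subset D (compressors v x)}"
    using essential_compressors_normalizer by (intro complex_vector.span_minimal) auto
  then show ?thesis using assms by blast
qed

text \<open>If \<open>g\<close> annihilates the conjugates, then \<open>v * g * star v\<close>,
  times \<open>v * star v\<close>, annihilates the compressors and vanishes. Conjugating back gives
  \<open>v * g = 0\<close>, so \<open>g\<close> lies in the second set and annihilates
  itself.\<close>

lemma essential_conj_compressors:
  assumes Q: "essential_subset D (compressors v x)"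
  shows "essential_subset D ((\<lambda>d. \<alpha> d) ` compressors v x \<union> {g \<in> D. v * g = 0})"
  unfolding essential_subset_def
proof (intro conjI ballI impI)
  show "(\<lambda>d. \<alpha> d) ` compressors v x \<union> {g \<in> D. v * g = 0} \<subseteq> D"
    using compressors_subset \<alpha>_in by blast
  fix g
  assume g: "g \<in> D" and z: "\<forall>j\<in>(\<lambda>d. \<alpha> d) ` compressors v x \<union> {g \<in> D. v * g = 0}. g * j = 0"
  let ?q = "v * star v" and ?u = "v * g * star v"
  have q: "?q \<in> D" and u: "?u \<in> D" using normalizer_modulus' normalizer_conj' v g by blast+
  have "?u * ?q * d = 0" if d: "d \<in> compressors v x" for d
  proof -
    have "d \<in> D" using d compressors_subset by blast
    then have "?u * ?q * d = ?u * (d * ?q)" using comm[OF q, of d] by (simp only: mult.assoc)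
    also have "\<dots> = v * (g * \<alpha> d) * star v" by (simp add: mult.assoc)
    also have "g * \<alpha> d = 0" using z d by blast
    finally show ?thesis by simp
  qed
  then have uq: "?u * ?q = 0" using Q D_rules(3)[OF u q] by (simp add: essential_subset_def)
  have "star v * (?u * ?q) * v = p * g * p * p" by (simp add: mult.assoc)
  then have "p * g * p * p = 0" using uq by simp
  then have gp: "g * p * p * p = 0" using comm[OF p_in g] by (simp only:)
  have sp: "star p = p" by (simp add: star_mult star_star)
  define y where "y = g * p"
  have y: "y \<in> D" using g p_in by (simp add: y_def D_rules)
  have "star (y * p) * (y * p) = p * star y * (g * p * p)" by (simp add: star_mult star_star y_def mult.assoc)
  also have "\<dots> = star y * (p * (g * p * p))" using comm[OF p_in D_rules(8)[OF y]] by (simp only: mult.assoc)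
  also have "p * (g * p * p) = g * p * p * p" using comm[OF p_in, of "g * p * p"] g p_in by (simp add: D_rules)
  finally have "y * p = 0" using gp by simp
  have "star y * y = p * star g * (g * p)" by (simp add: y_def star_mult star_star mult.assoc)
  also have "\<dots> = star g * (p * (g * p))" using comm[OF p_in D_rules(8)[OF g]] by (simp only: mult.assoc)
  also have "p * (g * p) = y * p" using comm[OF p_in, of "g * p"] g p_in by (simp add: y_def D_rules)
  finally have "y = 0" using \<open>y * p = 0\<close> by simp
  have "star (v * g) * (v * g) = star g * (p * g)" by (simp add: star_mult mult.assoc)
  also have "p * g = 0" using \<open>y = 0\<close> comm[OF p_in g] by (simp add: y_def)
  finally have "v * g = 0" by simp
  then have "g * g = 0" using z g by blast
  then show "g = 0" by (rule square_eq_0[OF g])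
qed

text \<open>The inequality \<open>star a * a \<le> r P^2\<close> in \<open>I(D)\<close> is checked
  on an essential set. Where \<open>v * j = 0\<close> both sides vanish; on conjugated compressors
  it comes from an inequality in \<open>D\<close>.\<close>

lemma norm_E_conj_le_span:
  assumes x: "x \<in> cspan (normalizers D)"
  shows "norm (E (star v * x * v)) \<le> (norm v)\<^sup>2 * norm (E x)"
proof -
  define r where "r = (norm (E x))\<^sup>2"
  define a where "a = E (star v * x * v)"
  define P where "P = \<iota> p"
  let ?x = "r *\<^sub>R (P * P) - star a * a"
  have sP: "star P = P" by (simp add: P_def star_iota_p)
  have r: "0 \<le> r" by (simp add: r_def)
  have "positive ?x"
  proof (rule essential_positive[OF essential_conj_compressors[OF essential_compressors[OF x]]])
    show "star ?x = ?x" by (simp add: star_diff star_scaleR star_mult star_star sP)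
    fix j assume "j \<in> (\<lambda>d. \<alpha> d) ` compressors v x \<union> {g \<in> D. v * g = 0}"
    then consider d where "d \<in> compressors v x" "j = \<alpha> d" | "j \<in> D" "v * j = 0" by blast
    then show "positive (?x * (star (\<iota> j) * \<iota> j))"
    proof cases
      case 2
      have "a * \<iota> j = E (star v * x * (v * j))"
        by (simp add: a_def E_right[OF 2(1), symmetric] mult.assoc)
      then have "a * \<iota> j = 0" using 2 by (simp add: map_zero)
      moreover have "P * \<iota> j = 0"
      proof -
        have "p * j = 0" using 2 by (simp add: mult.assoc)
        then show ?thesis
          using iota.hom_mult[OF p_in 2(1)] by (simp add: P_def iota.hom_zero)
      qed
      ultimately have "?x * \<iota> j = 0" by (simp add: left_diff_distrib mult.assoc)
      then have "?x * (star (\<iota> j) * \<iota> j) = 0"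
        by (simp only: i_left_comm[of ?x "star (\<iota> j)" "\<iota> j"] mult_zero_right)
      then show ?thesis by simp
    next
      case 1
      then obtain e where d: "d \<in> D" and e: "e \<in> D" "E (x * d) = \<iota> e"
        and ve: "E (star v * (x * d) * v) * \<iota> p = \<iota> (\<alpha> e) * \<iota> p"
        unfolding compressors_def by blast
      \<comment> \<open>Cut down by \<open>d\<close>, the inequality
        \<open>star (E x) * E x \<le> r\<close> says that \<iota> y is positive. Since
        \<open>y\<close> is in \<open>D\<close>, it can be conjugated by \<open>v\<close>.\<close>
      define y where "y = r *\<^sub>R (star d * d) - star e * e"
      have sd: "star d * d \<in> D" "star e * e \<in> D" using d e by (simp_all add: D_rules)
      have yD: "y \<in> D" using sd by (simp add: y_def D_rules)
      have "norm (star (E x) * E x) \<le> r" by (simp add: cstar_identity r_def)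
      then have "positive (star (\<iota> d) * (r *\<^sub>R 1 - star (E x) * E x) * \<iota> d)"
        by (intro positive_conj positive_norm_minus) (simp_all add: star_mult star_star)
      also have "star (\<iota> d) * (r *\<^sub>R 1 - star (E x) * E x) * \<iota> d =
          r *\<^sub>R (star (\<iota> d) * \<iota> d) - star (E x * \<iota> d) * (E x * \<iota> d)"
        by (simp add: right_diff_distrib left_diff_distrib star_mult mult.assoc)
      also have "\<dots> = \<iota> y"
        using d e(1) sd unfolding E_right[OF d, symmetric] e(2)
        by (simp add: y_def iota.hom_diff iota.hom_scaleR iota.hom_mult iota.hom_star D_rules)
      finally have "positive y" by (rule iota_reflects_positive[OF yD])
      then have "positive (\<alpha> y)" by (rule positive_conj)
      then have "positive (\<alpha> y * p)"
        by (rule positive_mult[OF _ positive_star_mult_self comm[OF \<alpha>_in[OF yD] p_in]])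
      then have "positive (star p * (\<alpha> y * p) * p)" by (rule positive_conj)
      then have "positive (\<iota> (star p * (\<alpha> y * p) * p))"
        using yD p_in \<alpha>_in by (intro iota.hom_positive) (simp_all add: D_rules)
      \<comment> \<open>Of the three factors \<open>p\<close>, one turns
        \<open>\<alpha> (star f * f)\<close> into \<open>star (\<alpha> f) * \<alpha> f\<close>; the
        other two supply \<open>P * P\<close>.\<close>
      moreover have "\<iota> (star p * (\<alpha> y * p) * p) = ?x * (star (\<iota> j) * \<iota> j)"
      proof -
        have sq: "star (\<alpha> f) * \<alpha> f = \<alpha> (star f * f) * p" if "f \<in> D" for f
          using \<alpha>_mult[OF D_rules(8)[OF that] that] by (simp add: star_mult star_star mult.assoc)
        have aj: "a * \<iota> j = \<iota> (\<alpha> e) * P"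
          using E_conj_right[OF d, of x] ve by (simp add: a_def 1 P_def)
        have ia: "star (\<iota> (\<alpha> f)) * \<iota> (\<alpha> f) = \<iota> (\<alpha> (star f * f)) * P" if "f \<in> D" for f
          using that sq[OF that] \<alpha>_in p_in
          by (simp add: P_def iota.hom_mult[symmetric] iota.hom_star[symmetric] D_rules)
        have "\<alpha> y = r *\<^sub>R \<alpha> (star d * d) - \<alpha> (star e * e)"
          by (simp add: y_def right_diff_distrib left_diff_distrib)
        then have "\<iota> (\<alpha> y) = r *\<^sub>R \<iota> (\<alpha> (star d * d)) - \<iota> (\<alpha> (star e * e))"
          using sd \<alpha>_in by (simp add: iota.hom_diff iota.hom_scaleR D_rules)
        then have "P * (\<iota> (\<alpha> y) * P) * P =
            r *\<^sub>R (P * P * (star (\<iota> (\<alpha> d)) * \<iota> (\<alpha> d))) - P * P * (star (\<iota> (\<alpha> e)) * \<iota> (\<alpha> e))"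
          unfolding ia[OF d] ia[OF e(1)] by (simp add: right_diff_distrib left_diff_distrib i_ac)
        also have "P * P * (star (\<iota> (\<alpha> e)) * \<iota> (\<alpha> e)) = star (a * \<iota> j) * (a * \<iota> j)"
          unfolding aj by (simp add: star_mult sP i_ac)
        also have "\<dots> = star a * a * (star (\<iota> j) * \<iota> j)" by (simp add: star_mult i_ac)
        finally have "P * (\<iota> (\<alpha> y) * P) * P = ?x * (star (\<iota> j) * \<iota> j)"
          by (simp add: 1 left_diff_distrib)
        moreover have "star p = p" by (simp add: star_mult star_star)
        then have "\<iota> (star p * (\<alpha> y * p) * p) = P * (\<iota> (\<alpha> y) * P) * P"
          using yD \<alpha>_in p_in by (simp add: P_def iota.hom_mult D_rules)
        ultimately show ?thesis by simp
      qed
      ultimately show ?thesis by simp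
    qed
  qed
  then have "norm (star a * a) \<le> norm (r *\<^sub>R (P * P))"
    by (rule norm_le_if_positive[OF positive_star_mult_self])
  also have "\<dots> \<le> r * (norm P)\<^sup>2"
    using r norm_mult_ineq[of P P] by (simp add: power2_eq_square mult_left_mono)
  also have "\<dots> \<le> r * ((norm v)\<^sup>2)\<^sup>2"
    using r iota.norm_hom_le[OF p_in]
    by (intro mult_left_mono power_mono) (simp_all add: P_def cstar_identity)
  finally have "(norm a)\<^sup>2 \<le> ((norm v)\<^sup>2 * norm (E x))\<^sup>2"
    by (simp add: cstar_identity r_def power_mult_distrib mult.commute)
  then show ?thesis unfolding a_def by (rule power2_le_imp_le) simp
qed

text \<open>Both sides are continuous in \<open>x\<close>, and the span of the normalizers is
  dense.\<close>

lemma norm_E_conj_le: "norm (E (star v * x * v)) \<le> (norm v)\<^sup>2 * norm (E x)"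
proof -
  have cE: "continuous_on UNIV E" by (rule linear_continuous_on[OF bounded_linear_map])
  have "continuous_on UNIV (\<lambda>x. E (star v * x * v))"
    by (rule continuous_on_compose2[OF cE]) (auto intro!: continuous_intros)
  with cE have "closed {x. norm (E (star v * x * v)) \<le> (norm v)\<^sup>2 * norm (E x)}"
    by (intro closed_Collect_le continuous_intros)
  then have "closure (cspan (normalizers D)) \<subseteq> {x. norm (E (star v * x * v)) \<le> (norm v)\<^sup>2 * norm (E x)}"
    using norm_E_conj_le_span by (intro closure_minimal) auto
  then show ?thesis using dense by auto
qed

end

section \<open>The left kernel is the largest ideal meeting \<open>D\<close> trivially\<close>

lemma left_kernel_mult_left:
  assumes "x \<in> left_kernel E"
  shows "a * x \<in> left_kernel E"
proof -
  have "positive ((norm a)\<^sup>2 *\<^sub>R 1 - star a * a)"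
    by (rule positive_norm_minus) (simp_all add: star_mult star_star cstar_identity)
  then have "positive (E (star x * ((norm a)\<^sup>2 *\<^sub>R 1 - star a * a) * x))"
    by (intro map_positive positive_conj)
  moreover have "star x * ((norm a)\<^sup>2 *\<^sub>R 1 - star a * a) * x =
      (norm a)\<^sup>2 *\<^sub>R (star x * x) - star (a * x) * (a * x)"
    by (simp add: star_mult right_diff_distrib left_diff_distrib mult.assoc)
  ultimately have "positive (- E (star (a * x) * (a * x)))"
    using assms by (simp add: left_kernel_def map_diff map_scaleR)
  moreover have "positive (E (star (a * x) * (a * x)))"
    by (intro map_positive positive_star_mult_self)
  ultimately have "E (star (a * x) * (a * x)) = 0" by (intro positive_antisym)
  then show ?thesis by (simp only: left_kernel_def mem_Collect_eq)
qed

lemma left_kernel_E_mult: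
  assumes "x \<in> left_kernel E"
  shows "E (y * x) = 0"
proof -
  have "E (star (y * x) * (y * x)) = 0"
    using left_kernel_mult_left[OF assms] by (simp add: left_kernel_def)
  then have "positive (- (star (E (y * x)) * E (y * x)))"
    using schwarz[of "y * x"] by simp
  then have "star (E (y * x)) * E (y * x) = 0"
    by (intro positive_antisym positive_star_mult_self)
  then show ?thesis by simp
qed

lemma csubspace_left_kernel: "csubspace (left_kernel E)"
proof (rule complex_vector.subspaceI)
  show "0 \<in> left_kernel E" by (simp add: left_kernel_def map_zero)
  show "x + y \<in> left_kernel E" if "x \<in> left_kernel E" "y \<in> left_kernel E" for x y
    using left_kernel_E_mult[OF that(1)] left_kernel_E_mult[OF that(2)]
    by (simp add: left_kernel_def distrib_left map_add)
  show "a *\<^sub>C x \<in> left_kernel E" if "x \<in> left_kernel E" for a x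
    using left_kernel_E_mult[OF that] by (simp add: left_kernel_def mult_scaleC_right map_scaleC)
qed

lemma closed_left_kernel: "closed (left_kernel E)"
proof -
  have "continuous_on UNIV (\<lambda>x :: 'c. star x * x)"
    by (rule continuous_on_mult[OF linear_continuous_on[OF bounded_linear_star] continuous_on_id])
  then have "continuous_on UNIV (\<lambda>x. E (star x * x))"
    by (rule continuous_on_compose2[OF linear_continuous_on[OF bounded_linear_map, of UNIV]]) simp
  then show ?thesis unfolding left_kernel_def by (intro closed_Collect_eq continuous_on_const)
qed

text \<open>The admissible right factors form a closed subspace, which contains each normalizer by
  the norm estimate applied to \<open>star x * x\<close>.\<close>

lemma left_kernel_mult_right:
  assumes "x \<in> left_kernel E"
  shows "x * a \<in> left_kernel E"
proof -
  let ?R = "{a. x * a \<in> left_kernel E}"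
  have N: "v \<in> ?R" if "v \<in> normalizers D" for v
  proof -
    have "norm (E (star v * (star x * x) * v)) \<le> (norm v)\<^sup>2 * norm (E (star x * x))"
      by (rule norm_E_conj_le[OF that])
    then have "E (star v * (star x * x) * v) = 0" using assms by (simp add: left_kernel_def)
    then show ?thesis by (simp add: left_kernel_def star_mult mult.assoc)
  qed
  have "csubspace ?R"
    using csubspace_left_kernel
    by (intro complex_vector.subspaceI)
      (simp_all add: distrib_left mult_scaleC_right complex_vector.subspace_0 complex_vector.subspace_add
        complex_vector.subspace_scale)
  then have "cspan (normalizers D) \<subseteq> ?R"
    using N by (intro complex_vector.span_minimal) auto
  moreover have "closed ?R"
  proof -
    have "closed ((\<lambda>a. x * a) -` left_kernel E)"
      by (rule closed_vimage[OF closed_left_kernel]) (intro continuous_intros)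
    then show ?thesis by (simp add: vimage_def)
  qed
  ultimately have "closure (cspan (normalizers D)) \<subseteq> ?R" by (rule closure_minimal)
  then show ?thesis using dense by auto
qed

lemma cstar_ideal_left_kernel: "cstar_ideal (left_kernel E)"
  unfolding cstar_ideal_def
  by (simp add: csubspace_left_kernel closed_left_kernel left_kernel_mult_left left_kernel_mult_right)

lemma left_kernel_Int: "left_kernel E \<inter> D = {0}"
proof -
  have "d = 0" if "d \<in> left_kernel E" "d \<in> D" for d
  proof -
    have "star d * d \<in> D" using that(2) by (simp add: D_rules)
    moreover from this have "\<iota> (star d * d) = 0" using that(1) by (simp add: left_kernel_def E_iota)
    ultimately have "star d * d = 0" by (rule iota_eq_0)
    then show ?thesis by simp
  qed
  moreover have "0 \<in> left_kernel E \<inter> D"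
    using D_rules(1) by (simp add: left_kernel_def map_zero)
  ultimately show ?thesis by blast
qed

text \<open>The map \<open>d + k \<mapsto> \<iota> d\<close> extends to a pseudo-expectation vanishing on the ideal, and \<open>E\<close> is
  the only pseudo-expectation. Ideals are self-adjoint, but passing to \<open>K \<inter> K\<^sup>*\<close> avoids the proof.\<close>

lemma ideal_subset_left_kernel:
  assumes K: "cstar_ideal K" "K \<inter> D = {0}"
  shows "K \<subseteq> left_kernel E"
proof
  fix x assume x: "x \<in> K"
  define L where "L = {y. y \<in> K \<and> star y \<in> K}"
  have sK: "csubspace K" and cK: "closed K" and mK: "y \<in> K \<Longrightarrow> a * y \<in> K" "y \<in> K \<Longrightarrow> y * a \<in> K" for a y
    using K(1) by (auto simp: cstar_ideal_def)
  have L: "star_hom_mod_ideal D (\<lambda>d. d) L"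
  proof
    show "cstar_subalgebra D" by (rule sub)
    show "1 \<in> D" by (rule one_mem)
    show "unital_star_hom_on D (\<lambda>d. d)" by (simp add: unital_star_hom_on_def)
    show "cstar_ideal L"
      unfolding cstar_ideal_def
    proof (intro conjI allI ballI)
      show "csubspace L"
        using sK unfolding complex_vector.subspace_def L_def by (simp add: star_add star_scaleC)
      have "continuous_on UNIV (star :: 'c \<Rightarrow> 'c)"
        by (rule linear_continuous_on[OF bounded_linear_star])
      then have "closed (K \<inter> star -` K)" using cK by (intro closed_Int closed_vimage) auto
      moreover have "L = K \<inter> star -` K" by (auto simp: L_def)
      ultimately show "closed L" by simp
      show "a * y \<in> L" "y * a \<in> L" if "y \<in> L" for a y
        using that mK by (simp_all add: L_def star_mult)
    qed
    show "star y \<in> L" if "y \<in> L" for y using that by (simp add: L_def star_star)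
    show "d = 0" if "d \<in> D" "d \<in> L" for d using that K(2) by (auto simp: L_def)
  qed
  have "inj (\<lambda>(x :: 'c) (g :: 'c + 'i \<Rightarrow> complex). g (Inl x))"
  proof (rule injI)
    fix x y :: 'c assume "(\<lambda>g :: 'c + 'i \<Rightarrow> complex. g (Inl x)) = (\<lambda>g. g (Inl y))"
    from fun_cong[OF this, of "\<lambda>z. if z = Inl x then 1 else 0"] show "x = y" by (simp split: if_splits)
  qed
  then obtain F where F: "ucp univ_cstar UNIV univ_cstar UNIV F" "\<forall>d\<in>D. F d = \<iota> d" "\<forall>k\<in>L. F k = 0"
    using star_hom_mod_ideal.ucp_extension_mod_ideal[OF L iota_hom injective] by blast
  have "pseudo_exp D \<iota> F"
    by unfold_locales (simp add: pseudo_expectation_def F)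
  then have "E = F" by (rule pseudo_exp_unique[OF pseudo_exp_axioms])
  \<comment> \<open>\<open>star x * x\<close> is self-adjoint and in \<open>K\<close>, hence in
    \<open>L\<close>; membership in the left kernel concerns only this element.\<close>
  moreover have "star x * x \<in> L" using mK(1)[OF x] by (simp add: L_def star_mult star_star)
  ultimately show "x \<in> left_kernel E" using F(3) by (simp add: left_kernel_def)
qed

end

theorem theorem3p22:
  fixes D :: "'c :: cstar_algebra set"
    and \<iota> :: "'c \<Rightarrow> 'i :: cstar_algebra"
    and E :: "'c \<Rightarrow> 'i"
  assumes "regular_masa_inclusion D"
    and "injective_envelope TYPE(('c, 'i) test_universe) D \<iota>"
    and "pseudo_expectation D \<iota> E"
  shows "cstar_ideal (left_kernel E) \<and> left_kernel E \<inter> D = {0} \<and>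
    (\<forall>K. cstar_ideal K \<and> K \<inter> D = {0} \<longrightarrow> K \<subseteq> left_kernel E)"
proof -
  interpret pseudo_exp D \<iota> E by (unfold_locales) (rule assms)+
  show ?thesis
    using cstar_ideal_left_kernel left_kernel_Int ideal_subset_left_kernel by blast
qed

end
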